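(* Let $p$ be a prime number and let $K = \mathbb{F}_p(z_1, \ldots, z_r)$ be a finitely generated field over $\mathbb{F}_p$. Let $a, b \in K^\ast$ be given. Then there is a finite set $\mathcal{T} \subseteq K^2$ such that the following holds. For every $x, y \in K$ and all integers $m, n > 1$, both coprime with $p$, satisfying $(m, n) \notin \{(2, 2), (2, 3), (3, 2), (2, 4), (4, 2), (3, 3)\}$ and $$a x^m + b y^n = 1,$$ there exist $(\gamma, \delta) \in \mathcal{T}$ and $t \in \mathbb{Z}_{\geq 0}$ such that $$a x^m = \gamma^{p^t} \quad \text{and} \quad b y^n = \delta^{p^t}.$$
   Context: The generators $z_1, \ldots, z_r$ of $K$ over $\mathbb{F}_p$ are not assumed to be algebraically independent; $K$ is an arbitrary finitely generated field extension of $\mathbb{F}_p$. $K^\ast$ denotes the set of nonzero elements of $K$. *)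

theory Defs
  imports
    "HOL-Algebra.Generated_Fields"
    "HOL-Algebra.Algebraic_Closure_Type"
    "HOL-Computational_Algebra.Computational_Algebra"
begin

text \<open>
  \<^const>\<open>ring_of_type_algebra\<close> is the type-class field regarded as a ring record whose carrier is
  the whole type, so \<^const>\<open>generate_field\<close> applied to it gives the smallest subfield containing a
  set. It contains the prime field, which makes it the field extension of
  the prime field generated by that set.
\<close>
abbreviation generated_subfield :: "'a::field set \<Rightarrow> 'a set" where
  "generated_subfield Z \<equiv> generate_field (ring_of_type_algebra :: 'a ring) Z"

end

theory Submission
  imports Defs
begin

text \<open>
  After replacing everything by a power with exponent \<open>p\<^sup>e\<close>, the field lies in a finite separable
  extension \<open>L\<close> of a rational function field over the prime field, inside an algebraic closure.
  Such an \<open>L\<close> carries valuations satisfying a product formula with the Northcott finiteness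
  property, and finitely many derivations whose common kernel is \<open>L\<^sup>p\<close>; both are lifted one
  extension at a time. For \<open>u = a x\<^sup>m\<close> and \<open>1 - u = b y\<^sup>n\<close> extract \<open>p\<close>-th roots of \<open>u\<close> until
  reaching some \<open>\<gamma>\<close> that is not a \<open>p\<close>-th power; if this never ends, \<open>u\<close> has height 0. As \<open>m\<close> and
  \<open>n\<close> are prime to \<open>p\<close>, outside finitely many places the zeros of \<open>\<gamma>\<close> and of \<open>1 - \<gamma>\<close> and their common
  poles have orders divisible by \<open>m\<close>, \<open>n\<close> and \<open>lcm m n\<close>. Some derivation does not kill \<open>\<gamma>\<close>, and
  comparing these zeros and poles with those of the derivative of \<open>\<gamma>\<close>, as in the Mason--Stothers
  theorem, bounds the height of \<open>\<gamma>\<close> as soon as \<open>1/m + 1/n + 1/lcm m n < 1\<close>, which fails only for the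
  excluded exponents; so there are finitely many \<open>\<gamma>\<close>. The power with exponent
  \<open>p\<^sup>e\<close> is undone by choosing, for each of the finitely many values, the least Frobenius twist that
  comes from the given field.
\<close>

hide_const (open) Polynomials.degree Divisibility.prime up_ring.coeff up_ring.monom

section \<open>Subfields and polynomials over them\<close>

text \<open>Places of an extension are not found through residue fields and ramification. Each
  valuation gets one extension to the algebraic elements of the ambient field, and the places above
  it are indexed by the embeddings \<open>\<sigma> l\<close> of the extension, repetitions allowed,
  so that the product formula upstairs is the one for the norm downstairs. The price is that
  extended values are a priori only real. Integrality at almost all places, without which
  divisibility of orders by m and n makes no sense, is regained from derivations: if a derivation
  sends a uniformizer of the base to a unit and its lift preserves integral elements, no fractional
  value can occur. Bounding a lifted derivation at one embedding meets the obstacle that an element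
  integral there may have poles at the others; the recursion \<open>sylvester\<close> removes it.
  The exponent e is forced because the given generators may be inseparable over the transcendental
  ones picked among them.\<close>

locale subring_set =
  fixes R :: "'b::field set"
  assumes zero_mem [simp, intro]: "0 \<in> R"
    and one_mem [simp, intro]: "1 \<in> R"
    and add_mem [intro]: "x \<in> R \<Longrightarrow> y \<in> R \<Longrightarrow> x + y \<in> R"
    and uminus_mem [intro]: "x \<in> R \<Longrightarrow> - x \<in> R"
    and mult_mem [intro]: "x \<in> R \<Longrightarrow> y \<in> R \<Longrightarrow> x * y \<in> R"
begin

lemma diff_mem [intro]: "x \<in> R \<Longrightarrow> y \<in> R \<Longrightarrow> x - y \<in> R"
  using add_mem[of x "- y"] uminus_mem by simp

lemma power_mem [intro]: "x \<in> R \<Longrightarrow> x ^ n \<in> R"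
  by (induction n) auto

lemma sum_mem [intro]: "(\<And>i. i \<in> I \<Longrightarrow> f i \<in> R) \<Longrightarrow> sum f I \<in> R"
  by (induction I rule: infinite_finite_induct) auto

lemma prod_mem [intro]: "(\<And>i. i \<in> I \<Longrightarrow> f i \<in> R) \<Longrightarrow> prod f I \<in> R"
  by (induction I rule: infinite_finite_induct) auto

lemma of_nat_mem [intro, simp]: "of_nat n \<in> R"
  by (induction n) auto

lemma of_int_mem [intro, simp]: "of_int n \<in> R"
  by (cases n rule: int_cases) (auto simp del: of_nat_Suc)

end

text \<open>Subfields are subsets of one fixed field type. A polynomial over L is therefore one of
  the ambient type with coefficients in L, and \<open>dvd\<close>, \<open>div\<close> and
  \<open>mod\<close> keep their ambient meaning.\<close>

definition polys :: "'b::zero set \<Rightarrow> 'b poly set" where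
  "polys L = {A. \<forall>i. coeff A i \<in> L}"

lemma polysI: "(\<And>i. coeff A i \<in> L) \<Longrightarrow> A \<in> polys L"
  and coeff_polys [intro]: "A \<in> polys L \<Longrightarrow> coeff A i \<in> L"
  by (auto simp: polys_def)

lemma polys_mono: "L \<subseteq> M \<Longrightarrow> polys L \<subseteq> polys M"
  by (auto simp: polys_def)

context subring_set
begin

lemma polys_0 [simp, intro]: "0 \<in> polys R"
  and polys_1 [simp, intro]: "1 \<in> polys R"
  and polys_add [intro]: "A \<in> polys R \<Longrightarrow> B \<in> polys R \<Longrightarrow> A + B \<in> polys R"
  and polys_diff [intro]: "A \<in> polys R \<Longrightarrow> B \<in> polys R \<Longrightarrow> A - B \<in> polys R"
  and polys_uminus [intro]: "A \<in> polys R \<Longrightarrow> - A \<in> polys R"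
  and polys_smult [intro]: "c \<in> R \<Longrightarrow> A \<in> polys R \<Longrightarrow> smult c A \<in> polys R"
  and polys_mult [intro]: "A \<in> polys R \<Longrightarrow> B \<in> polys R \<Longrightarrow> A * B \<in> polys R"
  and polys_monom [intro]: "c \<in> R \<Longrightarrow> Polynomial.monom c n \<in> polys R"
  and polys_pderiv [intro]: "A \<in> polys R \<Longrightarrow> pderiv A \<in> polys R"
  by (auto simp: polys_def coeff_pCons coeff_1 coeff_mult coeff_pderiv simp del: of_nat_Suc)

lemma polys_pCons [intro]: "c \<in> R \<Longrightarrow> A \<in> polys R \<Longrightarrow> pCons c A \<in> polys R"
  by (auto simp: polys_def coeff_pCons split: nat.splits)

lemma pCons_polys_iff: "pCons c A \<in> polys R \<longleftrightarrow> c \<in> R \<and> A \<in> polys R"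
  by (auto simp: polys_def coeff_pCons split: nat.splits)

lemma polys_power [intro]: "A \<in> polys R \<Longrightarrow> A ^ n \<in> polys R"
  by (induction n) auto

lemma polys_sum [intro]: "(\<And>i. i \<in> I \<Longrightarrow> f i \<in> polys R) \<Longrightarrow> sum f I \<in> polys R"
  by (induction I rule: infinite_finite_induct) auto

lemma poly_mem [intro]: "A \<in> polys R \<Longrightarrow> x \<in> R \<Longrightarrow> poly A x \<in> R"
  by (auto simp: poly_altdef)

lemma polys_pcompose [intro]: "A \<in> polys R \<Longrightarrow> B \<in> polys R \<Longrightarrow> pcompose A B \<in> polys R"
proof (induction A)
  case (pCons a A)
  then show ?case by (auto simp: pcompose_pCons pCons_polys_iff)
qed auto

end

locale subfield_set = subring_set L for L :: "'b::field set" +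
  assumes inverse_mem [intro]: "x \<in> L \<Longrightarrow> inverse x \<in> L"
begin

lemma divide_mem [intro]: "x \<in> L \<Longrightarrow> y \<in> L \<Longrightarrow> x / y \<in> L"
  by (simp add: divide_inverse inverse_mem mult_mem)

lemma power_int_mem [intro]: "x \<in> L \<Longrightarrow> x powi n \<in> L"
  by (auto simp: power_int_def)

text \<open>Cancelling leading terms stays inside L, and uniqueness of quotient and remainder
  identifies the outcome with the ambient operations. Hence ambient divisibility between polynomials
  over L is divisibility over L.\<close>

lemma polys_div_mod:
  assumes "A \<in> polys L" "B \<in> polys L"
  shows "A div B \<in> polys L" "A mod B \<in> polys L"
proof -
  have "A div B \<in> polys L \<and> A mod B \<in> polys L"
  proof (cases "B = 0")
    case False
    have "\<exists>Q R. Q \<in> polys L \<and> R \<in> polys L \<and> A = Q * B + R \<and> (R = 0 \<or> degree R < degree B)"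
      using assms(1)
    proof (induction "degree A" arbitrary: A rule: less_induct)
      case less
      show ?case
      proof (cases "A = 0 \<or> degree A < degree B")
        case True
        then show ?thesis using less.prems by (intro exI[of _ 0] exI[of _ A]) auto
      next
        case nlt: False
        define c where "c = lead_coeff A / lead_coeff B"
        define n where "n = degree A - degree B"
        define M where "M = Polynomial.monom c n"
        have c0: "c \<noteq> 0" using nlt False by (auto simp: c_def)
        have M: "M \<in> polys L" using less.prems assms(2) by (auto simp: M_def c_def)
        have dM: "degree (M * B) = degree A"
        proof -
          have "degree M = n" "M \<noteq> 0" using c0 by (auto simp: M_def degree_monom_eq monom_eq_0_iff)
          then show ?thesis using False nlt by (subst degree_mult_eq) (auto simp: n_def)
        qed
        have lc: "lead_coeff (M * B) = lead_coeff A"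
        proof -
          have "lead_coeff M = c" unfolding M_def by (rule lead_coeff_monom)
          then show ?thesis using False by (simp add: lead_coeff_mult c_def)
        qed
        define A' where "A' = A - M * B"
        have A': "A' \<in> polys L" using less.prems M assms by (auto simp: A'_def)
        show ?thesis
        \<comment> \<open>A constant is treated apart: cancelling its leading term gives 0, whose
          degree is again 0, so the induction would not descend.\<close>
        proof (cases "degree A = 0")
          case True
          then obtain a where a: "A = [:a:]" by (elim degree_eq_zeroE)
          from True nlt have "degree B = 0" by auto
          then obtain b where b: "B = [:b:]" by (elim degree_eq_zeroE)
          have "a \<in> L" "b \<in> L" using less.prems assms(2) by (auto simp: a b pCons_polys_iff)
          then show ?thesis using False
            by (intro exI[of _ "[:a / b:]"] exI[of _ 0]) (auto simp: a b)
        next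
          case dA: False
          have "degree A' < degree A"
            unfolding A'_def using dM lc dA
            by (metis coeff_diff degree_diff_le diff_self eq_zero_or_degree_less le_refl degree_0 bot_nat_0.not_eq_extremum)
          from less.hyps[OF this A'] obtain Q R where
            "Q \<in> polys L" "R \<in> polys L" "A' = Q * B + R" "R = 0 \<or> degree R < degree B" by blast
          then show ?thesis using M
            by (intro exI[of _ "Q + M"] exI[of _ R]) (auto simp: A'_def algebra_simps)
        qed
      qed
    qed
    then obtain Q R where QR: "Q \<in> polys L" "R \<in> polys L" "A = Q * B + R" "R = 0 \<or> degree R < degree B"
      by blast
    have "R div B = 0" using QR(4) by (auto simp: div_poly_less)
    then have "A div B = Q" using QR(3) False by simp
    moreover have "A mod B = A - A div B * B" by (rule minus_div_mult_eq_mod[symmetric])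
    ultimately show ?thesis using QR by simp
  qed (use assms in auto)
  then show "A div B \<in> polys L" "A mod B \<in> polys L" by auto
qed

lemma bezout_polys:
  assumes "A \<in> polys L" "B \<in> polys L"
  shows "\<exists>U W. U \<in> polys L \<and> W \<in> polys L \<and> U * A + W * B dvd A \<and> U * A + W * B dvd B"
  using assms
\<comment> \<open>The shift by one puts the zero polynomial below the nonzero constants, which have
  the same degree 0.\<close>
proof (induction "if B = 0 then 0 else Suc (degree B)" arbitrary: A B rule: less_induct)
  case less
  show ?case
  proof (cases "B = 0")
    case True
    then show ?thesis by (intro exI[of _ 1] exI[of _ 0]) auto
  next
    case False
    have "(if A mod B = 0 then 0 else Suc (degree (A mod B))) < (if B = 0 then 0 else Suc (degree B))"
      using False degree_mod_less[of B A] by auto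
    from less.hyps[OF this less.prems(2) polys_div_mod(2)[OF less.prems]]
    obtain U W where UW: "U \<in> polys L" "W \<in> polys L"
      "U * B + W * (A mod B) dvd B" "U * B + W * (A mod B) dvd A mod B" by blast
    have eq: "U * B + W * (A mod B) = W * A + (U - W * (A div B)) * B"
      by (simp add: algebra_simps minus_div_mult_eq_mod[symmetric])
    have "U * B + W * (A mod B) dvd A"
      using UW(3,4) by (metis dvd_mod_imp_dvd)
    then show ?thesis using UW less.prems polys_div_mod[OF less.prems]
      by (intro exI[of _ W] exI[of _ "U - W * (A div B)"]) (auto simp flip: eq)
  qed
qed

end

text \<open>Being monic is part of the definition, so that each class of associates has one
  representative; these representatives later index places.\<close>

definition irred_over :: "'b::field set \<Rightarrow> 'b poly \<Rightarrow> bool" where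
  "irred_over L P \<longleftrightarrow> P \<in> polys L \<and> lead_coeff P = 1 \<and> degree P > 0 \<and>
     (\<forall>A\<in>polys L. \<forall>B\<in>polys L. P = A * B \<longrightarrow> degree A = 0 \<or> degree B = 0)"

lemma irred_overD:
  assumes "irred_over L P"
  shows "P \<in> polys L" "lead_coeff P = 1" "degree P > 0" "P \<noteq> 0"
  using assms by (auto simp: irred_over_def)

context subfield_set
begin

text \<open>The common divisor supplied by \<open>bezout_polys\<close> divides P, so it is a
  constant or an associate of P, and the latter would make P divide A.\<close>

lemma irred_over_bezout:
  assumes P: "irred_over L P" and A: "A \<in> polys L" and nd: "\<not> P dvd A"
  shows "\<exists>U W. U \<in> polys L \<and> W \<in> polys L \<and> U * P + W * A = 1"
proof -
  note PL = irred_overD[OF P]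
  obtain U W where UW: "U \<in> polys L" "W \<in> polys L" and d: "U * P + W * A dvd P" "U * P + W * A dvd A"
    using bezout_polys[OF PL(1) A] by blast
  define G where "G = U * P + W * A"
  have G: "G \<in> polys L" using UW PL A by (auto simp: G_def)
  have eq: "P = G * (P div G)" using d(1) by (simp add: G_def)
  have "P div G \<in> polys L" using polys_div_mod[OF PL(1) G] by simp
  then have "degree G = 0 \<or> degree (P div G) = 0" using P eq G by (auto simp: irred_over_def)
  then have "degree G = 0"
  proof
    assume "degree (P div G) = 0"
    then obtain c where c: "P div G = [:c:]" by (elim degree_eq_zeroE)
    have "c \<noteq> 0" using eq PL c by auto
    have "P = smult c G" using eq c by simp
    then have "P dvd G" using \<open>c \<noteq> 0\<close> by (simp add: smult_dvd_iff)
    then show ?thesis using d(2) nd G_def dvd_trans by blast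
  qed
  then obtain c where c: "G = [:c:]" by (elim degree_eq_zeroE)
  have c0: "c \<noteq> 0" using eq PL c by auto
  have cL: "inverse c \<in> L" using G c by (auto simp: pCons_polys_iff)
  have "smult (inverse c) U * P + smult (inverse c) W * A = smult (inverse c) G"
    by (simp add: G_def smult_add_right)
  also have "\<dots> = 1" using c c0 by simp
  finally show ?thesis using UW cL by blast
qed

lemma irred_over_dvd_mult:
  assumes P: "irred_over L P" and A: "A \<in> polys L" and d: "P dvd A * B"
  shows "P dvd A \<or> P dvd B"
proof (rule disjCI)
  assume n: "\<not> P dvd B"
  show "P dvd A"
  proof (rule ccontr)
    assume "\<not> P dvd A"
    then obtain U W where "U * P + W * A = 1" using irred_over_bezout[OF P A] by blast
    then have "B = (U * P + W * A) * B" by simp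
    also have "\<dots> = P * (U * B) + W * (A * B)" by (simp add: algebra_simps)
    finally have "P dvd B" using d by (metis dvd_add dvd_mult dvd_triv_left)
    then show False using n by simp
  qed
qed

lemma exists_irred_factor:
  assumes "A \<in> polys L" "degree A > 0"
  shows "\<exists>P. irred_over L P \<and> P dvd A"
  using assms
proof (induction "degree A" arbitrary: A rule: less_induct)
  case less
  define A1 where "A1 = smult (inverse (lead_coeff A)) A"
  have A1: "A1 \<in> polys L" "lead_coeff A1 = 1" "degree A1 = degree A" "A1 dvd A"
    using less.prems by (auto simp: A1_def smult_dvd_iff)
  show ?case
  proof (cases "irred_over L A1")
    case True
    then show ?thesis using A1 by auto
  next
    case False
    then obtain B C where BC: "B \<in> polys L" "C \<in> polys L" "A1 = B * C" "degree B > 0" "degree C > 0"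
      using A1 less.prems by (auto simp: irred_over_def)
    have "degree B < degree A"
      using BC A1 by (metis degree_0 degree_mult_eq less_add_same_cancel1 not_less_zero mult_zero_left mult_zero_right)
    from less.hyps[OF this BC(1,4)] show ?thesis using A1(4) BC(3) by (metis dvd_mult2 dvd_trans dvd_refl)
  qed
qed

text \<open>Irreducible factors of A that do not vanish at z are divided off until one vanishes
  there.\<close>

lemma exists_min_poly:
  assumes "A \<in> polys L" "A \<noteq> 0" "poly A z = 0"
  shows "\<exists>P. irred_over L P \<and> poly P z = 0"
  using assms
proof (induction "degree A" arbitrary: A rule: less_induct)
  case less
  have "degree A > 0"
    using less.prems by (metis degree_eq_zeroE gr0I pCons_0_0 poly_const_conv)
  then obtain P where P: "irred_over L P" "P dvd A" using exists_irred_factor less.prems by blast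
  show ?case
  proof (cases "poly P z = 0")
    case False
    have eq: "A = P * (A div P)" using P by simp
    have "poly (A div P) z = 0" using eq less.prems(3) False by (metis mult_eq_0_iff poly_mult)
    moreover have "A div P \<noteq> 0" using eq less.prems by auto
    moreover have "A div P \<in> polys L" using polys_div_mod irred_overD[OF P(1)] less.prems by blast
    moreover have "degree (A div P) < degree A"
      using eq \<open>A div P \<noteq> 0\<close> irred_overD[OF P(1)] by (metis degree_mult_eq less_add_same_cancel2)
    ultimately show ?thesis using less.hyps by blast
  qed (use P in auto)
qed

text \<open>Otherwise a Bezout identity U P + W A = 1, evaluated at z, would read 0 = 1.\<close>

lemma irred_over_root_dvd:
  assumes P: "irred_over L P" and "poly P z = 0" and A: "A \<in> polys L" "poly A z = 0"
  shows "P dvd A"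
proof (rule ccontr)
  assume "\<not> P dvd A"
  then obtain U W where "U * P + W * A = 1" using irred_over_bezout[OF P A(1)] by blast
  then have "poly (U * P + W * A) z = 1" by simp
  then show False using assms by simp
qed

end

section \<open>Multiplicity of a factor in a polynomial\<close>

definition pord :: "'b::field poly \<Rightarrow> 'b poly \<Rightarrow> nat" where
  "pord P A = Max {n. P ^ n dvd A}"

lemma pord_aux:
  fixes P A :: "'b::field poly"
  assumes "degree P > 0" "A \<noteq> 0"
  shows "finite {n. P ^ n dvd A}"
proof (rule finite_subset)
  have "n \<le> degree A" if "P ^ n dvd A" for n
  proof -
    have "degree (P ^ n) \<le> degree A" using that assms(2) by (rule dvd_imp_degree_le)
    moreover have "degree (P ^ n) = n * degree P" using assms by (intro degree_power_eq) auto
    moreover have "n * 1 \<le> n * degree P" using assms(1) by (intro mult_le_mono2) simp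
    ultimately show ?thesis by linarith
  qed
  then show "{n. P ^ n dvd A} \<subseteq> {..degree A}" by auto
qed simp

lemma pord_power_dvd:
  fixes P A :: "'b::field poly"
  assumes "degree P > 0" "A \<noteq> 0"
  shows "P ^ pord P A dvd A"
proof -
  have "pord P A \<in> {n. P ^ n dvd A}"
    unfolding pord_def using pord_aux[OF assms] by (intro Max_in) (auto intro: exI[of _ 0])
  then show ?thesis by simp
qed

lemma pord_ge:
  fixes P A :: "'b::field poly"
  assumes "degree P > 0" "A \<noteq> 0" "P ^ n dvd A"
  shows "n \<le> pord P A"
  unfolding pord_def using pord_aux[OF assms(1,2)] assms(3) by (intro Max_ge) auto

lemma pord_decompose:
  fixes P A :: "'b::field poly"
  assumes "degree P > 0" "A \<noteq> 0"
  obtains B where "A = P ^ pord P A * B" "\<not> P dvd B"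
proof -
  obtain B where B: "A = P ^ pord P A * B" using pord_power_dvd[OF assms] by blast
  have "\<not> P dvd B"
  proof
    assume "P dvd B"
    then have "P ^ Suc (pord P A) dvd A" by (subst B) (auto intro: mult_dvd_mono simp: mult.commute)
    then show False using pord_ge[OF assms] by fastforce
  qed
  then show ?thesis using B that by blast
qed

lemma pord_eqI:
  fixes P A :: "'b::field poly"
  assumes "degree P > 0" "A = P ^ n * B" "\<not> P dvd B"
  shows "pord P A = n"
proof -
  have A0: "A \<noteq> 0" using assms by auto
  have "n \<le> pord P A" by (rule pord_ge) (use assms A0 in auto)
  moreover have "\<not> n < pord P A"
  proof
    assume "n < pord P A"
    then have "P ^ Suc n dvd A" using pord_power_dvd[OF assms(1) A0]
      by (metis Suc_leI dvd_trans le_imp_power_dvd)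
    then have "P ^ n * P dvd P ^ n * B" using assms(2) by (simp add: mult.commute)
    moreover have "P ^ n \<noteq> 0" using assms by auto
    ultimately show False using assms(3) dvd_mult_cancel_left by blast
  qed
  ultimately show ?thesis by simp
qed

lemma pord_add:
  fixes P A :: "'b::field poly"
  assumes "degree P > 0" "A \<noteq> 0" "B \<noteq> 0" "A + B \<noteq> 0"
  shows "pord P (A + B) \<ge> min (pord P A) (pord P B)"
proof (rule pord_ge)
  have "P ^ min (pord P A) (pord P B) dvd A" "P ^ min (pord P A) (pord P B) dvd B"
    using pord_power_dvd assms by (meson dvd_trans le_imp_power_dvd min.cobounded1 min.cobounded2)+
  then show "P ^ min (pord P A) (pord P B) dvd A + B" by simp
qed (use assms in auto)

lemma pord_pos_iff: "degree (P :: 'b::field poly) > 0 \<Longrightarrow> A \<noteq> 0 \<Longrightarrow> pord P A > 0 \<longleftrightarrow> P dvd A"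
  using pord_power_dvd[of P A] pord_ge[of P A 1]
  by (metis One_nat_def Suc_le_eq dvd_power dvd_trans power_one_right)

context subfield_set
begin

lemma pord_mult:
  assumes P: "irred_over L P" and A: "A \<in> polys L" "A \<noteq> 0" and B: "B \<noteq> 0"
  shows "pord P (A * B) = pord P A + pord P B"
proof -
  note PL = irred_overD[OF P]
  obtain A' where A': "A = P ^ pord P A * A'" "\<not> P dvd A'" using pord_decompose[OF PL(3) A(2)] by blast
  obtain B' where B': "B = P ^ pord P B * B'" "\<not> P dvd B'" using pord_decompose[OF PL(3) B] by blast
  have "A' = A div P ^ pord P A" using A'(1) PL(4)
    by (metis nonzero_mult_div_cancel_left power_not_zero)
  then have "A' \<in> polys L" using polys_div_mod A(1) PL(1) by blast
  then have "\<not> P dvd A' * B'" using irred_over_dvd_mult[OF P] A'(2) B'(2) by blast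
  moreover have "A * B = P ^ (pord P A + pord P B) * (A' * B')"
    by (subst A'(1), subst B'(1)) (simp add: power_add algebra_simps)
  ultimately show ?thesis using pord_eqI[OF PL(3)] by blast
qed

lemma pord_irred:
  assumes "irred_over L P" "irred_over L Q"
  shows "pord P Q = (if P = Q then 1 else 0)"
proof (cases "P = Q")
  case True
  have "\<not> P dvd 1" using irred_overD[OF assms(1)] by (metis is_unit_iff_degree less_numeral_extra(3))
  then show ?thesis using True irred_overD[OF assms(1)] by (auto intro!: pord_eqI[where B = 1])
next
  case False
  have "\<not> P dvd Q"
  proof
    assume d: "P dvd Q"
    note PL = irred_overD[OF assms(1)] and QL = irred_overD[OF assms(2)]
    have eq: "Q = P * (Q div P)" using d by simp
    have "Q div P \<in> polys L" using polys_div_mod PL QL by blast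
    then have "degree (Q div P) = 0" using eq assms(2) PL by (metis irred_over_def less_numeral_extra(3))
    then obtain c where c: "Q div P = [:c:]" by (elim degree_eq_zeroE)
    have "Q = smult c P" using eq c by simp
    then have "c = 1" using PL QL by (metis lead_coeff_smult mult.right_neutral)
    then show False using \<open>Q = smult c P\<close> False by simp
  qed
  then show ?thesis using False irred_overD[OF assms(1)] by (auto intro!: pord_eqI[where B = Q])
qed

end

section \<open>Extension of valuations\<close>

locale valuation_subring = subring_set R for R :: "'b::field set" +
  assumes total: "x \<in> R \<or> inverse x \<in> R"
begin

lemma inverse_memI: "x \<notin> R \<Longrightarrow> inverse x \<in> R"
  using total by blast

text \<open>If f is not in R then 1/f is, and dividing the monic equation of degree n by f^(n-1)
  expresses f as a polynomial in 1/f over R.\<close>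

lemma integrally_closed:
  assumes P: "P \<in> polys R" "lead_coeff P = 1" "poly P f = 0"
  shows "f \<in> R"
proof (rule ccontr)
  assume f: "f \<notin> R"
  define n where "n = degree P"
  have "f \<noteq> 0" using f by auto
  have "n \<noteq> 0"
  proof
    assume "n = 0"
    then obtain c where "P = [:c:]" by (auto simp: n_def elim: degree_eq_zeroE)
    then show False using P by simp
  qed
  then obtain m where m: "n = Suc m" by (cases n) auto
  have g: "inverse f \<in> R" using f by (rule inverse_memI)
  have "0 = (\<Sum>i\<le>n. coeff P i * f ^ i)" using P(3) by (simp add: poly_altdef n_def)
  also have "\<dots> = (\<Sum>i\<le>m. coeff P i * f ^ i) + f ^ n"
    using P(2) unfolding n_def[symmetric] by (simp add: m)
  finally have "f ^ n = - (\<Sum>i\<le>m. coeff P i * f ^ i)" by (simp add: eq_neg_iff_add_eq_0 add.commute)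
  then have "f ^ n * inverse f ^ m = - (\<Sum>i\<le>m. coeff P i * (f ^ i * inverse f ^ m))"
    by (simp add: sum_distrib_right mult.assoc)
  also have "(\<Sum>i\<le>m. coeff P i * (f ^ i * inverse f ^ m)) = (\<Sum>i\<le>m. coeff P i * inverse f ^ (m - i))"
  proof (intro sum.cong refl)
    fix i assume "i \<in> {..m}"
    then have "inverse f ^ m = inverse f ^ i * inverse f ^ (m - i)" by (simp flip: power_add)
    then show "coeff P i * (f ^ i * inverse f ^ m) = coeff P i * inverse f ^ (m - i)"
      using \<open>f \<noteq> 0\<close> by (simp add: power_inverse)
  qed
  also have "f ^ n * inverse f ^ m = f" using \<open>f \<noteq> 0\<close> by (simp add: m power_inverse field_simps)
  finally have "f = - (\<Sum>i\<le>m. coeff P i * inverse f ^ (m - i))" .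
  moreover have "\<dots> \<in> R" using P(1) g by auto
  ultimately show False using f by simp
qed

lemma power_memD:
  assumes "f ^ n \<in> R" "n > 0"
  shows "f \<in> R"
proof (rule integrally_closed)
  let ?P = "Polynomial.monom 1 n - [:f ^ n:]"
  show "?P \<in> polys R" using assms by (intro polys_diff polys_monom polys_pCons) auto
  have "degree ?P = n" using assms(2)
    by (subst diff_conv_add_uminus, subst degree_add_eq_left) (auto simp: degree_monom_eq)
  then show "lead_coeff ?P = 1" using assms by (simp add: coeff_pCons split: nat.split)
  show "poly ?P f = 0" by (simp add: poly_monom)
qed

end

text \<open>The reduction step: a relation of degree \<open>n\<close> in \<open>f\<close> is shortened with a relation of degree
  \<open>m \<le> n\<close> in \<open>1/f\<close>.\<close>

lemma (in subring_set) chevalley_step: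
  assumes units: "\<And>r. r \<in> R \<Longrightarrow> inverse (1 - \<pi> * r) \<in> R" and \<pi>: "\<pi> \<in> R"
    and X1: "\<And>r. r \<in> R \<Longrightarrow> \<pi> * r \<noteq> 1"
    and A: "A \<in> polys R" "\<pi> * poly A f = 1"
    and B: "B \<in> polys R" "\<pi> * poly B (inverse f) = 1" and le: "degree B \<le> degree A" and f: "f \<noteq> 0"
  shows "\<exists>C\<in>polys R. \<pi> * poly C f = 1 \<and> degree C < degree A"
proof -
  define n where "n = degree A"
  obtain b0 B1 where B1: "B = pCons b0 B1" by (cases B)
  have bR: "b0 \<in> R" "B1 \<in> polys R" using B(1) B1 by (auto simp: pCons_polys_iff)
  have "B1 \<noteq> 0"
  proof
    assume "B1 = 0"
    then show False using B B1 X1[OF bR(1)] by simp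
  qed
  then have "degree B = Suc (degree B1)" by (simp add: B1)
  then have n: "Suc (degree B1) \<le> n" using le by (simp add: n_def)
  \<comment> \<open>Isolating the constant coefficient b0 of B turns \<pi> B(1/f) = 1 into a formula
    for 1 - \<pi> b0 as \<pi> times a sum of negative powers of f. Multiplying by the inverse u of
    this unit and by f^n gives f^n = \<pi> E(f) with E of degree below n.\<close>
  define u where "u = inverse (1 - \<pi> * b0)"
  have u: "u \<in> R" "u * (1 - \<pi> * b0) = 1" using units[OF bR(1)] X1[OF bR(1)] by (auto simp: u_def)
  define E where "E = (\<Sum>j\<le>degree B1. Polynomial.monom (u * coeff B1 j) (n - Suc j))"
  have E: "E \<in> polys R" unfolding E_def using u bR by (intro polys_sum polys_monom) auto
  have dE: "degree E \<le> n - 1"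
    unfolding E_def by (intro degree_sum_le) (auto intro!: order.trans[OF degree_monom_le])
  have pE: "poly E f = f ^ n * (u * (inverse f * poly B1 (inverse f)))"
  proof -
    have "poly E f = (\<Sum>j\<le>degree B1. u * coeff B1 j * f ^ (n - Suc j))"
      by (simp add: E_def poly_sum poly_monom)
    also have "\<dots> = (\<Sum>j\<le>degree B1. f ^ n * (u * (inverse f * (coeff B1 j * inverse f ^ j))))"
    proof (intro sum.cong refl)
      fix j assume "j \<in> {..degree B1}"
      then have "n = (n - Suc j) + Suc j" using n by auto
      then have "f ^ n = f ^ (n - Suc j) * f ^ Suc j" by (metis power_add)
      then have "f ^ (n - Suc j) = f ^ n * (inverse f * inverse f ^ j)"
        using f by (simp add: power_inverse field_simps)
      then show "u * coeff B1 j * f ^ (n - Suc j) = f ^ n * (u * (inverse f * (coeff B1 j * inverse f ^ j)))"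
        by (simp add: mult_ac)
    qed
    also have "\<dots> = f ^ n * (u * (inverse f * poly B1 (inverse f)))"
      by (simp add: poly_altdef sum_distrib_left)
    finally show ?thesis .
  qed
  have "1 - \<pi> * b0 = \<pi> * (inverse f * poly B1 (inverse f))" using B(2) by (simp add: B1 algebra_simps)
  then have "u * (\<pi> * (inverse f * poly B1 (inverse f))) = 1" using u by metis
  then have fn: "f ^ n = \<pi> * poly E f"
    unfolding pE by (metis mult.left_commute mult.right_neutral)
  \<comment> \<open>The leading term of A is traded for the multiple of E that has the same value at
    f.\<close>
  define A1 where "A1 = A - Polynomial.monom (lead_coeff A) n"
  define C where "C = A1 + smult (lead_coeff A * \<pi>) E"
  have "C \<in> polys R" unfolding C_def A1_def using A(1) E \<pi> by (intro polys_add polys_diff polys_monom polys_smult) auto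
  moreover have "poly C f = poly A f"
    using fn by (simp add: C_def A1_def poly_monom algebra_simps)
  moreover have "degree C < n"
  proof -
    have "coeff A1 i = 0" if "i \<ge> n" for i
      using that by (cases "i = n") (auto simp: A1_def n_def coeff_eq_0)
    moreover have "coeff E i = 0" if "i \<ge> n" for i using that dE n by (intro coeff_eq_0) linarith
    ultimately have "\<forall>i\<ge>n. coeff C i = 0" by (simp add: C_def)
    then have "degree C \<le> n - 1" by (intro degree_le) (use n in \<open>auto\<close>)
    then show ?thesis using n by linarith
  qed
  ultimately show ?thesis using A(2) unfolding n_def by (intro bexI[of _ C]) simp_all
qed

text \<open>A maximal subring R that avoids 1/\<pi> works. By maximality every f outside R satisfies
  a relation \<pi> P(f) = 1 over R. If f and 1/f were both outside R, two such relations of least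
  degree would shorten one another.\<close>

lemma chevalley:
  assumes "subring_set A" "\<pi> \<in> A" "inverse \<pi> \<notin> A"
  shows "\<exists>R. valuation_subring R \<and> A \<subseteq> R \<and> inverse \<pi> \<notin> R"
proof -
  define \<A> where "\<A> = {R. subring_set R \<and> A \<subseteq> R \<and> inverse \<pi> \<notin> R}"
  have "\<exists>R\<in>\<A>. \<forall>R'\<in>\<A>. R \<subseteq> R' \<longrightarrow> R' = R"
  proof (rule subset_Zorn_nonempty)
    show "\<A> \<noteq> {}" using assms by (auto simp: \<A>_def)
    fix \<C> assume ne: "\<C> \<noteq> {}" and ch: "subset.chain \<A> \<C>"
    have sub: "\<C> \<subseteq> \<A>" using ch by (simp add: subset.chain_def)
    have both: "\<exists>R\<in>\<C>. x \<in> R \<and> y \<in> R" if "x \<in> \<Union>\<C>" "y \<in> \<Union>\<C>" for x y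
    proof -
      obtain R1 R2 where "R1 \<in> \<C>" "x \<in> R1" "R2 \<in> \<C>" "y \<in> R2" using \<open>x \<in> \<Union>\<C>\<close> \<open>y \<in> \<Union>\<C>\<close> by blast
      moreover have "R1 \<subseteq> R2 \<or> R2 \<subseteq> R1"
        using ch calculation(1,3) by (auto simp: subset_chain_def)
      ultimately show ?thesis by blast
    qed
    have ring: "subring_set R" if "R \<in> \<C>" for R using sub that by (auto simp: \<A>_def)
    have "subring_set (\<Union>\<C>)"
    proof
      fix x y assume "x \<in> \<Union>\<C>" "y \<in> \<Union>\<C>"
      then obtain R where "R \<in> \<C>" "x \<in> R" "y \<in> R" using both by blast
      then show "x + y \<in> \<Union>\<C>" "x * y \<in> \<Union>\<C>"
        using subring_set.add_mem[OF ring] subring_set.mult_mem[OF ring] by blast+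
    next
      fix x assume "x \<in> \<Union>\<C>"
      then show "- x \<in> \<Union>\<C>" using subring_set.uminus_mem[OF ring] by blast
    qed (use ne ring subring_set.zero_mem subring_set.one_mem in blast)+
    then show "\<Union>\<C> \<in> \<A>" using sub ne by (auto simp: \<A>_def)
  qed
  then obtain R where R: "R \<in> \<A>" and max: "\<And>R'. R' \<in> \<A> \<Longrightarrow> R \<subseteq> R' \<Longrightarrow> R' = R" by blast
  interpret subring_set R using R by (simp add: \<A>_def)
  have XR: "\<pi> \<in> R" "inverse \<pi> \<notin> R" using R assms by (auto simp: \<A>_def)
  then have X0: "\<pi> \<noteq> 0" by auto
  have adjoin: "\<exists>P\<in>polys R. poly P f = inverse \<pi>" if "f \<notin> R" for f
  proof (rule ccontr)
    assume n: "\<not> ?thesis"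
    define R' where "R' = {poly P f |P. P \<in> polys R}"
    have mem: "poly P f \<in> R'" if "P \<in> polys R" for P using that by (auto simp: R'_def)
    have "subring_set R'"
    proof
      show "0 \<in> R'" "1 \<in> R'" using mem[of 0] mem[of 1] by auto
      fix x y assume "x \<in> R'" "y \<in> R'"
      then obtain P Q where PQ: "P \<in> polys R" "Q \<in> polys R" "x = poly P f" "y = poly Q f"
        by (auto simp: R'_def)
      show "x + y \<in> R'" "x * y \<in> R'" "- x \<in> R'"
        using mem[of "P + Q"] mem[of "P * Q"] mem[of "- P"] PQ by (auto intro!: polys_mult polys_add)
    qed
    moreover have "R \<subseteq> R'"
    proof
      fix x assume "x \<in> R"
      then show "x \<in> R'" using mem[of "[:x:]"] by (auto simp: pCons_polys_iff)
    qed
    ultimately have "R' = R" using n R by (intro max) (auto simp: \<A>_def R'_def)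
    moreover have "f \<in> R'" using mem[of "[:0, 1:]"] by (auto simp: pCons_polys_iff)
    ultimately show False using that by simp
  qed
  have X1: "\<pi> * r \<noteq> 1" if "r \<in> R" for r
    using XR that X0 by (metis inverse_unique)
  \<comment> \<open>If s = 1 - \<pi> r had its inverse outside R, the relation for 1/s would make a
    power of s a multiple of \<pi>; but every power of s is 1 modulo \<pi>, so \<pi> would be
    invertible in R.\<close>
  have units: "inverse (1 - \<pi> * r) \<in> R" if r: "r \<in> R" for r
  proof (rule ccontr)
    define s where "s = 1 - \<pi> * r"
    assume "inverse (1 - \<pi> * r) \<notin> R"
    then obtain P where P: "P \<in> polys R" "poly P (inverse s) = inverse \<pi>" using adjoin by (auto simp: s_def)
    have sR: "s \<in> R" using XR r by (auto simp: s_def)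
    have s0: "s \<noteq> 0" using X1[OF r] by (auto simp: s_def)
    define n where "n = degree P"
    define b where "b = (\<Sum>i\<le>n. coeff P i * s ^ (n - i))"
    have bR: "b \<in> R" using P sR by (auto simp: b_def)
    have "b = s ^ n * poly P (inverse s)"
    proof -
      have "s ^ n * inverse s ^ i = s ^ (n - i)" if "i \<le> n" for i
        using that s0 by (simp add: power_diff power_inverse field_simps)
      then show ?thesis unfolding b_def
        by (simp add: poly_altdef n_def sum_distrib_left mult.left_commute)
    qed
    then have "s ^ n = \<pi> * b" using P(2) X0 by simp
    moreover have "\<exists>t\<in>R. s ^ n = 1 - \<pi> * t" for n
    proof (induction n)
      case (Suc n)
      then obtain t where "t \<in> R" "s ^ n = 1 - \<pi> * t" by blast
      then have "s ^ Suc n = (1 - \<pi> * r) * (1 - \<pi> * t)" by (simp add: s_def)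
      also have "\<dots> = 1 - \<pi> * (r + t - \<pi> * r * t)" by (simp add: algebra_simps)
      finally show ?case using r XR \<open>t \<in> R\<close> by blast
    qed (auto intro: bexI[of _ 0])
    then obtain t where "t \<in> R" "s ^ n = 1 - \<pi> * t" by blast
    ultimately have "\<pi> * (b + t) = 1" by (simp add: algebra_simps)
    then show False using X1 bR \<open>t \<in> R\<close> by blast
  qed
  have "f \<in> R \<or> inverse f \<in> R" for f
  proof (rule ccontr)
    assume n: "\<not> ?thesis"
    have f0: "f \<noteq> 0" using n by auto
    define K where "K g = {k. \<exists>A\<in>polys R. \<pi> * poly A g = 1 \<and> degree A = k}" for g
    have ne: "\<exists>k. k \<in> K g" if "g \<notin> R" for g
      using adjoin[OF that] X0 by (auto simp: K_def) (metis right_inverse)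
    define k where "k g = (LEAST k. k \<in> K g)" for g
    have K: "k g \<in> K g" if "g \<notin> R" for g unfolding k_def using ne[OF that] by (auto intro: LeastI)
    \<comment> \<open>Of g and 1/g, take as g the one whose shortest relation is the longer:
      \<open>chevalley_step\<close> shortens it further.\<close>
    have key: False if g: "g \<notin> R" "inverse g \<notin> R" "k (inverse g) \<le> k g" for g
    proof -
      obtain A where A: "A \<in> polys R" "\<pi> * poly A g = 1" "degree A = k g" using K[OF g(1)] by (auto simp: K_def)
      obtain B where B: "B \<in> polys R" "\<pi> * poly B (inverse g) = 1" "degree B = k (inverse g)"
        using K[OF g(2)] by (auto simp: K_def)
      have "g \<noteq> 0" using g by auto
      then obtain C where "C\<in>polys R" "\<pi> * poly C g = 1" "degree C < k g"
        using chevalley_step[OF units XR(1) X1 A(1,2) B(1,2)] A(3) B(3) g(3) by auto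
      then show False using not_less_Least[of "degree C" "\<lambda>k. k \<in> K g"] by (auto simp: k_def K_def)
    qed
    show False using key[of f] key[of "inverse f"] n by (metis inverse_inverse_eq nle_le)
  qed
  then have "valuation_subring R" by unfold_locales
  then show ?thesis using R by (auto simp: \<A>_def)
qed

section \<open>Real valuations of a subfield\<close>

locale valued_field = subfield_set L for L :: "'b::field set" +
  fixes w :: "'b \<Rightarrow> real"
  assumes w_mult: "x \<in> L \<Longrightarrow> x \<noteq> 0 \<Longrightarrow> y \<in> L \<Longrightarrow> y \<noteq> 0 \<Longrightarrow> w (x * y) = w x + w y"
    and w_add: "x \<in> L \<Longrightarrow> x \<noteq> 0 \<Longrightarrow> y \<in> L \<Longrightarrow> y \<noteq> 0 \<Longrightarrow> x + y \<noteq> 0 \<Longrightarrow> w (x + y) \<ge> min (w x) (w y)"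
begin

lemma w_1 [simp]: "w 1 = 0"
  using w_mult[of 1 1] by simp

lemma w_inverse: "x \<in> L \<Longrightarrow> x \<noteq> 0 \<Longrightarrow> w (inverse x) = - w x"
  using w_mult[of x "inverse x"] by (simp add: inverse_mem)

lemma w_divide: "x \<in> L \<Longrightarrow> x \<noteq> 0 \<Longrightarrow> y \<in> L \<Longrightarrow> y \<noteq> 0 \<Longrightarrow> w (x / y) = w x - w y"
  using w_mult[of x "inverse y"] by (simp add: inverse_mem w_inverse divide_inverse)

lemma w_power: "x \<in> L \<Longrightarrow> x \<noteq> 0 \<Longrightarrow> w (x ^ n) = n * w x"
  by (induction n) (auto simp: w_mult power_mem algebra_simps)

lemma w_power_int: "x \<in> L \<Longrightarrow> x \<noteq> 0 \<Longrightarrow> w (x powi n) = n * w x"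
  by (auto simp: power_int_def w_power power_mem inverse_mem w_inverse)

lemma w_minus: "x \<in> L \<Longrightarrow> x \<noteq> 0 \<Longrightarrow> w (- x) = w x"
proof -
  have "w (- 1) = 0" using w_mult[of "- 1" "- 1"] by (simp add: uminus_mem)
  then show "x \<in> L \<Longrightarrow> x \<noteq> 0 \<Longrightarrow> w (- x) = w x" using w_mult[of "- 1" x] by (simp add: uminus_mem)
qed

lemma w_diff: "x \<in> L \<Longrightarrow> x \<noteq> 0 \<Longrightarrow> y \<in> L \<Longrightarrow> y \<noteq> 0 \<Longrightarrow> x - y \<noteq> 0 \<Longrightarrow> w (x - y) \<ge> min (w x) (w y)"
  using w_add[of x "- y"] by (auto simp: w_minus uminus_mem)

lemma w_add_eq:
  assumes "x \<in> L" "x \<noteq> 0" "y \<in> L" "y \<noteq> 0" "w x < w y"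
  shows "x + y \<noteq> 0" "w (x + y) = w x"
proof -
  show *: "x + y \<noteq> 0"
    using assms w_minus by (metis add_eq_0_iff2 less_irrefl)
  have "w (x + y - y) \<ge> min (w (x + y)) (w y)" using assms * by (intro w_diff) (auto intro: add_mem)
  then show "w (x + y) = w x" using w_add[OF assms(1-4) *] assms(5) by auto
qed

text \<open>Zero is treated as having infinite value; \<open>w 0\<close> itself is unspecified.\<close>

definition atleast :: "real \<Rightarrow> 'b set" where
  "atleast c = {x \<in> L. x \<noteq> 0 \<longrightarrow> w x \<ge> c}"

lemma atleastI: "x \<in> L \<Longrightarrow> (x \<noteq> 0 \<Longrightarrow> w x \<ge> c) \<Longrightarrow> x \<in> atleast c"
  and atleastD: "x \<in> atleast c \<Longrightarrow> x \<noteq> 0 \<Longrightarrow> w x \<ge> c"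
  by (auto simp: atleast_def)

lemma atleast_0 [simp]: "0 \<in> atleast c"
  by (auto simp: atleast_def)

lemma atleast_add: "x \<in> atleast c \<Longrightarrow> y \<in> atleast c \<Longrightarrow> x + y \<in> atleast c"
  by (cases "x = 0"; cases "y = 0") (auto simp: atleast_def add_mem dest!: w_add[of x y])

lemma atleast_uminus: "x \<in> atleast c \<Longrightarrow> - x \<in> atleast c"
  by (auto simp: atleast_def w_minus)

lemma atleast_sum: "(\<And>i. i \<in> I \<Longrightarrow> f i \<in> atleast c) \<Longrightarrow> sum f I \<in> atleast c"
  by (induction I rule: infinite_finite_induct) (auto intro: atleast_add)

lemma atleast_mult: "x \<in> atleast b \<Longrightarrow> y \<in> atleast c \<Longrightarrow> x * y \<in> atleast (b + c)"
  by (auto simp: atleast_def w_mult)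

lemma atleast_mono: "x \<in> atleast b \<Longrightarrow> c \<le> b \<Longrightarrow> x \<in> atleast c"
  by (auto simp: atleast_def)

lemma subring_atleast: "subring_set (atleast 0)"
proof
  show "1 \<in> atleast 0" by (auto simp: atleast_def)
  fix x y assume "x \<in> atleast 0" "y \<in> atleast 0"
  then show "x + y \<in> atleast 0" "- x \<in> atleast 0" "x * y \<in> atleast 0"
    using atleast_mult[of x 0 y 0] by (auto intro: atleast_add atleast_uminus)
qed auto

end

context valuation_subring
begin

definition nonunits :: "'b set" where
  "nonunits = {x \<in> R. x = 0 \<or> inverse x \<notin> R}"

definition units :: "'b set" where
  "units = {x \<in> R. x \<noteq> 0 \<and> inverse x \<in> R}"

lemma units_1 [simp, intro]: "1 \<in> units"
  and units_mult: "x \<in> units \<Longrightarrow> y \<in> units \<Longrightarrow> x * y \<in> units"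
  and units_inverse: "x \<in> units \<Longrightarrow> inverse x \<in> units"
  by (auto simp: units_def)

lemma units_divide: "x \<in> units \<Longrightarrow> y \<in> units \<Longrightarrow> x / y \<in> units"
  by (simp add: divide_inverse units_mult units_inverse)

lemma units_power: "x \<in> units \<Longrightarrow> x ^ n \<in> units"
  by (induction n) (auto intro: units_mult)

lemma mem_units_mult_iff: "u \<in> units \<Longrightarrow> u * x \<in> R \<longleftrightarrow> x \<in> R"
proof
  assume u: "u \<in> units" and x: "u * x \<in> R"
  have "x = inverse u * (u * x)" using u by (simp add: units_def)
  then show "x \<in> R" using u x mult_mem by (metis (no_types, lifting) mem_Collect_eq units_def)
qed (auto simp: units_def)

text \<open>One of x/y and y/x lies in R. If x/y does and x + y were a unit, then 1/y = (1 + x/y) /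
  (x + y) would lie in R.\<close>

lemma nonunits_add:
  assumes x: "x \<in> nonunits" and y: "y \<in> nonunits"
  shows "x + y \<in> nonunits"
proof -
  have key: "x + y \<in> nonunits" if x: "x \<in> nonunits" and y: "y \<in> nonunits" "y \<noteq> 0" and q: "x / y \<in> R" for x y
  proof (rule ccontr)
    assume "x + y \<notin> nonunits"
    then have u: "x + y \<noteq> 0" "inverse (x + y) \<in> R" using x y by (auto simp: nonunits_def)
    have "1 + x / y \<in> R" using q by auto
    then have "(1 + x / y) * inverse (x + y) \<in> R" using u by auto
    moreover have "(1 + x / y) * inverse (x + y) = inverse y" using y(2) u by (simp add: field_simps)
    ultimately show False using y by (simp add: nonunits_def)
  qed
  show ?thesis
  proof (cases "x = 0 \<or> y = 0")
    case False
    then have "inverse (x / y) = y / x" by simp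
    then have "x / y \<in> R \<or> y / x \<in> R" using total[of "x / y"] by simp
    then show ?thesis using key[of x y] key[of y x] x y False by (auto simp: add.commute)
  qed (use x y in auto)
qed

lemma nonunits_sum: "(\<And>i. i \<in> I \<Longrightarrow> f i \<in> nonunits) \<Longrightarrow> sum f I \<in> nonunits"
proof (induction I rule: infinite_finite_induct)
  case (insert i I)
  then show ?case using nonunits_add[of "f i" "sum f I"] by simp
qed (auto simp: nonunits_def)

text \<open>Divisibility in R is a total preorder on nonzero elements, so a finite set has a member
  of least value.\<close>

lemma finite_min_quotient:
  assumes "finite T" "T \<noteq> {}" "0 \<notin> T"
  shows "\<exists>t0\<in>T. \<forall>t\<in>T. t / t0 \<in> R"
  using assms
proof (induction T rule: finite_ne_induct)
  case (insert s T)
  then obtain t0 where t0: "t0 \<in> T" "\<And>t. t \<in> T \<Longrightarrow> t / t0 \<in> R" by blast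
  have nz: "s \<noteq> 0" "t0 \<noteq> 0" using insert.prems t0 by auto
  show ?case
  proof (cases "s / t0 \<in> R")
    case True
    then show ?thesis using t0 by auto
  next
    case False
    then have "t0 / s \<in> R" using total[of "s / t0"] by simp
    then have "t / s \<in> R" if "t \<in> T" for t
      using mult_mem[OF t0(2)[OF that], of "t0 / s"] nz by simp
    then show ?thesis using nz by auto
  qed
qed auto

text \<open>In a vanishing sum two terms of least value must agree up to a unit.\<close>

lemma vanishing_sum:
  assumes "finite I" "I \<noteq> {}" "sum f I = 0" "\<And>i. i \<in> I \<Longrightarrow> f i \<noteq> 0"
  shows "\<exists>i\<in>I. \<exists>j\<in>I. i \<noteq> j \<and> f i / f j \<in> units"
proof (rule ccontr)
  assume n: "\<not> ?thesis"
  obtain j where j: "j \<in> I" "\<And>i. i \<in> I \<Longrightarrow> f i / f j \<in> R"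
  proof -
    have "0 \<notin> f ` I" using assms(4) by force
    then show ?thesis using finite_min_quotient[of "f ` I"] assms(1,2) that by auto
  qed
  \<comment> \<open>After division by the term of least value, all other terms would be nonunits;
    yet they sum to -1, which is a unit.\<close>
  have "f i / f j \<in> nonunits" if "i \<in> I - {j}" for i
    using n j that assms(4) by (auto simp: nonunits_def units_def)
  then have "(\<Sum>i\<in>I - {j}. f i / f j) \<in> nonunits" by (intro nonunits_sum) auto
  moreover have "(\<Sum>i\<in>I - {j}. f i / f j) = - 1"
  proof -
    have "(\<Sum>i\<in>I. f i / f j) = 0" using assms(3) by (simp flip: sum_divide_distrib)
    then show ?thesis using assms(1,4) j(1) by (simp add: sum.remove[of I j] eq_neg_iff_add_eq_0 add.commute)
  qed
  ultimately show False by (auto simp: nonunits_def)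
qed

end

definition algebraic_over :: "'b::field set \<Rightarrow> 'b set" where
  "algebraic_over L = {x. \<exists>P\<in>polys L. P \<noteq> 0 \<and> poly P x = 0}"

text \<open>A valuation ring of the ambient field need not come from a real-valued valuation. W is
  therefore confined to a multiplicative group G containing the nonzero elements algebraic over L,
  and \<open>W_root\<close> records that some multiple of each value is a value of the base.\<close>

locale extended_valuation = base: valued_field L w + ext: valuation_subring R
  for L :: "'b::field set" and w :: "'b \<Rightarrow> real" and R :: "'b set" +
  fixes G :: "'b set" and W :: "'b \<Rightarrow> real"
  assumes algebraic_G: "x \<in> algebraic_over L \<Longrightarrow> x \<noteq> 0 \<Longrightarrow> x \<in> G"
    and zero_notin_G: "0 \<notin> G"
    and mult_G: "x \<in> G \<Longrightarrow> y \<in> G \<Longrightarrow> x * y \<in> G"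
    and inverse_G: "x \<in> G \<Longrightarrow> inverse x \<in> G"
    and W_base: "x \<in> L \<Longrightarrow> x \<noteq> 0 \<Longrightarrow> W x = w x"
    and W_mult: "x \<in> G \<Longrightarrow> y \<in> G \<Longrightarrow> W (x * y) = W x + W y"
    and R_iff: "x \<in> G \<Longrightarrow> x \<in> R \<longleftrightarrow> W x \<ge> 0"
    and W_root: "x \<in> G \<Longrightarrow> \<exists>s>0. \<exists>g\<in>L. g \<noteq> 0 \<and> real s * W x = w g"

text \<open>Chevalley's theorem is applied to the valuation ring of w and to \<pi>. Real values
  being archimedean, excluding 1/\<pi> already forces R to cut out exactly that ring in L. An
  algebraic equation for f has two terms equal up to a unit, which makes a power f^s a base element
  g up to a unit and dictates the value w g / s.\<close>

lemma (in valued_field) exists_extension: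
  assumes \<pi>: "\<pi> \<in> L" "\<pi> \<noteq> 0" "w \<pi> > 0"
  shows "\<exists>R G W. extended_valuation L w R G W"
proof -
  interpret A: subring_set "atleast 0" by (rule subring_atleast)
  have "\<pi> \<in> atleast 0" "inverse \<pi> \<notin> atleast 0"
    using \<pi> by (auto simp: atleast_def w_inverse)
  from chevalley[OF subring_atleast this] obtain R
    where R: "valuation_subring R" "atleast 0 \<subseteq> R" "inverse \<pi> \<notin> R" by blast
  interpret R: valuation_subring R by (rule R)
  have RL: "x \<in> R \<longleftrightarrow> w x \<ge> 0" if x: "x \<in> L" "x \<noteq> 0" for x
  proof
    assume "w x \<ge> 0"
    then show "x \<in> R" using R(2) x by (auto simp: atleast_def)
  next
    assume xR: "x \<in> R"
    show "w x \<ge> 0"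
    proof (rule ccontr)
      assume "\<not> w x \<ge> 0"
      \<comment> \<open>N is large enough that x^N \<pi> has nonpositive value; its inverse then
        lies in R, and multiplying by x^N would put 1/\<pi> into R.\<close>
      then obtain N :: nat where N: "w \<pi> \<le> real N * (- w x)"
        using reals_Archimedean3[of "- w x"] by (metis less_eq_real_def neg_0_less_iff_less not_le)
      have nz: "x ^ N * \<pi> \<in> L" "x ^ N * \<pi> \<noteq> 0" using x \<pi> by auto
      have "w (inverse (x ^ N * \<pi>)) \<ge> 0"
        using x \<pi> N w_inverse[OF nz] by (simp add: w_mult w_power power_mem)
      then have "inverse (x ^ N * \<pi>) \<in> R" using R(2) nz by (auto simp: atleast_def)
      then have "x ^ N * inverse (x ^ N * \<pi>) \<in> R" using xR by auto
      moreover have "x ^ N * inverse (x ^ N * \<pi>) = inverse \<pi>" using x by (simp add: field_simps)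
      ultimately show False using R(3) by metis
    qed
  qed
  have UL: "x \<in> R.units \<longleftrightarrow> w x = 0" if "x \<in> L" "x \<noteq> 0" for x
    using that RL[of x] RL[of "inverse x"] by (auto simp: R.units_def w_inverse inverse_mem)
  \<comment> \<open>\<open>Q f s g\<close> says that f^s and g agree up to a unit, so that f ought
    to have value w g / s; \<open>Quniq\<close> shows that this does not depend on s and g.\<close>
  define Q where "Q f s g \<longleftrightarrow> (0::nat) < s \<and> g \<in> L \<and> g \<noteq> 0 \<and> f ^ s / g \<in> R.units" for f s g
  have Quniq: "w g / s = w g' / s'" if "f \<noteq> 0" "Q f s g" "Q f s' g'" for f s g s' g'
  proof -
    have "(f ^ s / g) ^ s' / (f ^ s' / g') ^ s \<in> R.units"
      using that R.units_divide[OF R.units_power[of "f ^ s / g" s'] R.units_power[of "f ^ s' / g'" s]]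
      by (auto simp: Q_def)
    moreover have "(f ^ s / g) ^ s' / (f ^ s' / g') ^ s = g' ^ s / g ^ s'"
      using that by (simp add: Q_def power_divide mult.commute flip: power_mult)
    ultimately have "w (g' ^ s / g ^ s') = 0" using UL[of "g' ^ s / g ^ s'"] that by (auto simp: Q_def divide_mem power_mem)
    then have "s * w g' = s' * w g" using that by (auto simp: Q_def w_divide w_power power_mem)
    then show ?thesis using that by (simp add: Q_def field_simps)
  qed
  define G where "G = {f. f \<noteq> 0 \<and> (\<exists>s g. Q f s g)}"
  define W where "W f = (THE q. \<exists>s g. Q f s g \<and> q = w g / real s)" for f
  have W: "W f = w g / s" if "f \<noteq> 0" "Q f s g" for f s g
    unfolding W_def using that Quniq by (intro the_equality) blast+
  have "extended_valuation L w R G W"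
  proof unfold_locales
    fix f assume f: "f \<in> algebraic_over L" "f \<noteq> 0"
    then obtain P where P: "P \<in> polys L" "P \<noteq> 0" "poly P f = 0" by (auto simp: algebraic_over_def)
    define I where "I = {i. coeff P i \<noteq> 0}"
    have fin: "finite I" by (rule finite_subset[of _ "{..degree P}"]) (auto simp: I_def le_degree)
    have "sum (\<lambda>i. coeff P i * f ^ i) I = poly P f"
      unfolding poly_altdef by (rule sum.mono_neutral_left) (auto simp: I_def le_degree)
    \<comment> \<open>Two terms of the vanishing sum agree up to a unit, so the power of f with
      exponent the difference of i and j is a base element up to a unit.\<close>
    then obtain i j where ij: "i \<in> I" "j \<in> I" "i \<noteq> j"
      "(coeff P i * f ^ i) / (coeff P j * f ^ j) \<in> R.units"
      using R.vanishing_sum[OF fin, of "\<lambda>i. coeff P i * f ^ i"] P f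
      by (auto simp: I_def) (metis (mono_tags, lifting) leading_coeff_neq_0 empty_iff mem_Collect_eq)
    have *: "f \<in> G" if ij: "i \<in> I" "j \<in> I" "i > j" "(coeff P i * f ^ i) / (coeff P j * f ^ j) \<in> R.units" for i j
    proof -
      have "f ^ i = f ^ (i - j) * f ^ j" using ij(3) by (simp flip: power_add)
      then have "f ^ (i - j) / (coeff P j / coeff P i) \<in> R.units"
        using ij(4) f by (simp add: mult.commute)
      then show ?thesis using ij P f by (auto simp: G_def Q_def I_def intro!: exI[of _ "i - j"] exI[of _ "coeff P j / coeff P i"])
    qed
    show "f \<in> G"
    proof (cases "i > j")
      case False
      have "inverse ((coeff P i * f ^ i) / (coeff P j * f ^ j)) \<in> R.units" using ij by (intro R.units_inverse)
      then show ?thesis using *[of j i] ij False by simp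
    qed (use * ij in blast)
  next
    show "0 \<notin> G" by (simp add: G_def)
    fix x y assume "x \<in> G" "y \<in> G"
    then obtain s g s' g' where Q: "Q x s g" "Q y s' g'" "x \<noteq> 0" "y \<noteq> 0" by (auto simp: G_def)
    have "(x ^ s / g) ^ s' * (y ^ s' / g') ^ s \<in> R.units"
      using Q by (intro R.units_mult R.units_power) (auto simp: Q_def)
    moreover have "(x ^ s / g) ^ s' * (y ^ s' / g') ^ s = (x * y) ^ (s * s') / (g ^ s' * g' ^ s)"
      by (simp add: power_divide power_mult_distrib mult.commute flip: power_mult)
    ultimately have Q2: "Q (x * y) (s * s') (g ^ s' * g' ^ s)" using Q by (auto simp: Q_def)
    then show "x * y \<in> G" using Q by (auto simp: G_def)
    have "w (g ^ s' * g' ^ s) = s' * w g + s * w g'" using Q by (auto simp: Q_def w_mult w_power power_mem)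
    then have Wxy: "W (x * y) = (real s' * w g + real s * w g') / (real s * real s')"
      using W[OF _ Q2] Q by simp
    have "W x = w g / s" "W y = w g' / s'" using W[OF _ Q(1)] W[OF _ Q(2)] Q by auto
    then show "W (x * y) = W x + W y"
      using Q unfolding Wxy by (simp add: Q_def add_divide_distrib)
  next
    fix x assume "x \<in> G"
    then obtain s g where Q: "Q x s g" "x \<noteq> 0" by (auto simp: G_def)
    have "inverse x ^ s / inverse g = inverse (x ^ s / g)" by (simp add: divide_inverse power_inverse)
    then have "Q (inverse x) s (inverse g)" using Q R.units_inverse[of "x ^ s / g"] by (auto simp: Q_def)
    then show "inverse x \<in> G" using Q by (auto simp: G_def)
    have Wx: "W x = w g / s" using W Q by blast
    then show "\<exists>s>0. \<exists>g\<in>L. g \<noteq> 0 \<and> real s * W x = w g"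
      using Q by (intro exI[of _ s]) (auto simp: Q_def)
    have "x ^ s = (x ^ s / g) * g" using Q by (auto simp: Q_def)
    then have "x ^ s \<in> R \<longleftrightarrow> g \<in> R" using R.mem_units_mult_iff Q by (metis Q_def)
    then have "x \<in> R \<longleftrightarrow> g \<in> R" using R.power_memD[of x s] R.power_mem Q by (auto simp: Q_def)
    then show "x \<in> R \<longleftrightarrow> W x \<ge> 0" using RL[of g] Q by (auto simp: Wx Q_def zero_le_divide_iff)
  next
    fix x assume "x \<in> L" "x \<noteq> 0"
    then have "Q x 1 x" by (auto simp: Q_def)
    then show "W x = w x" using W[of x 1 x] \<open>x \<noteq> 0\<close> by simp
  qed
  then show ?thesis by blast
qed

context extended_valuation
begin

lemma W_inverse: "x \<in> G \<Longrightarrow> W (inverse x) = - W x"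
  using W_mult[of x "inverse x"] inverse_G[of x] W_base[of 1] zero_notin_G base.one_mem
  by (metis add_eq_0_iff right_inverse zero_neq_one base.w_1)

lemma W_add:
  assumes "x \<in> G" "y \<in> G" "x + y \<in> G"
  shows "W (x + y) \<ge> min (W x) (W y)"
proof -
  have key: "W (x + y) \<ge> W x" if "W y \<ge> W x" "x \<in> G" "y \<in> G" "x + y \<in> G" for x y
  proof -
    have x0: "x \<noteq> 0" using that zero_notin_G by auto
    have "W (y * inverse x) \<ge> 0" using that by (simp add: W_mult inverse_G W_inverse)
    then have "y * inverse x \<in> R" using R_iff[of "y * inverse x"] that by (auto simp: mult_G inverse_G)
    then have "1 + y * inverse x \<in> R" by auto
    moreover have "(x + y) * inverse x = 1 + y * inverse x" using x0 by (simp add: field_simps)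
    ultimately have "(x + y) * inverse x \<in> R" by simp
    then have "W ((x + y) * inverse x) \<ge> 0" using R_iff[of "(x + y) * inverse x"] that
      by (simp add: mult_G inverse_G)
    then show ?thesis using that by (simp add: W_mult inverse_G W_inverse)
  qed
  show ?thesis using key[of y x] key[of x y] assms by (cases "W x \<le> W y") (auto simp: add.commute)
qed

lemma base_G: "x \<in> L \<Longrightarrow> x \<noteq> 0 \<Longrightarrow> x \<in> G"
  by (rule algebraic_G)
    (auto simp: algebraic_over_def base.pCons_polys_iff base.uminus_mem intro!: bexI[of _ "[:-x, 1:]"])

lemma W_power: "x \<in> G \<Longrightarrow> x ^ n \<in> G \<and> W (x ^ n) = n * W x"
  using W_base[of 1] base_G[of 1] by (induction n) (auto simp: mult_G W_mult algebra_simps)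

lemma R_base_iff: "x \<in> L \<Longrightarrow> x \<noteq> 0 \<Longrightarrow> x \<in> R \<longleftrightarrow> w x \<ge> 0"
  using R_iff W_base base_G by simp

end

text \<open>Euclid's algorithm interchanges the roots of the two polynomials.\<close>

lemma norm_mem_mset:
  fixes A :: "'b::alg_closed_field poly"
  assumes "subfield_set L" and "A \<in> polys L" "A = smult c (\<Prod>x\<in>#M. [:-x, 1:])" "A \<noteq> 0" "B \<in> polys L"
  shows "(\<Prod>x\<in>#M. poly B x) \<in> L"
  using assms(2-)
proof (induction "size M" arbitrary: A B M c rule: less_induct)
  case less
  interpret subfield_set L by fact
  note A = less.prems(2)
  have c0: "c \<noteq> 0" using less.prems by auto
  have size: "degree A = size M" if "A = smult c (\<Prod>x\<in>#M. [:-x, 1:])" "c \<noteq> 0" for A :: "'b poly" and c M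
  proof -
    have "degree (\<Prod>x\<in>#M. [:-x, 1:]) = size M \<and> (\<Prod>x\<in>#M. [:-x, 1:]) \<noteq> (0::'b poly)"
    proof (induction M)
      case (add x M)
      then show ?case by (auto simp: degree_mult_eq simp del: mult_pCons_left)
    qed auto
    then show ?thesis using that by simp
  qed
  have lc: "lead_coeff A = c" if "A = smult c (\<Prod>x\<in>#M. [:-x, 1:])" for A :: "'b poly" and c M
  proof -
    have "lead_coeff (\<Prod>x\<in>#M. [:-x, 1:]) = (1::'b)"
      by (induction M) (auto simp: lead_coeff_mult simp del: mult_pCons_left)
    then show ?thesis using that by (simp add: lead_coeff_smult)
  qed
  have cL: "c \<in> L" using lc[OF A] less.prems(1) by auto
  define B' where "B' = B mod A"
  have B': "B' \<in> polys L" using polys_div_mod less.prems by (simp add: B'_def)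
  have root: "poly A x = 0" if "x \<in># M" for x
    using that unfolding A by (auto simp: poly_prod_mset)
  have "poly B x = poly B' x" if "x \<in># M" for x
    using root[OF that] by (metis B'_def add.left_neutral div_mult_mod_eq mult_zero_right poly_add poly_mult)
  then have eq: "(\<Prod>x\<in>#M. poly B x) = (\<Prod>x\<in>#M. poly B' x)" by (metis image_mset_cong)
  show ?case
  proof (cases "B' = 0")
    case True
    have "(\<Prod>x\<in>#M. poly B' x) = (\<Prod>x\<in>#M. 0)"
      unfolding True by (intro arg_cong[of _ _ prod_mset] image_mset_cong) simp
    then show ?thesis unfolding eq by (auto simp: power_0_left)
  next
    case False
    obtain N where N: "size N = degree B'" "B' = smult (lead_coeff B') (\<Prod>y\<in>#N. [:-y, 1:])"
      using alg_closed_imp_factorization[OF False] by blast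
    have lt: "size N < size M \<or> M = {#}"
    proof (cases "degree A = 0")
      case True
      then show ?thesis using size[OF A c0] by simp
    next
      case dA: False
      then have "degree B' < degree A" using degree_mod_less'[of A B] less.prems(3) False by (auto simp: B'_def)
      then show ?thesis using size[OF A c0] N by simp
    qed
    show ?thesis
    proof (cases "M = {#}")
      case False
      then have "size N < size M" using lt by blast
      then have IH: "(\<Prod>y\<in>#N. poly A y) \<in> L"
        using less.hyps[OF _ B' N(2) \<open>B' \<noteq> 0\<close> less.prems(1)] by blast
      \<comment> \<open>D is the resultant of the two polynomials without leading coefficients. The
        product of B' over the roots of A and that of A over the roots of B' both equal D up to sign
        and powers of leading coefficients, all in L; the induction hypothesis handles the second
        product, which has fewer factors.\<close>
      define D where "D = (\<Prod>x\<in>#M. \<Prod>y\<in>#N. x - y)"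
      have pB: "poly B' x = lead_coeff B' * (\<Prod>y\<in>#N. x - y)" for x
        by (subst N(2)) (simp add: poly_prod_mset)
      have "(\<Prod>x\<in>#M. poly B' x) = lead_coeff B' ^ size M * D"
        by (simp add: pB D_def prod_mset.distrib)
      moreover have "(\<Prod>y\<in>#N. poly A y) = c ^ size N * ((- 1) ^ (size M * size N) * D)"
      proof -
        have pA: "poly A y = c * (- 1) ^ size M * (\<Prod>x\<in>#M. x - y)" for y
        proof -
          have "(\<Prod>x\<in>#M. y - x) = (\<Prod>x\<in>#M. (- 1) * (x - y))" by simp
          also have "\<dots> = (- 1) ^ size M * (\<Prod>x\<in>#M. x - y)"
            by (subst prod_mset.distrib) simp
          finally show ?thesis unfolding A by (simp add: poly_prod_mset)
        qed
        have "(\<Prod>y\<in>#N. poly A y) = (c * (- 1) ^ size M) ^ size N * (\<Prod>y\<in>#N. \<Prod>x\<in>#M. x - y)"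
          unfolding pA by (simp only: prod_mset.distrib prod_mset_constant power_mult_distrib)
        also have "(\<Prod>y\<in>#N. \<Prod>x\<in>#M. x - y) = D" unfolding D_def by (rule prod_mset.swap)
        also have "(c * (- 1) ^ size M) ^ size N = c ^ size N * (- 1) ^ (size M * size N)"
          by (subst power_mult_distrib) (simp add: power_mult)
        finally show ?thesis by (simp add: mult.assoc)
      qed
      then have "D = (\<Prod>y\<in>#N. poly A y) * (- 1) ^ (size M * size N) / c ^ size N"
        using c0 by (simp add: field_simps flip: power_mult_distrib)
      then have "D \<in> L" using IH cL uminus_mem[OF one_mem] by (simp add: divide_mem mult_mem power_mem)
      ultimately show ?thesis unfolding eq using B' by (auto simp: mult_mem power_mem coeff_polys)
    qed auto
  qed
qed

lemma norm_mem:
  fixes \<theta> :: "nat \<Rightarrow> 'b::alg_closed_field"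
  assumes "subfield_set L" "(\<Prod>l<n. [:-\<theta> l, 1:]) \<in> polys L" "B \<in> polys L"
  shows "(\<Prod>l<n. poly B (\<theta> l)) \<in> L"
proof -
  define M where "M = image_mset \<theta> (mset_set {..<n})"
  have "(\<Prod>l<n. [:-\<theta> l, 1:]) = smult 1 (\<Prod>x\<in>#M. [:-x, 1:])"
    by (simp add: M_def prod_unfold_prod_mset multiset.map_comp comp_def)
  moreover have "(\<Prod>l<n. [:-\<theta> l, 1:]) \<noteq> 0" by simp
  ultimately have "(\<Prod>x\<in>#M. poly B x) \<in> L" using norm_mem_mset[OF assms(1)] assms(2,3) by blast
  then show ?thesis by (simp add: M_def prod_unfold_prod_mset multiset.map_comp comp_def)
qed

section \<open>Derivations and separable simple extensions\<close>

lemma frobenius_add: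
  fixes x y :: "'b::comm_semiring_1"
  assumes "Factorial_Ring.prime CHAR('b)"
  shows "(x + y) ^ CHAR('b) = x ^ CHAR('b) + y ^ CHAR('b)"
  using freshmans_dream[OF assms refl] .

lemma frobenius_inj:
  fixes x y :: "'b::field"
  assumes "Factorial_Ring.prime CHAR('b)" "x ^ CHAR('b) = y ^ CHAR('b)"
  shows "x = y"
proof -
  have "x ^ CHAR('b) = ((x - y) + y) ^ CHAR('b)" by simp
  also have "\<dots> = (x - y) ^ CHAR('b) + y ^ CHAR('b)" using assms(1) by (rule frobenius_add)
  finally have "(x - y) ^ CHAR('b) = 0" using assms(2) by simp
  then show ?thesis by simp
qed

text \<open>Newton interpolation, keeping track of denominators.\<close>

lemma (in subring_set) interpolation_polys:
  assumes "finite A" "degree P < card A" "s \<in> R"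
    and "\<And>y. y \<in> A \<Longrightarrow> poly P y \<in> R" "\<And>y. y \<in> A \<Longrightarrow> s * y \<in> R"
    and "\<And>y a. y \<in> A \<Longrightarrow> a \<in> A \<Longrightarrow> y \<noteq> a \<Longrightarrow> s / (y - a) \<in> R"
  shows "smult (s ^ (2 * degree P)) P \<in> polys R"
  using assms
proof (induction "degree P" arbitrary: P A)
  case 0
  then obtain c where c: "P = [:c:]" by (metis degree_eq_zeroE)
  obtain y where "y \<in> A" using 0 by (metis card_gt_0_iff ex_in_conv)
  then show ?case using 0 c by (auto simp: pCons_polys_iff)
next
  case (Suc k)
  obtain a where a: "a \<in> A" using Suc.prems by (metis card_gt_0_iff ex_in_conv le_less_trans zero_le)
  define Q where "Q = synthetic_div P a"
  have PQ: "P = [:- a, 1:] * Q + [:poly P a:]"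
    unfolding Q_def using synthetic_div_correct'[of a P] by simp
  have dQ: "degree Q = k" using Suc.hyps(2) by (simp add: Q_def degree_synthetic_div)
  \<comment> \<open>Divided differences at a are integral only after multiplication by s, so the
    induction is applied to s Q. Together with the s needed to clear the factor Y - a this makes two
    powers of s per degree.\<close>
  have "smult (s ^ (2 * degree (smult s Q))) (smult s Q) \<in> polys R"
  proof (cases "s = 0")
    case False
    then have dsQ: "degree (smult s Q) = k" using dQ by simp
    show ?thesis
    proof (rule Suc.hyps(1)[of "smult s Q" "A - {a}"])
      show "degree (smult s Q) < card (A - {a})" using Suc.prems Suc.hyps(2) a dsQ by simp
      fix y assume y: "y \<in> A - {a}"
      have "poly P y = (y - a) * poly Q y + poly P a" by (subst PQ) (simp add: algebra_simps)
      then have "poly (smult s Q) y = (s / (y - a)) * (poly P y - poly P a)" using y by simp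
      moreover have "(s / (y - a)) * (poly P y - poly P a) \<in> R"
        using y a Suc.prems by (intro mult_mem diff_mem) auto
      ultimately show "poly (smult s Q) y \<in> R" by (rule ssubst)
    qed (use Suc.prems dsQ in auto)
  qed auto
  moreover have "s \<noteq> 0 \<Longrightarrow> degree (smult s Q) = k" using dQ by simp
  ultimately have sQ: "smult (s ^ (2 * k + 1)) Q \<in> polys R" by (cases "s = 0") (simp_all add: mult.commute)
  have "smult (s ^ (2 * degree P)) P = [:- (s * a), s:] * smult (s ^ (2 * k + 1)) Q + [:s ^ (2 * degree P) * poly P a:]"
  proof -
    have "smult (s ^ (2 * degree P)) P = smult (s ^ (2 * degree P)) ([:- a, 1:] * Q + [:poly P a:])"
      using PQ by (rule arg_cong)
    then show ?thesis by (simp add: smult_add_right Suc.hyps(2)[symmetric] algebra_simps smult_diff_right)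
  qed
  also have "\<dots> \<in> polys R"
  proof (intro polys_add polys_mult sQ)
    have "s * a \<in> R" "s ^ (2 * degree P) * poly P a \<in> R" using Suc.prems a by auto
    then show "[:- (s * a), s:] \<in> polys R" "[:s ^ (2 * degree P) * poly P a:] \<in> polys R"
      using Suc.prems by (auto simp: pCons_polys_iff)
  qed
  finally show ?case .
qed

section \<open>Adjoining an algebraic element\<close>

definition adjoin :: "'b::field set \<Rightarrow> 'b \<Rightarrow> 'b set" where
  "adjoin L z = {poly g z |g. g \<in> polys L}"

lemma adjoinI [intro]: "g \<in> polys L \<Longrightarrow> poly g z \<in> adjoin L z"
  by (auto simp: adjoin_def)

lemma adjoinE:
  assumes "x \<in> adjoin L z"
  obtains g where "g \<in> polys L" "x = poly g z"
  using assms by (auto simp: adjoin_def)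

context subfield_set
begin

lemma base_subset_adjoin: "L \<subseteq> adjoin L z"
proof
  fix x assume "x \<in> L"
  then show "x \<in> adjoin L z" using adjoinI[of "[:x:]"] by (auto simp: pCons_polys_iff)
qed

lemma generator_adjoin: "z \<in> adjoin L z"
  using adjoinI[of "[:0, 1:]" L z] by (auto simp: pCons_polys_iff)

lemma subfield_adjoin:
  assumes "z \<in> algebraic_over L"
  shows "subfield_set (adjoin L z)"
proof
  obtain P where P: "irred_over L P" "poly P z = 0"
    using assms exists_min_poly by (auto simp: algebraic_over_def)
  show "0 \<in> adjoin L z" "1 \<in> adjoin L z" using base_subset_adjoin by auto
  fix x assume "x \<in> adjoin L z"
  then obtain g where g: "g \<in> polys L" "x = poly g z" by (rule adjoinE)
  show "- x \<in> adjoin L z" using g adjoinI[of "- g"] by auto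
  show "inverse x \<in> adjoin L z"
  proof (cases "x = 0")
    case False
    then have "\<not> P dvd g" using P(2) g(2) by (auto elim!: dvdE)
    then obtain U W where UW: "U \<in> polys L" "W \<in> polys L" "U * P + W * g = 1"
      using irred_over_bezout[OF P(1) g(1)] by blast
    have "poly (U * P + W * g) z = 1" by (simp add: UW(3))
    then have "poly W z * x = 1" using P(2) g by simp
    then have "inverse x = poly W z" by (metis inverse_unique mult.commute)
    then show ?thesis using UW by auto
  qed (use base_subset_adjoin in auto)
  fix y assume "y \<in> adjoin L z"
  then obtain h where h: "h \<in> polys L" "y = poly h z" by (rule adjoinE)
  show "x + y \<in> adjoin L z" using g h adjoinI[of "g + h"] by auto
  show "x * y \<in> adjoin L z" using g h adjoinI[of "g * h"] by auto
qed

end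

section \<open>Derivations of a subfield\<close>

locale derivation = subfield_set L for L :: "'b::field set" +
  fixes D :: "'b \<Rightarrow> 'b"
  assumes D_mem: "x \<in> L \<Longrightarrow> D x \<in> L"
    and D_add: "x \<in> L \<Longrightarrow> y \<in> L \<Longrightarrow> D (x + y) = D x + D y"
    and D_mult: "x \<in> L \<Longrightarrow> y \<in> L \<Longrightarrow> D (x * y) = D x * y + x * D y"
begin

lemma D_0 [simp]: "D 0 = 0"
  using D_add[of 0 0] by (metis add_cancel_right_right add.right_neutral zero_mem)

lemma D_1 [simp]: "D 1 = 0"
  using D_mult[of 1 1] by (metis add_cancel_right_right mult.right_neutral mult_1 one_mem)

lemma D_sum: "(\<And>i. i \<in> I \<Longrightarrow> f i \<in> L) \<Longrightarrow> D (sum f I) = (\<Sum>i\<in>I. D (f i))"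
  by (induction I rule: infinite_finite_induct) (auto simp: D_add sum_mem)

lemma D_inverse: "x \<in> L \<Longrightarrow> x \<noteq> 0 \<Longrightarrow> D (inverse x) = - D x / x\<^sup>2"
proof -
  assume x: "x \<in> L" "x \<noteq> 0"
  then have "D x * inverse x + x * D (inverse x) = 0" using D_mult[of x "inverse x"] by (simp add: inverse_mem)
  then have "inverse x * (D x * inverse x + x * D (inverse x)) = 0" by simp
  moreover have "inverse x * (x * D (inverse x)) = D (inverse x)" using x by (simp flip: mult.assoc)
  ultimately have "inverse x * (D x * inverse x) + D (inverse x) = 0" by (simp only: distrib_left)
  then have "D (inverse x) = - (inverse x * (D x * inverse x))" by (simp add: eq_neg_iff_add_eq_0 add.commute)
  then show ?thesis by (simp add: power2_eq_square divide_inverse mult_ac)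
qed

lemma D_divide: "x \<in> L \<Longrightarrow> y \<in> L \<Longrightarrow> y \<noteq> 0 \<Longrightarrow> D (x / y) = (D x * y - x * D y) / y\<^sup>2"
  by (simp add: divide_inverse D_mult inverse_mem D_inverse) (simp add: field_simps power2_eq_square)

lemma D_power: "x \<in> L \<Longrightarrow> D (x ^ n) = of_nat n * x ^ (n - 1) * D x"
proof (induction n)
  case (Suc n)
  then show ?case by (cases n) (auto simp: D_mult power_mem mult_mem algebra_simps)
qed simp

lemma D_power_char: "x \<in> L \<Longrightarrow> D (x ^ CHAR('b)) = 0"
  by (simp add: D_power)

lemma D_power_char_mult: "x \<in> L \<Longrightarrow> D (x ^ (CHAR('b) * n)) = 0"
  by (simp add: D_power)

lemma D_power_int:
  assumes "x \<in> L" "x \<noteq> 0"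
  shows "D (x powi n) = of_int n * x powi (n - 1) * D x"
proof (cases n rule: int_cases2)
  case (nonneg k)
  show ?thesis
  proof (cases k)
    case (Suc j)
    then have "n - 1 = int j" using nonneg by simp
    then show ?thesis using nonneg assms by (simp only: power_int_of_nat D_power Suc) simp
  qed (use nonneg in simp)
next
  case (nonpos k)
  show ?thesis
  proof (cases k)
    case (Suc j)
    have "x powi n = inverse (x ^ k)" using nonpos by (simp add: power_int_minus power_inverse)
    then have "D (x powi n) = - (of_nat k * x ^ j * D x) / (x ^ k)\<^sup>2"
    proof -
      have "D (inverse (x ^ k)) = - D (x ^ k) / (x ^ k)\<^sup>2" using assms by (intro D_inverse power_mem) auto
      also have "D (x ^ k) = of_nat k * x ^ j * D x" using D_power[of x k] assms by (simp add: Suc)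
      finally show ?thesis using \<open>x powi n = inverse (x ^ k)\<close> by (simp only:)
    qed
    also have "\<dots> = - of_nat k * (x ^ j / (x ^ k)\<^sup>2) * D x" by simp
    also have "x ^ j / (x ^ k)\<^sup>2 = x powi (n - 1)"
    proof -
      have "n - 1 = - int (Suc k)" using nonpos by simp
      then have "x powi (n - 1) = inverse (x ^ Suc k)" by (simp only: power_int_minus power_int_of_nat)
      moreover have "(x ^ k)\<^sup>2 = x ^ j * x ^ Suc k" by (simp add: Suc power2_eq_square algebra_simps)
      moreover have "x ^ j / (x ^ j * x ^ Suc k) = inverse (x ^ Suc k)" using assms by (simp add: divide_inverse)
      ultimately show ?thesis by simp
    qed
    finally show ?thesis using nonpos by simp
  qed (use nonpos in simp)
qed

lemma map_D_coeff [simp]: "coeff (map_poly D A) i = D (coeff A i)"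
  by (simp add: coeff_map_poly)

lemma map_D_mem: "A \<in> polys L \<Longrightarrow> map_poly D A \<in> polys L"
  by (intro polysI) (simp add: D_mem coeff_polys)

lemma map_D_add: "A \<in> polys L \<Longrightarrow> B \<in> polys L \<Longrightarrow> map_poly D (A + B) = map_poly D A + map_poly D B"
  by (intro poly_eqI) (simp add: D_add coeff_polys)

lemma map_D_mult:
  assumes "A \<in> polys L" "B \<in> polys L"
  shows "map_poly D (A * B) = map_poly D A * B + A * map_poly D B"
  using assms
  by (intro poly_eqI)
    (simp add: coeff_mult D_sum D_mult mult_mem coeff_polys sum.distrib)

end

section \<open>Conjugates in a separable simple extension\<close>

locale simple_extension = subfield_set L for L :: "'b::alg_closed_field set" +
  fixes F :: "'b poly" and \<theta> :: "nat \<Rightarrow> 'b"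
  assumes irred: "irred_over L F"
    and split: "F = (\<Prod>l<degree F. [:- \<theta> l, 1:])"
    and inj: "inj_on \<theta> {..<degree F}"
begin

abbreviation "n \<equiv> degree F"

abbreviation "E \<equiv> adjoin L (\<theta> 0)"

lemma F_poly: "F \<in> polys L" and F_monic: "lead_coeff F = 1" and n_pos: "n > 0" and F_nz: "F \<noteq> 0"
  using irred_overD[OF irred] by auto

lemma root: "l < n \<Longrightarrow> poly F (\<theta> l) = 0"
  by (subst split) (auto simp: poly_prod)

lemma algebraic_root: "l < n \<Longrightarrow> \<theta> l \<in> algebraic_over L"
  using root F_poly F_nz by (auto simp: algebraic_over_def)

sublocale E: subfield_set E
  using subfield_adjoin algebraic_root n_pos by blast

lemma pderiv_root: "l < n \<Longrightarrow> poly (pderiv F) (\<theta> l) = (\<Prod>m\<in>{..<n} - {l}. \<theta> l - \<theta> m)"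
proof -
  assume l: "l < n"
  have "poly (pderiv F) (\<theta> l) = (\<Sum>a<n. \<Prod>m\<in>{..<n} - {a}. \<theta> l - \<theta> m)"
    by (subst split) (simp add: pderiv_prod poly_sum poly_prod pderiv_pCons)
  also have "\<dots> = (\<Sum>a\<in>{l}. \<Prod>m\<in>{..<n} - {a}. \<theta> l - \<theta> m)"
    using l by (intro sum.mono_neutral_right) auto
  finally show ?thesis by simp
qed

lemma pderiv_root_nz: "l < n \<Longrightarrow> poly (pderiv F) (\<theta> l) \<noteq> 0"
  using inj by (auto simp: pderiv_root inj_on_def)

definition rep :: "'b \<Rightarrow> 'b poly" where
  "rep x = (SOME g. g \<in> polys L \<and> poly g (\<theta> 0) = x)"

lemma rep: "x \<in> E \<Longrightarrow> rep x \<in> polys L \<and> poly (rep x) (\<theta> 0) = x"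
  unfolding rep_def by (rule someI_ex) (auto simp: adjoin_def)

text \<open>The embedding of E over L that sends \<theta> 0 to \<theta> l; separability provides as
  many of them as the degree of F.\<close>

definition \<sigma> :: "nat \<Rightarrow> 'b \<Rightarrow> 'b" where
  "\<sigma> l x = poly (rep x) (\<theta> l)"

lemma F_dvd_iff: "g \<in> polys L \<Longrightarrow> l < n \<Longrightarrow> F dvd g \<longleftrightarrow> poly g (\<theta> l) = 0"
  using irred_over_root_dvd[OF irred root] root by (auto elim!: dvdE)

text \<open>Two polynomials representing the same element differ by a multiple of F, which vanishes
  at every root; so the choice made in \<open>rep\<close> is harmless.\<close>

lemma sigma_poly:
  assumes "g \<in> polys L" "l < n"
  shows "\<sigma> l (poly g (\<theta> 0)) = poly g (\<theta> l)"
proof -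
  define h where "h = rep (poly g (\<theta> 0))"
  have h: "h \<in> polys L" "poly h (\<theta> 0) = poly g (\<theta> 0)" using rep[of "poly g (\<theta> 0)"] assms by (auto simp: h_def)
  have "F dvd h - g" using F_dvd_iff[of "h - g" 0] h assms n_pos by auto
  then have "poly (h - g) (\<theta> l) = 0" using F_dvd_iff h assms by blast
  then show ?thesis by (simp add: \<sigma>_def h_def)
qed

lemma sigma_0 [simp]: "x \<in> E \<Longrightarrow> \<sigma> 0 x = x"
  using rep by (simp add: \<sigma>_def)

lemma sigma_base: "x \<in> L \<Longrightarrow> l < n \<Longrightarrow> \<sigma> l x = x"
  using sigma_poly[of "[:x:]" l] by (auto simp: pCons_polys_iff)

lemma sigma_add: "x \<in> E \<Longrightarrow> y \<in> E \<Longrightarrow> l < n \<Longrightarrow> \<sigma> l (x + y) = \<sigma> l x + \<sigma> l y"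
  by (elim adjoinE) (auto simp: sigma_poly polys_add simp flip: poly_add)

lemma sigma_mult: "x \<in> E \<Longrightarrow> y \<in> E \<Longrightarrow> l < n \<Longrightarrow> \<sigma> l (x * y) = \<sigma> l x * \<sigma> l y"
  by (elim adjoinE) (auto simp: sigma_poly polys_mult simp flip: poly_mult)

lemma sigma_eq_0_iff: "x \<in> E \<Longrightarrow> l < n \<Longrightarrow> \<sigma> l x = 0 \<longleftrightarrow> x = 0"
  using F_dvd_iff[of _ l] F_dvd_iff[of _ 0] n_pos by (elim adjoinE) (auto simp: sigma_poly)

lemma sigma_diff: "x \<in> E \<Longrightarrow> y \<in> E \<Longrightarrow> l < n \<Longrightarrow> \<sigma> l (x - y) = \<sigma> l x - \<sigma> l y"
  using sigma_add[of "x - y" y l] by (auto simp: E.diff_mem)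

lemma sigma_inverse: "x \<in> E \<Longrightarrow> l < n \<Longrightarrow> \<sigma> l (inverse x) = inverse (\<sigma> l x)"
proof (cases "x = 0")
  case False
  assume *: "x \<in> E" "l < n"
  have "\<sigma> l x * \<sigma> l (inverse x) = \<sigma> l 1" using sigma_mult[of x "inverse x" l] * False by (auto simp: E.inverse_mem)
  then show ?thesis using sigma_base[of 1 l] * by (metis inverse_unique one_mem)
qed (use sigma_base[of 0] in auto)

lemma sigma_divide: "x \<in> E \<Longrightarrow> y \<in> E \<Longrightarrow> l < n \<Longrightarrow> \<sigma> l (x / y) = \<sigma> l x / \<sigma> l y"
  by (simp add: divide_inverse sigma_mult sigma_inverse E.inverse_mem)

lemma sigma_power: "x \<in> E \<Longrightarrow> l < n \<Longrightarrow> \<sigma> l (x ^ k) = \<sigma> l x ^ k"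
  using sigma_base[of 1 l] by (induction k) (auto simp: sigma_mult E.power_mem)

lemma norm_in_base: "x \<in> E \<Longrightarrow> (\<Prod>l<n. \<sigma> l x) \<in> L"
  unfolding \<sigma>_def using rep F_poly split by (intro norm_mem subfield_set_axioms) auto

definition charpoly :: "'b \<Rightarrow> 'b poly" where
  "charpoly x = (\<Prod>l<n. [:- \<sigma> l x, 1:])"

lemma charpoly_props: "charpoly x \<noteq> 0" "lead_coeff (charpoly x) = 1" "degree (charpoly x) = n"
  "l < n \<Longrightarrow> poly (charpoly x) (\<sigma> l x) = 0"
proof -
  show "charpoly x \<noteq> 0" "l < n \<Longrightarrow> poly (charpoly x) (\<sigma> l x) = 0"
    by (auto simp: charpoly_def poly_prod)
  show "lead_coeff (charpoly x) = 1" unfolding charpoly_def by (subst lead_coeff_prod) simp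
  show "degree (charpoly x) = n" unfolding charpoly_def by (subst degree_prod_eq_sum_degree) auto
qed

lemma charpoly_value:
  assumes "x \<in> E" "y \<in> L"
  shows "poly (charpoly x) y = (\<Prod>l<n. \<sigma> l (y - x))"
proof -
  have "y \<in> E" using assms base_subset_adjoin by auto
  then have "\<sigma> l (y - x) = y - \<sigma> l x" if "l < n" for l
    using that assms by (simp add: sigma_diff sigma_base)
  then show ?thesis by (simp add: charpoly_def poly_prod)
qed

text \<open>At a base element y the value is the norm of y - x, hence in L. An infinite L offers
  enough such y to recover the coefficients by interpolation, with s = 1 because over a field no
  denominators have to be cleared.\<close>

lemma charpoly_polys:
  assumes "infinite L" "x \<in> E"
  shows "charpoly x \<in> polys L"
proof -
  obtain A where A: "finite A" "card A = Suc n" "A \<subseteq> L"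
    using infinite_arbitrarily_large[OF assms(1)] by blast
  have "smult (1 ^ (2 * degree (charpoly x))) (charpoly x) \<in> polys L"
  proof (rule interpolation_polys[OF A(1)])
    show "degree (charpoly x) < card A" using A by (simp add: charpoly_props)
    fix y assume y: "y \<in> A"
    then have "y \<in> E" using A base_subset_adjoin by auto
    then show "poly (charpoly x) y \<in> L" using y A assms charpoly_value norm_in_base by (auto simp: E.diff_mem)
  qed (use A in \<open>auto intro!: diff_mem divide_mem\<close>)
  then show ?thesis by simp
qed

lemma sigma_algebraic: "infinite L \<Longrightarrow> x \<in> E \<Longrightarrow> l < n \<Longrightarrow> \<sigma> l x \<in> algebraic_over L"
  using charpoly_polys[of x] charpoly_props(1)[of x] charpoly_props(4)[of l x] unfolding algebraic_over_def by blast

end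

section \<open>Lifting a derivation to a separable simple extension\<close>

context simple_extension
begin

text \<open>The derivative that \<theta> 0 must receive: differentiating F(\<theta> 0) = 0 gives a
  linear equation for it with coefficient F'(\<theta> 0), solvable because F' is invertible modulo
  F.\<close>

definition kappa :: "('b \<Rightarrow> 'b) \<Rightarrow> 'b poly" where
  "kappa D = (SOME k. k \<in> polys L \<and> F dvd map_poly D F + pderiv F * k)"

text \<open>The derivation of L[Y] that extends D and sends Y to \<open>kappa D\<close>. It maps
  multiples of F to multiples of F, so it descends to E.\<close>

definition delta :: "('b \<Rightarrow> 'b) \<Rightarrow> 'b poly \<Rightarrow> 'b poly" where
  "delta D g = map_poly D g + pderiv g * kappa D"

definition lift_deriv :: "('b \<Rightarrow> 'b) \<Rightarrow> 'b \<Rightarrow> 'b" where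
  "lift_deriv D x = poly (delta D (rep x)) (\<theta> 0)"

lemma kappa:
  assumes "derivation L D"
  shows "kappa D \<in> polys L" "F dvd delta D F"
proof -
  interpret D: derivation L D by fact
  have "\<not> F dvd pderiv F" using F_dvd_iff[of "pderiv F" 0] pderiv_root_nz n_pos F_poly by auto
  then obtain U W where UW: "U \<in> polys L" "W \<in> polys L" "U * F + W * pderiv F = 1"
    using irred_over_bezout[OF irred, of "pderiv F"] F_poly by blast
  have "map_poly D F + pderiv F * (- (W * map_poly D F)) = map_poly D F * (1 - W * pderiv F)"
    by (simp add: algebra_simps)
  also have "1 - W * pderiv F = U * F" using UW(3) by (simp add: algebra_simps)
  finally have "F dvd map_poly D F + pderiv F * (- (W * map_poly D F))" by simp
  moreover have "- (W * map_poly D F) \<in> polys L" using UW F_poly D.map_D_mem by auto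
  ultimately have "\<exists>k. k \<in> polys L \<and> F dvd map_poly D F + pderiv F * k" by blast
  from someI_ex[OF this] show "kappa D \<in> polys L" "F dvd delta D F"
    by (auto simp: kappa_def delta_def)
qed

lemma delta_polys:
  assumes "derivation L D" "g \<in> polys L"
  shows "delta D g \<in> polys L"
  unfolding delta_def using assms kappa(1) derivation.map_D_mem by (auto intro!: polys_add polys_mult)

lemma delta_add:
  assumes "derivation L D" "g \<in> polys L" "h \<in> polys L"
  shows "delta D (g + h) = delta D g + delta D h"
  using assms by (simp add: delta_def derivation.map_D_add pderiv_add algebra_simps)

lemma delta_mult:
  assumes "derivation L D" "g \<in> polys L" "h \<in> polys L"
  shows "delta D (g * h) = delta D g * h + g * delta D h"
  using assms by (simp add: delta_def derivation.map_D_mult pderiv_mult algebra_simps)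

lemma lift_deriv_poly:
  assumes D: "derivation L D" and g: "g \<in> polys L"
  shows "lift_deriv D (poly g (\<theta> 0)) = poly (delta D g) (\<theta> 0)"
proof -
  define h where "h = rep (poly g (\<theta> 0))"
  have h: "h \<in> polys L" "poly h (\<theta> 0) = poly g (\<theta> 0)" using rep[of "poly g (\<theta> 0)"] g by (auto simp: h_def)
  have "F dvd h - g" using F_dvd_iff[of "h - g" 0] h g n_pos by auto
  then have eq: "h = F * ((h - g) div F) + g" by simp
  have q: "(h - g) div F \<in> polys L" using polys_div_mod F_poly h g by blast
  have "delta D h = delta D F * ((h - g) div F) + F * delta D ((h - g) div F) + delta D g"
    using D g q F_poly by (subst eq) (simp add: delta_add delta_mult polys_mult)
  moreover have "poly (delta D F) (\<theta> 0) = 0" using kappa(2)[OF D] root[of 0] n_pos by (auto elim!: dvdE)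
  ultimately show ?thesis using root[of 0] n_pos by (simp add: lift_deriv_def h_def)
qed

lemma sigma_lift_deriv:
  assumes "derivation L D" "g \<in> polys L" "l < n"
  shows "\<sigma> l (lift_deriv D (poly g (\<theta> 0))) = poly (delta D g) (\<theta> l)"
  using assms by (simp add: lift_deriv_poly sigma_poly delta_polys)

lemma derivation_lift:
  assumes D: "derivation L D"
  shows "derivation E (lift_deriv D)"
proof unfold_locales
  fix x assume "x \<in> E"
  then obtain g where g: "g \<in> polys L" "x = poly g (\<theta> 0)" by (rule adjoinE)
  show "lift_deriv D x \<in> E" using g D by (auto simp: lift_deriv_poly delta_polys)
  fix y assume "y \<in> E"
  then obtain h where h: "h \<in> polys L" "y = poly h (\<theta> 0)" by (rule adjoinE)
  show "lift_deriv D (x + y) = lift_deriv D x + lift_deriv D y"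
    using g h D lift_deriv_poly[OF D, of "g + h"] by (simp add: lift_deriv_poly delta_add polys_add)
  show "lift_deriv D (x * y) = lift_deriv D x * y + x * lift_deriv D y"
    using g h D lift_deriv_poly[OF D, of "g * h"] by (simp add: lift_deriv_poly delta_mult polys_mult)
qed

lemma lift_deriv_base:
  assumes D: "derivation L D" and x: "x \<in> L"
  shows "lift_deriv D x = D x"
proof -
  interpret D: derivation L D by fact
  have "lift_deriv D (poly [:x:] (\<theta> 0)) = poly (delta D [:x:]) (\<theta> 0)"
    using x by (intro lift_deriv_poly D) (auto simp: pCons_polys_iff)
  then show ?thesis by (simp add: delta_def pderiv_pCons map_poly_pCons)
qed

text \<open>The Frobenius applied to F(\<theta> 0) = 0. The resulting equation lets polynomials in
  the p-th power of \<theta> 0 be reduced to degree below n.\<close>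

lemma frobenius_F:
  assumes p: "Factorial_Ring.prime CHAR('b)"
    and Fp_eq: "Fp = map_poly (\<lambda>x. x ^ CHAR('b)) F"
  shows "Fp \<in> polys L \<and> degree Fp = n \<and> poly Fp (\<theta> 0 ^ CHAR('b)) = 0"
proof -
  define p where "p = CHAR('b)"
  define z where "z = \<theta> 0 ^ p"
  have p0: "p > 0" using p by (simp add: p_def prime_gt_0_nat)
  have Fp: "Fp = map_poly (\<lambda>x. x ^ p) F" by (simp add: Fp_eq p_def)
  have dFp: "degree Fp = n" unfolding Fp using p0 F_monic by (subst map_poly_degree_eq) auto
  have "poly F (\<theta> 0) ^ p = (\<Sum>i\<le>n. (coeff F i * \<theta> 0 ^ i) ^ p)"
    unfolding poly_altdef p_def using p by (rule freshmans_dream_sum) simp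
  also have "\<dots> = (\<Sum>i\<le>n. coeff Fp i * z ^ i)"
    using p0 by (intro sum.cong refl) (simp add: Fp coeff_map_poly power_mult_distrib z_def mult.commute flip: power_mult)
  finally have Fpz: "poly Fp z = 0" using p0 root[of 0] n_pos by (simp add: poly_altdef[of Fp] dFp zero_power)
  have "Fp \<in> polys L" using F_poly p0 by (intro polysI) (simp add: Fp coeff_map_poly power_mem coeff_polys)
  then show ?thesis using dFp Fpz[unfolded z_def p_def] by blast
qed

text \<open>Separability makes the generator a polynomial in its \<open>p\<close>-th power: both \<open>F\<close> and
  \<open>Y\<^sup>p - \<theta>\<^sup>p = (Y - \<theta>)\<^sup>p\<close> vanish at \<open>\<theta>\<close>, which is a simple root of \<open>F\<close>.\<close>

lemma generator_in_power:
  assumes p: "Factorial_Ring.prime CHAR('b)"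
  shows "\<theta> 0 \<in> adjoin L (\<theta> 0 ^ CHAR('b))"
proof -
  define p where "p = CHAR('b)"
  define z where "z = \<theta> 0 ^ p"
  have p0: "p > 0" using p by (simp add: p_def prime_gt_0_nat)
  have "z \<in> algebraic_over L"
    unfolding algebraic_over_def z_def p_def using frobenius_F[OF p refl] n_pos
    by (intro CollectI bexI[of _ "map_poly (\<lambda>x. x ^ CHAR('b)) F"]) auto
  then interpret Z: subfield_set "adjoin L z" by (rule subfield_adjoin)
  define A where "A = Polynomial.monom 1 p - [:z:]"
  have A: "A \<in> polys (adjoin L z)" unfolding A_def using generator_adjoin[of z] by (auto simp: Z.pCons_polys_iff)
  have rootA: "poly A y = 0 \<longleftrightarrow> y = \<theta> 0" for y
    using frobenius_inj[of y "\<theta> 0"] p by (auto simp: A_def z_def poly_monom p_def)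
  have "A \<noteq> 0" using rootA[of "\<theta> 0 + 1"] by (metis add_cancel_right_right poly_0 zero_neq_one)
  then obtain P where P: "irred_over (adjoin L z) P" "poly P (\<theta> 0) = 0"
    using Z.exists_min_poly[OF A] rootA by blast
  note PL = irred_overD[OF P(1)]
  have "P dvd A" using Z.irred_over_root_dvd[OF P A] rootA by blast
  have "P dvd F" using F_poly polys_mono[OF base_subset_adjoin] root n_pos
    by (intro Z.irred_over_root_dvd[OF P]) auto
  \<comment> \<open>The only root of A, hence of P, is \<theta> 0. A nonlinear P would therefore
    have it as a multiple root, and so would F.\<close>
  have "degree P = 1"
  proof (rule ccontr)
    assume "degree P \<noteq> 1"
    obtain Q where Q: "P = [:- \<theta> 0, 1:] * Q" using P(2) unfolding poly_eq_0_iff_dvd by (rule dvdE)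
    have "Q \<noteq> 0" using Q PL by auto
    then have "degree P = Suc (degree Q)" unfolding Q by (subst degree_mult_eq) auto
    then have "degree Q > 0" using \<open>degree P \<noteq> 1\<close> by simp
    then obtain r where r: "poly Q r = 0" using alg_closed_imp_poly_has_root by blast
    then have "poly P r = 0" by (simp add: Q)
    then have "poly A r = 0" using \<open>P dvd A\<close> by (auto elim!: dvdE)
    then have "r = \<theta> 0" by (simp only: rootA)
    then have "poly Q (\<theta> 0) = 0" using r by simp
    then have "[:- \<theta> 0, 1:] dvd Q" by (simp only: poly_eq_0_iff_dvd)
    then obtain Q' where Q': "Q = [:- \<theta> 0, 1:] * Q'" by (rule dvdE)
    obtain H where "F = P * H" using \<open>P dvd F\<close> by (rule dvdE)
    then have "F = [:- \<theta> 0, 1:] * ([:- \<theta> 0, 1:] * (Q' * H))" unfolding Q Q' by (simp only: mult.assoc)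
    then have "poly (pderiv F) (\<theta> 0) = 0" by (simp add: pderiv_mult del: mult_pCons_left)
    then show False using pderiv_root_nz n_pos by blast
  qed
  moreover obtain c P1 where P1: "P = pCons c P1" by (cases P)
  ultimately have "degree P1 = 0" by (auto split: if_splits)
  then obtain a where "P1 = [:a:]" by (elim degree_eq_zeroE)
  then have "P = [:c, 1:]" using PL(2,3) P1 by (auto split: if_splits)
  then have "c \<in> adjoin L z" "c = - \<theta> 0" using PL(1) P(2) by (auto simp: Z.pCons_polys_iff eq_neg_iff_add_eq_0 add.commute)
  then show ?thesis using Z.uminus_mem[of c] by (simp add: z_def p_def)
qed

text \<open>Write x = c(z) with z the p-th power of \<theta> 0 and c of degree below n over L.
  Derivations kill z, so the derivative of x is (D c)(z), with D applied to coefficients. If it is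
  0, then D c also vanishes at the p-th powers of all n roots, which are distinct, so D c = 0. Every
  coefficient of c is then a p-th power in L, and x is a p-th power in E.\<close>

lemma lift_deriv_kernel:
  assumes p: "Factorial_Ring.prime CHAR('b)"
    and Ds: "\<And>D. D \<in> Ds \<Longrightarrow> derivation L D"
    and ker: "\<And>x. x \<in> L \<Longrightarrow> (\<And>D. D \<in> Ds \<Longrightarrow> D x = 0) \<Longrightarrow> \<exists>y\<in>L. x = y ^ CHAR('b)"
    and x: "x \<in> E" and Dx: "\<And>D. D \<in> Ds \<Longrightarrow> lift_deriv D x = 0"
  shows "\<exists>y\<in>E. x = y ^ CHAR('b)"
proof -
  define p where "p = CHAR('b)"
  have p0: "p > 0" using p by (simp add: p_def prime_gt_0_nat)
  define z where "z = \<theta> 0 ^ p"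
  obtain R where R: "R \<in> polys L" "poly R z = \<theta> 0"
  proof -
    obtain R where "R \<in> polys L" "\<theta> 0 = poly R (\<theta> 0 ^ CHAR('b))" using generator_in_power[OF p] by (rule adjoinE)
    then show thesis using that[of R] unfolding z_def p_def by metis
  qed
  obtain g where g: "g \<in> polys L" "x = poly g (\<theta> 0)" using x by (rule adjoinE)
  define Fp where "Fp = map_poly (\<lambda>x. x ^ p) F"
  have Fp: "Fp \<in> polys L" and dFp: "degree Fp = n" and Fpz: "poly Fp z = 0"
    using frobenius_F[OF p refl] by (auto simp: Fp_def z_def p_def)
  define h where "h = pcompose g R"
  define c where "c = h mod Fp"
  have c: "c \<in> polys L" unfolding c_def h_def using g R Fp polys_div_mod polys_pcompose by blast
  have "poly h z = x" using g R by (simp add: h_def poly_pcompose)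
  moreover have "poly h z = poly c z"
    unfolding c_def using Fpz by (metis add.left_neutral div_mult_mod_eq mult_zero_right poly_add poly_mult)
  ultimately have xc: "x = poly c z" by simp
  have dc: "degree c < n" unfolding c_def using dFp n_pos
    by (metis degree_0 degree_mod_less le0 le_neq_implies_less less_numeral_extra(3) less_le_trans nat_less_le)
  have coeff0: "D (coeff c i) = 0" if D: "D \<in> Ds" for D i
  proof -
    interpret D: derivation L D using Ds D by blast
    interpret DE: derivation E "lift_deriv D" by (rule derivation_lift) (rule D.derivation_axioms)
    define C where "C = map_poly D c"
    have C: "C \<in> polys L" unfolding C_def using c by (rule D.map_D_mem)
    have E1: "coeff c i \<in> E" "\<theta> 0 \<in> E" for i
      using subsetD[OF base_subset_adjoin coeff_polys[OF c]] generator_adjoin by auto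
    have "lift_deriv D x = (\<Sum>i\<le>degree c. lift_deriv D (coeff c i * z ^ i))"
      unfolding xc poly_altdef by (rule DE.D_sum) (use E1 in \<open>auto simp: z_def\<close>)
    also have "\<dots> = (\<Sum>i\<le>degree c. D (coeff c i) * z ^ i)"
    proof (intro sum.cong refl)
      fix i
      have "lift_deriv D (z ^ i) = 0" unfolding z_def p_def power_mult[symmetric] by (rule DE.D_power_char_mult) (rule E1)
      moreover have "lift_deriv D (coeff c i) = D (coeff c i)" using c by (intro lift_deriv_base D.derivation_axioms) auto
      ultimately show "lift_deriv D (coeff c i * z ^ i) = D (coeff c i) * z ^ i"
        using E1 by (simp add: DE.D_mult z_def E.power_mem)
    qed
    also have "\<dots> = poly C z"
    proof -
      have "degree C \<le> degree c" unfolding C_def by (rule map_poly_degree_leq)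
      then have "poly C z = (\<Sum>i\<le>degree c. coeff C i * z ^ i)"
        unfolding poly_altdef by (intro sum.mono_neutral_left) (auto simp: coeff_eq_0)
      then show ?thesis by (simp add: C_def)
    qed
    finally have Cz: "poly C z = 0" using Dx D by simp
    have "poly C (\<theta> l ^ p) = 0" if l: "l < n" for l
    proof -
      have "pcompose C (Polynomial.monom 1 p) \<in> polys L" using C by auto
      moreover have "poly (pcompose C (Polynomial.monom 1 p)) (\<theta> 0) = 0" using Cz by (simp add: poly_pcompose poly_monom z_def)
      ultimately have "poly (pcompose C (Polynomial.monom 1 p)) (\<theta> l) = 0" using F_dvd_iff l n_pos by blast
      then show ?thesis by (simp add: poly_pcompose poly_monom)
    qed
    then have sub: "(\<lambda>l. \<theta> l ^ p) ` {..<n} \<subseteq> {y. poly C y = 0}" by auto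
    have injp: "inj_on (\<lambda>l. \<theta> l ^ p) {..<n}"
      using inj frobenius_inj[OF p] by (auto simp: inj_on_def p_def)
    have "C = 0"
    proof (rule ccontr)
      assume "C \<noteq> 0"
      then have "card ((\<lambda>l. \<theta> l ^ p) ` {..<n}) \<le> card {y. poly C y = 0}"
        using sub by (intro card_mono poly_roots_finite)
      then have "n \<le> degree C" using card_poly_roots_bound[OF \<open>C \<noteq> 0\<close>] injp by (simp add: card_image)
      then show False using dc map_poly_degree_leq[of D c] by (simp add: C_def)
    qed
    then have "coeff C i = 0" by simp
    then show ?thesis by (simp add: C_def)
  qed
  have "\<exists>y\<in>L. coeff c i = y ^ p" for i unfolding p_def by (intro ker coeff_polys c coeff0)
  then have "\<forall>i. \<exists>y. y \<in> L \<and> coeff c i = y ^ p" by blast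
  from choice[OF this] obtain b where b: "\<And>i. b i \<in> L" "\<And>i. coeff c i = b i ^ p" by blast
  define y where "y = (\<Sum>i\<le>degree c. b i * \<theta> 0 ^ i)"
  have "y \<in> E" unfolding y_def using subsetD[OF base_subset_adjoin b(1)] generator_adjoin
    by (intro E.sum_mem E.mult_mem E.power_mem)
  have "y ^ p = (\<Sum>i\<le>degree c. (b i * \<theta> 0 ^ i) ^ p)"
    unfolding y_def p_def using p by (rule freshmans_dream_sum) simp
  also have "\<dots> = x" unfolding xc poly_altdef
    by (intro sum.cong refl) (simp add: b z_def power_mult_distrib mult.commute flip: power_mult)
  finally show ?thesis using \<open>y \<in> E\<close> by (auto simp: p_def)
qed

end

section \<open>Bounds for lifted derivations\<close>

text \<open>Sylvester's recursion. It serves to find y, a polynomial expression in f, such that 1/y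
  and f/y are integral at all conjugates at once. A denominator f + c with an integral constant c
  may fail to exist, because the residue field can be too small to avoid the residues of all
  conjugates.\<close>

primrec sylvester :: "nat \<Rightarrow> 'b::comm_ring_1 \<Rightarrow> 'b" where
  "sylvester 0 x = x"
| "sylvester (Suc r) x = sylvester r x ^ 2 - sylvester r x + 1"

context valuation_subring
begin

lemma sylvester_mem: "x \<in> R \<Longrightarrow> sylvester r x \<in> R"
  by (induction r) auto

text \<open>The next term after s is 1 + s (s - 1), and the recursion preserves the form 1 + s
  q.\<close>

lemma sylvester_cong:
  assumes "x \<in> R" "r < r'"
  shows "\<exists>q\<in>R. sylvester r' x = 1 + sylvester r x * q"
  using assms(2)
proof (induction r')
  case (Suc r')
  show ?case
  proof (cases "r = r'")
    case True
    then show ?thesis using assms sylvester_mem[of x r]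
      by (intro bexI[of _ "sylvester r x - 1"]) (auto simp: power2_eq_square algebra_simps)
  next
    case False
    then obtain q where q: "q \<in> R" "sylvester r' x = 1 + sylvester r x * q" using Suc by auto
    have "sylvester (Suc r') x = 1 + sylvester r x * (q * (1 + sylvester r x * q))"
      using q by (simp add: power2_eq_square algebra_simps)
    then show ?thesis using q sylvester_mem[of x r] assms by (intro bexI[of _ "q * (1 + sylvester r x * q)"]) auto
  qed
qed simp

lemma sylvester_nonunits_unique:
  assumes "x \<in> R" "sylvester r x \<in> nonunits" "sylvester r' x \<in> nonunits"
  shows "r = r'"
proof -
  have key: False if lt: "r < r'" and n: "sylvester r x \<in> nonunits" "sylvester r' x \<in> nonunits" for r r'
  proof -
    obtain q where q: "q \<in> R" "sylvester r' x = 1 + sylvester r x * q" using sylvester_cong[OF assms(1) lt] by blast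
    have "- (sylvester r x * q) \<in> nonunits"
    proof (rule ccontr)
      assume "- (sylvester r x * q) \<notin> nonunits"
      moreover have "- (sylvester r x * q) \<in> R" using n q by (auto simp: nonunits_def)
      ultimately have i: "inverse (- (sylvester r x * q)) \<in> R" "sylvester r x * q \<noteq> 0" by (auto simp: nonunits_def)
      then have "(- q) * inverse (- (sylvester r x * q)) \<in> R" using q by blast
      moreover have "(- q) * inverse (- (sylvester r x * q)) = inverse (sylvester r x)" using i by simp
      ultimately have "inverse (sylvester r x) \<in> R" by metis
      then show False using n(1) i(2) unfolding nonunits_def by auto
    qed
    then have "sylvester r' x + - (sylvester r x * q) \<in> nonunits" using n nonunits_add by blast
    then show False using q by (simp add: nonunits_def)
  qed
  show ?thesis using key[of r r'] key[of r' r] assms by (meson linorder_neqE_nat)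
qed

text \<open>For s outside R the next term s' satisfies s'/s = (s - 1) + 1/s, which is again outside
  R; so the pole only grows along the sequence, starting from x itself.\<close>

lemma sylvester_notin:
  assumes "x \<notin> R"
  shows "sylvester r x \<notin> R \<and> x / sylvester r x \<in> R"
proof (induction r)
  case 0
  then show ?case using assms by auto
next
  case (Suc r)
  define s where "s = sylvester r x"
  have s: "s \<notin> R" "x / s \<in> R" using Suc by (auto simp: s_def)
  then have s0: "s \<noteq> 0" by auto
  have si: "inverse s \<in> R" using s inverse_memI by blast
  define s' where "s' = s ^ 2 - s + 1"
  have eq: "s' / s = (s - 1) + inverse s" using s0 by (simp add: s'_def power2_eq_square field_simps)
  have notin: "s' / s \<notin> R"
  proof
    assume "s' / s \<in> R"
    then have "s' / s - inverse s + 1 \<in> R" using si by auto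
    then show False using s eq by simp
  qed
  then have "s / s' \<in> R" using inverse_memI[OF notin] by simp
  then have "(x / s) * (s / s') \<in> R" using s by blast
  moreover have "(x / s) * (s / s') = x / s'" using s0 by simp
  ultimately have "x / s' \<in> R" by metis
  moreover have "s' \<notin> R"
  proof
    assume "s' \<in> R"
    then have "s' * inverse s \<in> R" using si by auto
    then show False using notin by (simp add: divide_inverse)
  qed
  ultimately show ?case by (simp add: s_def s'_def)
qed

text \<open>Distinct members of the sequence are coprime, so each \<open>y l\<close> spoils at most one index.\<close>

lemma exists_sylvester_inverse:
  fixes n :: nat
  shows "\<exists>r. \<forall>l<n. sylvester r (y l) \<noteq> 0 \<and> inverse (sylvester r (y l)) \<in> R"
proof -
  define B where "B l = {r. y l \<in> R \<and> sylvester r (y l) \<in> nonunits}" for l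
  have "finite (B l)" for l
  proof (cases "B l = {}")
    case False
    then obtain r where "r \<in> B l" by auto
    then have "B l \<subseteq> {r}" using sylvester_nonunits_unique by (auto simp: B_def)
    then show ?thesis by (rule finite_subset) simp
  qed simp
  then have "finite (\<Union>l<n. B l)" by auto
  then obtain r where r: "r \<notin> (\<Union>l<n. B l)" using ex_new_if_finite[OF infinite_UNIV_nat] by blast
  show ?thesis
  proof (intro exI allI impI)
    fix l assume l: "l < n"
    show "sylvester r (y l) \<noteq> 0 \<and> inverse (sylvester r (y l)) \<in> R"
    proof (cases "y l \<in> R")
      case True
      then show ?thesis using r l sylvester_mem[OF True] by (auto simp: B_def nonunits_def)
    next
      case False
      then show ?thesis using sylvester_notin[OF False, of r] inverse_memI by auto
    qed
  qed
qed

end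

locale extended_valuation_roots = simple_extension L F \<theta> + extended_valuation L w R G W
  for L :: "'b::alg_closed_field set" and F \<theta> w R G W +
  assumes infinite_base: "infinite L"
begin

lemma sigma_G: "x \<in> E \<Longrightarrow> x \<noteq> 0 \<Longrightarrow> l < n \<Longrightarrow> \<sigma> l x \<in> G"
  using sigma_algebraic[OF infinite_base] sigma_eq_0_iff algebraic_G by blast

lemma W_sigma_mult: "x \<in> E \<Longrightarrow> x \<noteq> 0 \<Longrightarrow> y \<in> E \<Longrightarrow> y \<noteq> 0 \<Longrightarrow> l < n \<Longrightarrow>
    W (\<sigma> l (x * y)) = W (\<sigma> l x) + W (\<sigma> l y)"
  by (simp add: sigma_mult W_mult sigma_G)

lemma W_sigma_add: "x \<in> E \<Longrightarrow> x \<noteq> 0 \<Longrightarrow> y \<in> E \<Longrightarrow> y \<noteq> 0 \<Longrightarrow> x + y \<noteq> 0 \<Longrightarrow> l < n \<Longrightarrow>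
    W (\<sigma> l (x + y)) \<ge> min (W (\<sigma> l x)) (W (\<sigma> l y))"
  using sigma_G[of "x + y" l] by (simp add: sigma_add E.add_mem W_add sigma_G)

lemma valued_sigma: "l < n \<Longrightarrow> valued_field E (\<lambda>x. W (\<sigma> l x))"
  by unfold_locales (auto intro: W_sigma_mult W_sigma_add)

lemma R_sigma_iff: "x \<in> E \<Longrightarrow> x \<noteq> 0 \<Longrightarrow> l < n \<Longrightarrow> \<sigma> l x \<in> R \<longleftrightarrow> W (\<sigma> l x) \<ge> 0"
  using R_iff sigma_G by blast

lemma W_sigma_base: "x \<in> L \<Longrightarrow> x \<noteq> 0 \<Longrightarrow> l < n \<Longrightarrow> W (\<sigma> l x) = w x"
  by (simp add: sigma_base W_base)

lemma W_norm:
  assumes "x \<in> E" "x \<noteq> 0"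
  shows "(\<Prod>l<n. \<sigma> l x) \<noteq> 0" "w (\<Prod>l<n. \<sigma> l x) = (\<Sum>l<n. W (\<sigma> l x))"
proof -
  show nz: "(\<Prod>l<n. \<sigma> l x) \<noteq> 0" using assms by (simp add: sigma_eq_0_iff)
  have "(\<Prod>l<m. \<sigma> l x) \<in> G \<and> W (\<Prod>l<m. \<sigma> l x) = (\<Sum>l<m. W (\<sigma> l x))" if "m \<le> n" for m
    using that
  proof (induction m)
    case 0
    then show ?case using W_base[of 1] base_G[of 1] by simp
  next
    case (Suc m)
    then show ?case using assms by (simp add: W_mult mult_G sigma_G)
  qed
  then have "W (\<Prod>l<n. \<sigma> l x) = (\<Sum>l<n. W (\<sigma> l x))" by blast
  moreover have "W (\<Prod>l<n. \<sigma> l x) = w (\<Prod>l<n. \<sigma> l x)" using nz norm_in_base[OF assms(1)] W_base by blast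
  ultimately show "w (\<Prod>l<n. \<sigma> l x) = (\<Sum>l<n. W (\<sigma> l x))" by simp
qed

text \<open>Denominators: \<open>s\<close> clears those of the roots and of the inverse differences of roots,
  \<open>u\<close> those of the derivation.\<close>

definition clears :: "('b \<Rightarrow> 'b) \<Rightarrow> 'b \<Rightarrow> 'b \<Rightarrow> bool" where
  "clears D s u \<longleftrightarrow> s \<in> L \<and> s \<noteq> 0 \<and> s \<in> R \<and> u \<in> L \<and> u \<noteq> 0 \<and> (\<forall>l<n. s * \<theta> l \<in> R)
     \<and> (\<forall>l<n. \<forall>m<n. l \<noteq> m \<longrightarrow> s / (\<theta> l - \<theta> m) \<in> R)
     \<and> (\<forall>c\<in>L. c \<in> R \<longrightarrow> u * D c \<in> R) \<and> (\<forall>i. u * coeff (kappa D) i \<in> R)"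

text \<open>By interpolation a = s^(2 n) makes the coefficients of a g integral, and u then clears
  the derivative of a g. Passing from a g back to g by the product rule costs a second factor a, and
  evaluating at \<theta> l, in degree at most n plus that of \<open>kappa D\<close>, costs the
  remaining power of s.\<close>

lemma delta_bound:
  assumes D: "derivation L D" and cl: "clears D s u"
    and g: "g \<in> polys L" "degree g < n" "\<And>l. l < n \<Longrightarrow> poly g (\<theta> l) \<in> R" and l: "l < n"
  shows "(s ^ (n + degree (kappa D)) * u * (s ^ (2 * n)) ^ 2) * poly (delta D g) (\<theta> l) \<in> R"
proof -
  interpret D: derivation L D by fact
  define a where "a = s ^ (2 * n)"
  have s: "s \<in> L" "s \<in> R" "u \<in> L" using cl by (auto simp: clears_def)
  have aL: "a \<in> L" "a \<in> R" using s by (auto simp: a_def power_mem)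
  have "smult (s ^ (2 * degree g)) g \<in> polys R"
  proof (rule ext.interpolation_polys[of "\<theta> ` {..<n}"])
    show "degree g < card (\<theta> ` {..<n})" using g(2) inj by (simp add: card_image)
    show "s \<in> R" by (rule s)
    show "poly g y \<in> R" if "y \<in> \<theta> ` {..<n}" for y using that g(3) by auto
    show "s * y \<in> R" if "y \<in> \<theta> ` {..<n}" for y using that cl by (auto simp: clears_def)
    show "s / (y - b) \<in> R" if "y \<in> \<theta> ` {..<n}" "b \<in> \<theta> ` {..<n}" "y \<noteq> b" for y b
      using that cl by (auto simp: clears_def)
  qed simp
  then have "smult (s ^ (2 * n - 2 * degree g)) (smult (s ^ (2 * degree g)) g) \<in> polys R"
    by (rule ext.polys_smult[OF ext.power_mem[OF s(2)]])
  moreover have "s ^ (2 * n - 2 * degree g) * s ^ (2 * degree g) = a"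
    using g(2) by (simp add: a_def flip: power_add)
  ultimately have hR: "smult a g \<in> polys R" by simp
  have hL: "smult a g \<in> polys L" using aL g by auto
  have uD: "u * D c \<in> R" if "c \<in> L" "c \<in> R" for c using that cl by (auto simp: clears_def)
  have uk: "smult u (kappa D) \<in> polys R" using cl by (auto simp: clears_def intro!: polysI)
  have Da: "delta D (smult a g) = smult (D a) g + smult a (delta D g)"
    using aL g by (intro poly_eqI)
      (simp add: delta_def D.D_mult coeff_polys pderiv_smult algebra_simps)
  have "smult u (delta D (smult a g)) = smult u (map_poly D (smult a g)) + pderiv (smult a g) * smult u (kappa D)"
    by (simp add: delta_def smult_add_right)
  also have "\<dots> \<in> polys R"
  proof (intro ext.polys_add ext.polys_mult uk ext.polys_pderiv hR)
    have "u * D (coeff (smult a g) i) \<in> R" for i using hL hR by (intro uD coeff_polys)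
    then show "smult u (map_poly D (smult a g)) \<in> polys R" by (intro polysI) simp
  qed
  finally have "smult a (smult u (delta D (smult a g))) - smult (u * D a) (smult a g) \<in> polys R"
    by (rule ext.polys_diff[OF ext.polys_smult[OF aL(2)] ext.polys_smult[OF uD[OF aL] hR]])
  moreover have "smult a (smult u (delta D (smult a g))) - smult (u * D a) (smult a g) = smult (u * a ^ 2) (delta D g)"
    unfolding Da by (simp add: smult_add_right power2_eq_square mult_ac)
  ultimately have qR: "smult (u * a ^ 2) (delta D g) \<in> polys R" by simp
  define q where "q = smult (u * a ^ 2) (delta D g)"
  define N where "N = n + degree (kappa D)"
  have "degree (pderiv g) \<le> degree g" by (rule degree_le) (simp add: coeff_pderiv coeff_eq_0)
  then have "degree (pderiv g * kappa D) \<le> degree g + degree (kappa D)"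
    using degree_mult_le[of "pderiv g" "kappa D"] by linarith
  moreover have "degree (map_poly D g) \<le> degree g" by (rule map_poly_degree_leq)
  ultimately have "degree (delta D g) \<le> N"
    using g(2) by (auto simp: delta_def N_def intro!: degree_add_le)
  then have "degree q \<le> N" using degree_smult_le[of "u * a ^ 2" "delta D g"] by (simp add: q_def)
  have "s ^ N * poly q (\<theta> l) = (\<Sum>i\<le>degree q. coeff q i * (s ^ (N - i) * (s * \<theta> l) ^ i))"
  proof -
    have "s ^ N * (coeff q i * \<theta> l ^ i) = coeff q i * (s ^ (N - i) * (s * \<theta> l) ^ i)" if "i \<le> degree q" for i
    proof -
      have "s ^ N = s ^ (N - i) * s ^ i" using that \<open>degree q \<le> N\<close> by (simp flip: power_add)
      then show ?thesis by (simp add: power_mult_distrib)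
    qed
    then show ?thesis unfolding poly_altdef sum_distrib_left by (intro sum.cong refl) auto
  qed
  also have "\<dots> \<in> R"
  proof (rule ext.sum_mem, rule ext.mult_mem[OF _ ext.mult_mem[OF ext.power_mem[OF s(2)] ext.power_mem]])
    show "coeff q i \<in> R" for i using qR unfolding q_def by (rule coeff_polys)
    show "s * \<theta> l \<in> R" using cl l by (auto simp: clears_def)
  qed
  finally show ?thesis by (simp add: q_def a_def N_def mult_ac)
qed

text \<open>Only the conjugate \<sigma> l f is assumed integral, while \<open>delta_bound\<close>
  needs all of them. So f is written as h'/h with h = 1/y and h' = f/y integral at every conjugate,
  y being a term of \<open>sylvester\<close>. In the quotient rule the denominator becomes the
  factor y^2, which is integral at the conjugate l.\<close>

lemma lift_deriv_bound:
  assumes D: "derivation L D" and cl: "clears D s u"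
    and f: "f \<in> E" "l < n" "\<sigma> l f \<in> R"
  shows "(s ^ (n + degree (kappa D)) * u * (s ^ (2 * n)) ^ 2) * \<sigma> l (lift_deriv D f) \<in> R"
proof -
  define t where "t = s ^ (n + degree (kappa D)) * u * (s ^ (2 * n)) ^ 2"
  interpret DE: derivation E "lift_deriv D" by (rule derivation_lift) fact
  have integral: "t * \<sigma> l (lift_deriv D h) \<in> R" if h: "h \<in> E" "\<And>m. m < n \<Longrightarrow> \<sigma> m h \<in> R" for h
  proof -
    define g where "g = rep h mod F"
    have g: "g \<in> polys L" unfolding g_def using rep[OF h(1)] F_poly polys_div_mod by blast
    have ev: "poly g (\<theta> m) = \<sigma> m h" if "m < n" for m
      using root[OF that] unfolding g_def \<sigma>_def
      by (metis add.left_neutral div_mult_mod_eq mult_zero_right poly_add poly_mult)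
    have hg: "h = poly g (\<theta> 0)" using ev[of 0] n_pos h by simp
    have "degree g < n" unfolding g_def using n_pos
      by (metis degree_0 degree_mod_less gr_implies_not0 degree_mod_less' F_nz)
    then have "t * poly (delta D g) (\<theta> l) \<in> R"
      unfolding t_def using ev h g f by (intro delta_bound D cl) auto
    then show ?thesis unfolding hg using sigma_lift_deriv[OF D g f(2)] by simp
  qed
  obtain r where r: "\<And>m. m < n \<Longrightarrow> sylvester r (\<sigma> m f) \<noteq> 0 \<and> inverse (sylvester r (\<sigma> m f)) \<in> R"
    using ext.exists_sylvester_inverse[of n "\<lambda>m. \<sigma> m f"] by blast
  define y where "y = sylvester r f"
  have yE: "y \<in> E \<and> (\<forall>m<n. \<sigma> m y = sylvester r (\<sigma> m f))"
    unfolding y_def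
  proof (induction r)
    case (Suc r)
    then show ?case using sigma_base[of 1]
      by (auto simp: E.add_mem E.diff_mem E.power_mem sigma_add sigma_diff sigma_power)
  qed (use f in auto)
  have y0: "y \<noteq> 0" using yE r[of l] sigma_eq_0_iff[of y l] f by auto
  define h where "h = inverse y"
  define h' where "h' = f / y"
  have hE: "h \<in> E" "h' \<in> E" "h \<noteq> 0" using yE y0 f by (auto simp: h_def h'_def)
  have hR: "\<sigma> m h \<in> R" if "m < n" for m
    using that yE r by (simp add: h_def sigma_inverse)
  have h'R: "\<sigma> m h' \<in> R" if m: "m < n" for m
  proof (cases "\<sigma> m f \<in> R")
    case True
    then show ?thesis using hR[OF m] yE f m ext.mult_mem[of "\<sigma> m f" "\<sigma> m h"]
      by (simp add: h'_def h_def sigma_inverse sigma_mult E.inverse_mem divide_inverse)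
  next
    case False
    then show ?thesis using ext.sylvester_notin[OF False, of r] yE f m by (simp add: h'_def sigma_divide)
  qed
  have f_eq: "f = h' / h" using y0 by (simp add: h'_def h_def)
  have "lift_deriv D f = (lift_deriv D h' * h - h' * lift_deriv D h) * y ^ 2"
    using DE.D_divide[of h' h] hE f_eq y0 by (simp add: h_def field_simps)
  then have "\<sigma> l (lift_deriv D f) =
    (\<sigma> l (lift_deriv D h') * \<sigma> l h - \<sigma> l h' * \<sigma> l (lift_deriv D h)) * (sylvester r (\<sigma> l f)) ^ 2"
    using hE yE f DE.D_mem by (simp add: sigma_mult sigma_diff sigma_power E.diff_mem E.mult_mem E.power_mem)
  then have "t * \<sigma> l (lift_deriv D f) =
    ((t * \<sigma> l (lift_deriv D h')) * \<sigma> l h - \<sigma> l h' * (t * \<sigma> l (lift_deriv D h))) * (sylvester r (\<sigma> l f)) ^ 2"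
    by (simp only:) (simp add: algebra_simps)
  also have "\<dots> \<in> R"
    using ext.mult_mem[OF ext.diff_mem[OF
        ext.mult_mem[OF integral[OF hE(2) h'R] hR[OF f(2)]]
        ext.mult_mem[OF h'R[OF f(2)] integral[OF hE(1) hR]]] ext.power_mem[OF ext.sylvester_mem[OF f(3)]]]
    by blast
  finally show ?thesis by (simp add: t_def)
qed

text \<open>The inverse of \<theta> l - \<theta> m is the product of the other differences at
  \<theta> l divided by F'(\<theta> l). Powers of a make those differences integral, and b clears
  the inverse of F'(\<theta> l).\<close>

lemma clearsI:
  assumes a: "a \<in> L" "a \<in> R" "a \<noteq> 0" and b: "b \<in> L" "b \<in> R" "b \<noteq> 0" and u: "u \<in> L" "u \<noteq> 0"
    and root: "\<And>l. l < n \<Longrightarrow> a * \<theta> l \<in> R"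
    and disc: "\<And>l. l < n \<Longrightarrow> b / poly (pderiv F) (\<theta> l) \<in> R"
    and D: "\<And>c. c \<in> L \<Longrightarrow> c \<in> R \<Longrightarrow> u * D c \<in> R" "\<And>i. u * coeff (kappa D) i \<in> R"
  shows "clears D (a ^ n * b) u"
proof -
  have "a ^ n * b * \<theta> l \<in> R" if l: "l < n" for l
  proof -
    have "a ^ n = a ^ (n - 1) * a" using n_pos by (simp flip: power_Suc2)
    then have eq: "a ^ n * b * \<theta> l = a ^ (n - 1) * b * (a * \<theta> l)" by simp
    show ?thesis unfolding eq by (intro ext.mult_mem[OF _ root[OF l]] ext.mult_mem ext.power_mem a b)
  qed
  moreover have "a ^ n * b / (\<theta> l - \<theta> m) \<in> R" if lm: "l < n" "m < n" "l \<noteq> m" for l m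
  proof -
    define Z where "Z = {..<n} - {l} - {m}"
    have nz: "\<theta> l - \<theta> m \<noteq> 0" using lm inj by (auto simp: inj_on_def)
    have card: "card Z \<le> n" using lm by (simp add: Z_def)
    have "poly (pderiv F) (\<theta> l) = (\<theta> l - \<theta> m) * (\<Prod>k\<in>Z. \<theta> l - \<theta> k)"
      unfolding pderiv_root[OF lm(1)] Z_def using lm by (subst prod.remove[of _ m]) auto
    moreover have "(\<Prod>k\<in>Z. \<theta> l - \<theta> k) \<noteq> 0" using pderiv_root_nz[OF lm(1)] calculation by auto
    ultimately have "a ^ n * b / (\<theta> l - \<theta> m) = b / poly (pderiv F) (\<theta> l) * (a ^ n * (\<Prod>k\<in>Z. \<theta> l - \<theta> k))"
      using nz by simp
    also have "a ^ n * (\<Prod>k\<in>Z. \<theta> l - \<theta> k) = a ^ (n - card Z) * (\<Prod>k\<in>Z. a * (\<theta> l - \<theta> k))"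
      using card by (simp add: prod.distrib flip: power_add mult.assoc)
    also have "b / poly (pderiv F) (\<theta> l) * \<dots> \<in> R"
    proof (rule ext.mult_mem[OF disc[OF lm(1)] ext.mult_mem[OF ext.power_mem[OF a(2)] ext.prod_mem]])
      fix k assume "k \<in> Z"
      then have "a * \<theta> l - a * \<theta> k \<in> R" using lm root by (intro ext.diff_mem) (auto simp: Z_def)
      then show "a * (\<theta> l - \<theta> k) \<in> R" by (simp add: right_diff_distrib)
    qed
    finally show ?thesis .
  qed
  ultimately show ?thesis using a b u D by (auto simp: clears_def)
qed

text \<open>Since \<pi> has positive value, a high power of it clears any finite set of elements
  that have a value. The constant C fixes how high it must be to make up for what D loses.\<close>

lemma exists_clears:
  assumes \<pi>: "\<pi> \<in> L" "\<pi> \<noteq> 0" "w \<pi> > 0" and D: "derivation L D"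
    and C: "\<And>x. x \<in> L \<Longrightarrow> x \<noteq> 0 \<Longrightarrow> w x \<ge> 0 \<Longrightarrow> D x \<noteq> 0 \<Longrightarrow> w (D x) \<ge> - C"
  shows "\<exists>s u. clears D s u"
proof -
  interpret D: derivation L D by fact
  have piR: "\<pi> \<in> R" using \<pi> R_base_iff by auto
  have pow: "\<exists>N. \<forall>k\<ge>N. \<pi> ^ k * z \<in> R" if z: "z \<in> G \<or> z = 0" for z
  proof (cases "z = 0")
    case False
    obtain N :: nat where N: "- W z \<le> real N * w \<pi>"
      using reals_Archimedean3[OF \<pi>(3)] by (meson less_imp_le)
    have "\<pi> ^ k * z \<in> R" if k: "k \<ge> N" for k
    proof -
      have "real N * w \<pi> \<le> real k * w \<pi>" using k \<pi> by (intro mult_right_mono) auto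
      moreover have "W (\<pi> ^ k) = k * w \<pi>" "\<pi> ^ k \<in> G"
        using W_power[of \<pi> k] base_G[of \<pi>] W_base[of \<pi>] \<pi> by auto
      ultimately have "W (\<pi> ^ k * z) \<ge> 0" using z False N by (simp add: W_mult)
      then show ?thesis using R_iff[of "\<pi> ^ k * z"] z False \<open>\<pi> ^ k \<in> G\<close> by (simp add: mult_G)
    qed
    then show ?thesis by blast
  qed simp
  have pows: "\<exists>N. \<forall>k\<ge>N. \<forall>z\<in>Z. \<pi> ^ k * z \<in> R" if "finite Z" "Z \<subseteq> insert 0 G" for Z
    using that
  proof (induction Z)
    case (insert z Z)
    then obtain N1 where N1: "\<forall>k\<ge>N1. \<forall>z\<in>Z. \<pi> ^ k * z \<in> R" by auto
    obtain N2 where "\<forall>k\<ge>N2. \<pi> ^ k * z \<in> R" using pow[of z] insert.prems by auto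
    then show ?case using N1 by (intro exI[of _ "max N1 N2"]) auto
  qed simp
  have rootG: "\<theta> l \<in> insert 0 G" if "l < n" for l
    using algebraic_G[OF algebraic_root[OF that]] by auto
  have derE: "poly (pderiv F) (\<theta> 0) \<in> E" using F_poly by auto
  have sder: "\<sigma> l (poly (pderiv F) (\<theta> 0)) = poly (pderiv F) (\<theta> l)" if "l < n" for l
    using that F_poly by (intro sigma_poly) auto
  have derG: "inverse (poly (pderiv F) (\<theta> l)) \<in> G" if "l < n" for l
    using sigma_G[OF derE _ that] pderiv_root_nz[of 0] n_pos sder[OF that] by (simp add: inverse_G)
  have kG: "coeff (kappa D) i \<in> insert 0 G" for i
    using base_G[of "coeff (kappa D) i"] kappa(1)[OF D] by auto
  obtain N1 where N1: "\<forall>k\<ge>N1. \<forall>z\<in>\<theta> ` {..<n}. \<pi> ^ k * z \<in> R"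
    using pows[of "\<theta> ` {..<n}"] rootG by auto
  obtain N2 where N2: "\<forall>k\<ge>N2. \<forall>z\<in>(\<lambda>l. inverse (poly (pderiv F) (\<theta> l))) ` {..<n}. \<pi> ^ k * z \<in> R"
    using pows[of "(\<lambda>l. inverse (poly (pderiv F) (\<theta> l))) ` {..<n}"] derG by auto
  obtain N3 where N3: "\<forall>k\<ge>N3. \<forall>z\<in>coeff (kappa D) ` {..degree (kappa D)}. \<pi> ^ k * z \<in> R"
    using pows[of "coeff (kappa D) ` {..degree (kappa D)}"] kG by auto
  obtain N4 :: nat where N4: "C \<le> real N4 * w \<pi>" using reals_Archimedean3[OF \<pi>(3)] by (meson less_imp_le)
  define k where "k = max N3 N4"
  have "clears D ((\<pi> ^ N1) ^ n * \<pi> ^ N2) (\<pi> ^ k)"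
  proof (rule clearsI)
    show "\<pi> ^ N1 * \<theta> l \<in> R" if "l < n" for l using N1 that by auto
    show "\<pi> ^ N2 / poly (pderiv F) (\<theta> l) \<in> R" if "l < n" for l using N2 that by (auto simp: divide_inverse)
    show "\<pi> ^ k * coeff (kappa D) i \<in> R" for i
      using N3 by (cases "i \<le> degree (kappa D)") (auto simp: k_def coeff_eq_0)
    fix c assume c: "c \<in> L" "c \<in> R"
    show "\<pi> ^ k * D c \<in> R"
    proof (cases "D c = 0")
      case False
      then have "c \<noteq> 0" by auto
      then have "w (D c) \<ge> - C" using C c False R_base_iff by blast
      moreover have "real N4 * w \<pi> \<le> real k * w \<pi>" using \<pi> by (intro mult_right_mono) (auto simp: k_def)
      moreover have "w (\<pi> ^ k * D c) = real k * w \<pi> + w (D c)"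
        using c False \<pi> D.D_mem by (simp add: base.w_mult base.w_power power_mem)
      ultimately have "w (\<pi> ^ k * D c) \<ge> 0" using N4 by linarith
      then show ?thesis using R_base_iff[of "\<pi> ^ k * D c"] c False \<pi> D.D_mem by auto
    qed simp
  qed (use \<pi> piR in auto)
  then show ?thesis by blast
qed

end

section \<open>Fields with a product formula\<close>

text \<open>Let b be the least positive integer that makes b times the value an integer. If b > 1, a
  product f of powers of x and \<pi> has value 1/b, and u = f^b / \<pi> has value 0. In the
  derivative of f^b = \<pi> u the right side is nonzero of value 0, because D \<pi> is a unit; the
  left side b f^(b-1) D f vanishes or has value at least (b-1)/b.\<close>

lemma (in extended_valuation_roots) integral_values:
  assumes ints: "\<And>x. x \<in> L \<Longrightarrow> x \<noteq> 0 \<Longrightarrow> w x \<in> \<int>"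
    and \<pi>: "\<pi> \<in> L" "\<pi> \<noteq> 0" "w \<pi> = 1"
    and D: "derivation L D" "D \<pi> \<noteq> 0" "w (D \<pi>) = 0"
    and int: "\<And>f. f \<in> E \<Longrightarrow> \<sigma> l f \<in> R \<Longrightarrow> \<sigma> l (lift_deriv D f) \<in> R"
    and x: "x \<in> E" "x \<noteq> 0" and l: "l < n"
  shows "W (\<sigma> l x) \<in> \<int>"
proof -
  interpret vE: valued_field E "\<lambda>x. W (\<sigma> l x)" by (rule valued_sigma[OF l])
  interpret DE: derivation E "lift_deriv D" by (rule derivation_lift[OF D(1)])
  define r where "r = W (\<sigma> l x)"
  obtain s g where s: "s > 0" "g \<in> L" "g \<noteq> 0" "real s * r = w g"
    using W_root[OF sigma_G[OF x l]] by (auto simp: r_def)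
  define P where "P b \<longleftrightarrow> 0 < b \<and> real b * r \<in> \<int>" for b :: nat
  have "P s" using s ints by (auto simp: P_def)
  define b where "b = (LEAST b. P b)"
  have b: "P b" unfolding b_def using \<open>P s\<close> by (rule LeastI)
  have min: "b \<le> c" if "P c" for c unfolding b_def using that by (rule Least_le)
  obtain a :: int where a: "real b * r = of_int a" using b by (auto simp: P_def elim: Ints_cases)
  have b0: "b > 0" using b by (simp add: P_def)
  have "b = 1"
  proof (rule ccontr)
    assume "b \<noteq> 1"
    then have b2: "b > 1" using b0 by simp
    \<comment> \<open>A common factor could be cancelled, against the minimality of b. Coprimality
      supplies the exponents i and j of f.\<close>
    have cop: "gcd a (int b) = 1"
    proof -
      define e where "e = gcd a (int b)"
      have e0: "e > 0" using b0 by (simp add: e_def)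
      obtain a' b' where ab: "a = e * a'" "int b = e * b'" unfolding e_def by (meson dvdE gcd_dvd1 gcd_dvd2)
      have b'0: "b' > 0" using ab b0 e0 by (metis of_nat_0_less_iff zero_less_mult_pos)
      have "real_of_int e * (of_int b' * r) = real_of_int e * of_int a'"
        using a ab by (metis of_int_mult of_int_of_nat_eq mult.assoc)
      then have "of_int b' * r = of_int a'" using e0 by simp
      then have "P (nat b')" using b'0 by (simp add: P_def)
      then have "int b \<le> b'" using min[of "nat b'"] b'0 by linarith
      then have "e * b' \<le> 1 * b'" using ab by simp
      then have "e \<le> 1" using b'0 by (rule mult_right_le_imp_le)
      then show ?thesis using e0 unfolding e_def by linarith
    qed
    obtain i j where ij: "i * a + j * int b = 1" using bezout_int[of a "int b"] cop by auto
    have piE: "\<pi> \<in> E" using base_subset_adjoin \<pi> by auto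
    have Wpi: "W (\<sigma> l \<pi>) = 1" using W_sigma_base[OF _ _ l] \<pi> by simp
    define f where "f = x powi i * \<pi> powi j"
    have f: "f \<in> E" "f \<noteq> 0" using x \<pi> piE by (auto simp: f_def power_int_eq_0_iff)
    have Wf: "W (\<sigma> l f) = 1 / real b"
    proof -
      have "W (\<sigma> l f) = of_int i * r + of_int j"
        using x \<pi> piE Wpi by (simp add: f_def vE.w_mult vE.w_power_int E.power_int_mem r_def power_int_eq_0_iff)
      also have "r = of_int a / real b" using a b0 by (simp add: field_simps)
      also have "of_int i * (of_int a / real b) + of_int j = of_int (i * a + j * int b) / real b"
        using b0 by (simp add: add_divide_distrib)
      finally show ?thesis using ij by simp
    qed
    define u where "u = f ^ b / \<pi>"
    have u: "u \<in> E" "u \<noteq> 0" using f \<pi> piE by (auto simp: u_def)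
    have Wu: "W (\<sigma> l u) = 0" using f \<pi> piE Wpi Wf b0 by (simp add: u_def vE.w_divide vE.w_power E.power_mem)
    have fb: "f ^ b = \<pi> * u" using \<pi> by (simp add: u_def)
    have Dpi: "lift_deriv D \<pi> = D \<pi>" by (rule lift_deriv_base[OF D(1) \<pi>(1)])
    have DpiL: "D \<pi> \<in> L" using derivation.D_mem[OF D(1) \<pi>(1)] .
    have DpiE: "D \<pi> \<in> E" using DpiL base_subset_adjoin by auto
    have eq: "of_nat b * f ^ (b - 1) * lift_deriv D f = D \<pi> * u + \<pi> * lift_deriv D u"
      using DE.D_power[OF f(1), of b] DE.D_mult[OF piE u(1)] by (simp add: fb Dpi)
    have W1: "W (\<sigma> l (D \<pi> * u)) = 0"
      using vE.w_mult[OF DpiE D(2) u] Wu W_sigma_base[OF DpiL D(2) l] D(3) by simp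
    have nz1: "D \<pi> * u \<noteq> 0" "D \<pi> * u \<in> E" using D u DpiE by auto
    have W2: "D \<pi> * u + \<pi> * lift_deriv D u \<noteq> 0 \<and> W (\<sigma> l (D \<pi> * u + \<pi> * lift_deriv D u)) = 0"
    proof (cases "lift_deriv D u = 0")
      case False
      have "\<sigma> l u \<in> R" using R_sigma_iff[OF u l] Wu by simp
      then have "\<sigma> l (lift_deriv D u) \<in> R" using int u by blast
      then have "W (\<sigma> l (lift_deriv D u)) \<ge> 0" using R_sigma_iff[OF DE.D_mem[OF u(1)] False l] by simp
      then have "W (\<sigma> l (\<pi> * lift_deriv D u)) > W (\<sigma> l (D \<pi> * u))"
        using vE.w_mult[OF piE \<pi>(2) DE.D_mem[OF u(1)] False] W1 Wpi by simp
      then show ?thesis using vE.w_add_eq[OF nz1(2,1), of "\<pi> * lift_deriv D u"] W1 False \<pi> piE u DE.D_mem by auto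
    qed (use W1 nz1 in auto)
    then have "of_nat b * f ^ (b - 1) * lift_deriv D f \<noteq> 0" using eq by simp
    then have nz: "(of_nat b :: 'b) \<noteq> 0" "lift_deriv D f \<noteq> 0" by auto
    have "\<sigma> l (of_nat b) = of_nat b" by (rule sigma_base) (use l in auto)
    then have Wb: "W (\<sigma> l (of_nat b)) \<ge> 0" using R_sigma_iff[of "of_nat b" l] nz l by auto
    have "\<sigma> l f \<in> R" using R_sigma_iff[OF f l] Wf by simp
    then have "\<sigma> l (lift_deriv D f) \<in> R" using int f by blast
    then have WDf: "W (\<sigma> l (lift_deriv D f)) \<ge> 0" using R_sigma_iff[OF DE.D_mem[OF f(1)] nz(2) l] by simp
    have "W (\<sigma> l (of_nat b * f ^ (b - 1) * lift_deriv D f)) =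
      W (\<sigma> l (of_nat b)) + real (b - 1) * (1 / real b) + W (\<sigma> l (lift_deriv D f))"
      using f nz DE.D_mem[OF f(1)] by (simp add: vE.w_mult vE.w_power E.power_mem E.mult_mem Wf)
    moreover have "real (b - 1) * (1 / real b) > 0" using b2 by simp
    ultimately show False using Wb WDf W2 unfolding eq by linarith
  qed
  then show ?thesis using a by (simp add: r_def)
qed

text \<open>Sets of places may be infinite, so the sum runs over the support. An infinite support
  would give 0 by default, which is why the additive and monotone laws carry finiteness
  hypotheses.\<close>

definition fsum :: "('i \<Rightarrow> real) \<Rightarrow> 'i set \<Rightarrow> real" where
  "fsum f V = sum f {i \<in> V. f i \<noteq> 0}"

lemma fsum_eq:
  assumes "finite T" "T \<subseteq> V" "\<And>i. i \<in> V - T \<Longrightarrow> f i = 0"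
  shows "fsum f V = sum f T"
  unfolding fsum_def using assms by (intro sum.mono_neutral_left) auto

lemma fsum_cong: "(\<And>i. i \<in> V \<Longrightarrow> f i = g i) \<Longrightarrow> fsum f V = fsum g V"
  unfolding fsum_def by (intro sum.cong) auto

lemma fsum_add:
  assumes "finite {i \<in> V. f i \<noteq> 0}" "finite {i \<in> V. g i \<noteq> 0}"
  shows "fsum (\<lambda>i. f i + g i) V = fsum f V + fsum g V"
proof -
  define T where "T = {i \<in> V. f i \<noteq> 0} \<union> {i \<in> V. g i \<noteq> 0}"
  have "finite T" "T \<subseteq> V" using assms by (auto simp: T_def)
  then have "fsum (\<lambda>i. f i + g i) V = (\<Sum>i\<in>T. f i + g i)" "fsum f V = sum f T" "fsum g V = sum g T"
    by (auto intro!: fsum_eq simp: T_def)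
  then show ?thesis by (simp add: sum.distrib)
qed

lemma fsum_cmult: "fsum (\<lambda>i. c * f i) V = c * fsum f V"
  by (cases "c = 0") (simp_all add: fsum_def sum_distrib_left)

lemma fsum_minus: "fsum (\<lambda>i. - f i) V = - fsum f V"
  using fsum_cmult[of "- 1"] by simp

lemma fsum_mono:
  assumes "finite {i \<in> V. f i \<noteq> 0}" "finite {i \<in> V. g i \<noteq> 0}" "\<And>i. i \<in> V \<Longrightarrow> f i \<le> g i"
  shows "fsum f V \<le> fsum g V"
proof -
  define T where "T = {i \<in> V. f i \<noteq> 0} \<union> {i \<in> V. g i \<noteq> 0}"
  have "finite T" "T \<subseteq> V" using assms by (auto simp: T_def)
  then have "fsum f V = sum f T" "fsum g V = sum g T" by (auto intro!: fsum_eq simp: T_def)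
  then show ?thesis using assms(3) by (auto intro!: sum_mono simp: T_def)
qed

lemma fsum_nonneg: "(\<And>i. i \<in> V \<Longrightarrow> f i \<ge> 0) \<Longrightarrow> fsum f V \<ge> 0"
  unfolding fsum_def by (intro sum_nonneg) auto

lemma fsum_Times:
  assumes "finite {i \<in> V. \<exists>l<n. f (i, l) \<noteq> 0}"
  shows "fsum f (V \<times> {..<n::nat}) = fsum (\<lambda>i. \<Sum>l<n. f (i, l)) V"
proof -
  define T where "T = {i \<in> V. \<exists>l<n. f (i, l) \<noteq> 0}"
  have "fsum f (V \<times> {..<n}) = sum f (T \<times> {..<n})"
    using assms by (intro fsum_eq) (auto simp: T_def)
  also have "\<dots> = (\<Sum>i\<in>T. \<Sum>l<n. f (i, l))" using assms by (simp add: sum.cartesian_product)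
  also have "\<dots> = fsum (\<lambda>i. \<Sum>l<n. f (i, l)) V"
    using assms by (intro fsum_eq[symmetric]) (auto simp: T_def intro!: sum.neutral)
  finally show ?thesis .
qed

lemma fsum_image:
  assumes "inj_on h V"
  shows "fsum f (h ` V) = fsum (\<lambda>i. f (h i)) V"
proof -
  have "{j \<in> h ` V. f j \<noteq> 0} = h ` {i \<in> V. f (h i) \<noteq> 0}" by auto
  moreover have "inj_on h {i \<in> V. f (h i) \<noteq> 0}" using assms by (rule inj_on_subset) auto
  ultimately show ?thesis by (simp add: fsum_def sum.reindex)
qed

lemma fsum_Plus:
  assumes "finite {i \<in> V. f (Inl i) \<noteq> 0}" "finite {j \<in> V'. f (Inr j) \<noteq> 0}"
  shows "fsum f (V <+> V') = fsum (\<lambda>i. f (Inl i)) V + fsum (\<lambda>j. f (Inr j)) V'"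
proof -
  have "{k \<in> V <+> V'. f k \<noteq> 0} = {i \<in> V. f (Inl i) \<noteq> 0} <+> {j \<in> V'. f (Inr j) \<noteq> 0}" by auto
  then show ?thesis using assms by (simp add: fsum_def sum.Plus)
qed

text \<open>V is the set of places with weights d, and S holds finitely many exceptional ones.
  Outside S values are integers, derivations preserve integrality, and one of them maps a
  uniformizer to a unit; at places of S derivations merely lose a bounded amount. V may be empty,
  but then \<open>northcott\<close> forces L to be finite; this covers the prime field.\<close>

locale product_formula_field = subfield_set L for L :: "'b::field set" +
  fixes V :: "'i set" and d :: "'i \<Rightarrow> real" and v :: "'i \<Rightarrow> 'b \<Rightarrow> real"
    and S :: "'i set" and Ds :: "('b \<Rightarrow> 'b) set"
  assumes prime_char: "Factorial_Ring.prime CHAR('b)"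
    and weight_pos: "i \<in> V \<Longrightarrow> d i > 0"
    and valued: "i \<in> V \<Longrightarrow> valued_field L (v i)"
    and finite_support: "x \<in> L \<Longrightarrow> x \<noteq> 0 \<Longrightarrow> finite {i \<in> V. v i x \<noteq> 0}"
    and product_formula: "x \<in> L \<Longrightarrow> x \<noteq> 0 \<Longrightarrow> fsum (\<lambda>i. d i * v i x) V = 0"
    and northcott: "finite {x \<in> L. x \<noteq> 0 \<and> fsum (\<lambda>i. d i * max 0 (- v i x)) V \<le> B}"
    and finite_Ds: "finite Ds"
    and deriv: "D \<in> Ds \<Longrightarrow> derivation L D"
    and kernel: "x \<in> L \<Longrightarrow> (\<And>D. D \<in> Ds \<Longrightarrow> D x = 0) \<Longrightarrow> \<exists>y\<in>L. x = y ^ CHAR('b)"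
    and finite_S: "finite S" and S_V: "S \<subseteq> V"
    and good_int: "i \<in> V - S \<Longrightarrow> x \<in> L \<Longrightarrow> x \<noteq> 0 \<Longrightarrow> v i x \<in> \<int>"
    and good_uniformizer: "i \<in> V - S \<Longrightarrow> \<exists>u\<in>L. \<exists>D\<in>Ds. u \<noteq> 0 \<and> v i u = 1 \<and> D u \<noteq> 0 \<and> v i (D u) = 0"
    and good_deriv: "i \<in> V - S \<Longrightarrow> D \<in> Ds \<Longrightarrow> x \<in> L \<Longrightarrow> x \<noteq> 0 \<Longrightarrow> v i x \<ge> 0 \<Longrightarrow> D x \<noteq> 0 \<Longrightarrow> v i (D x) \<ge> 0"
    and nontrivial: "i \<in> V \<Longrightarrow> \<exists>u\<in>L. u \<noteq> 0 \<and> v i u > 0"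
    and bounded_deriv: "i \<in> V \<Longrightarrow>
      \<exists>C\<ge>0. \<forall>D\<in>Ds. \<forall>x\<in>L. x \<noteq> 0 \<longrightarrow> v i x \<ge> 0 \<longrightarrow> D x \<noteq> 0 \<longrightarrow> v i (D x) \<ge> - C"
begin

definition height :: "'b \<Rightarrow> real" where
  "height x = fsum (\<lambda>i. d i * max 0 (- v i x)) V"

lemma infinite_base: "i \<in> V \<Longrightarrow> infinite L"
proof
  assume i: "i \<in> V" and fin: "finite L"
  interpret vi: valued_field L "v i" using i by (rule valued)
  obtain u where u: "u \<in> L" "u \<noteq> 0" "v i u > 0" using nontrivial[OF i] by blast
  have "inj (\<lambda>k::nat. u ^ k)"
  proof (rule injI)
    fix j k :: nat assume "u ^ j = u ^ k"
    then have "real j * v i u = real k * v i u" using vi.w_power[OF u(1,2)] by metis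
    then show "j = k" using u by simp
  qed
  moreover have "range (\<lambda>k::nat. u ^ k) \<subseteq> L" using u by auto
  ultimately show False using fin finite_subset finite_imageD infinite_UNIV_nat by blast
qed

end

lemma finite_extension_finite:
  fixes L :: "'b::alg_closed_field set"
  assumes "simple_extension L F \<theta>" "finite L"
  shows "finite (adjoin L (\<theta> 0))"
proof -
  interpret simple_extension L F \<theta> by fact
  have "E \<subseteq> (\<lambda>c. \<Sum>j<n. c j * \<theta> 0 ^ j) ` (PiE {..<n} (\<lambda>_. L))"
  proof
    fix x assume "x \<in> E"
    then obtain g where g: "g \<in> polys L" "x = poly g (\<theta> 0)" by (rule adjoinE)
    define h where "h = g mod F"
    have h: "h \<in> polys L" unfolding h_def using polys_div_mod g F_poly by blast
    have "x = poly h (\<theta> 0)" unfolding g(2) h_def using root[of 0] n_pos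
      by (metis add.left_neutral div_mult_mod_eq mult_zero_right poly_add poly_mult)
    moreover have "degree h < n" unfolding h_def using n_pos
      by (metis degree_0 degree_mod_less' F_nz)
    then have "poly h (\<theta> 0) = (\<Sum>j<n. coeff h j * \<theta> 0 ^ j)"
      unfolding poly_altdef by (intro sum.mono_neutral_left) (auto simp: coeff_eq_0)
    ultimately have "x = (\<Sum>j<n. restrict (coeff h) {..<n} j * \<theta> 0 ^ j)" by simp
    moreover have "restrict (coeff h) {..<n} \<in> PiE {..<n} (\<lambda>_. L)" using h by auto
    ultimately show "x \<in> (\<lambda>c. \<Sum>j<n. c j * \<theta> 0 ^ j) ` (PiE {..<n} (\<lambda>_. L))" by blast
  qed
  then show ?thesis using assms(2) by (meson finite_PiE finite_imageI finite_lessThan finite_subset)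
qed

section \<open>The product formula in a separable simple extension\<close>

locale product_formula_extension = simple_extension L F \<theta> + product_formula_field L V d v S Ds
  for L :: "'b::alg_closed_field set" and F \<theta> and V :: "'i set" and d v S Ds +
  fixes R G :: "'i \<Rightarrow> 'b set" and W :: "'i \<Rightarrow> 'b \<Rightarrow> real"
  assumes ext: "i \<in> V \<Longrightarrow> extended_valuation L (v i) (R i) (G i) (W i)"
begin

lemma roots: "i \<in> V \<Longrightarrow> extended_valuation_roots L F \<theta> (v i) (R i) (G i) (W i)"
  using ext[of i] infinite_base[of i] simple_extension_axioms
  by (simp add: extended_valuation_roots_def extended_valuation_roots_axioms_def)

definition norm :: "'b \<Rightarrow> 'b" where
  "norm x = (\<Prod>l<n. \<sigma> l x)"

lemma norm_mem: "x \<in> E \<Longrightarrow> norm x \<in> L"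
  unfolding norm_def by (rule norm_in_base)

lemma norm_nz: "x \<in> E \<Longrightarrow> x \<noteq> 0 \<Longrightarrow> norm x \<noteq> 0"
  by (simp add: norm_def sigma_eq_0_iff)

lemma v_norm: "i \<in> V \<Longrightarrow> x \<in> E \<Longrightarrow> x \<noteq> 0 \<Longrightarrow> v i (norm x) = (\<Sum>l<n. W i (\<sigma> l x))"
  unfolding norm_def using extended_valuation_roots.W_norm(2)[OF roots] by blast

definition coeff_support :: "'b poly \<Rightarrow> 'i set" where
  "coeff_support A = {i \<in> V. \<exists>j. coeff A j \<noteq> 0 \<and> v i (coeff A j) \<noteq> 0}"

lemma finite_coeff_support:
  assumes "A \<in> polys L"
  shows "finite (coeff_support A)"
proof -
  have "coeff_support A \<subseteq> (\<Union>j\<in>{j. j \<le> degree A \<and> coeff A j \<noteq> 0}. {i \<in> V. v i (coeff A j) \<noteq> 0})"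
    by (auto simp: coeff_support_def intro: le_degree)
  moreover have "finite \<dots>" using finite_support coeff_polys[OF assms] by auto
  ultimately show ?thesis by (rule finite_subset)
qed

lemma polys_R:
  assumes "i \<in> V" "i \<notin> coeff_support A" "A \<in> polys L"
  shows "A \<in> polys (R i)"
proof (rule polysI)
  interpret ev: extended_valuation_roots L F \<theta> "v i" "R i" "G i" "W i" using roots assms by blast
  fix j
  show "coeff A j \<in> R i"
    using assms(1,2) ev.R_base_iff[OF coeff_polys[OF assms(3), of j]]
    by (cases "coeff A j = 0") (auto simp: coeff_support_def)
qed

text \<open>Where the characteristic polynomial is integral, all conjugates are integral. Where in
  addition the norm has value 0, their nonnegative values sum to 0. Both conditions fail at finitely
  many places only.\<close>

lemma finite_support_ext:
  assumes x: "x \<in> E" "x \<noteq> 0"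
  shows "finite {i \<in> V. \<exists>l<n. W i (\<sigma> l x) \<noteq> 0}"
proof (cases "V = {}")
  case False
  then have inf: "infinite L" using infinite_base by blast
  have cp: "charpoly x \<in> polys L" using charpoly_polys inf x by blast
  have "{i \<in> V. \<exists>l<n. W i (\<sigma> l x) \<noteq> 0} \<subseteq> coeff_support (charpoly x) \<union> {i \<in> V. v i (norm x) \<noteq> 0}"
  proof (rule subsetI, rule ccontr)
    fix i assume i: "i \<in> {i \<in> V. \<exists>l<n. W i (\<sigma> l x) \<noteq> 0}"
      and n: "i \<notin> coeff_support (charpoly x) \<union> {i \<in> V. v i (norm x) \<noteq> 0}"
    interpret ev: extended_valuation_roots L F \<theta> "v i" "R i" "G i" "W i" using roots i by blast
    have "charpoly x \<in> polys (R i)" using polys_R cp i n by blast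
    then have "\<sigma> l x \<in> R i" if "l < n" for l
      using ev.ext.integrally_closed[of "charpoly x" "\<sigma> l x"] charpoly_props that by blast
    then have ge: "W i (\<sigma> l x) \<ge> 0" if "l < n" for l using ev.R_sigma_iff x that by blast
    have "(\<Sum>l<n. W i (\<sigma> l x)) = 0" using v_norm[of i x] n i x by auto
    then have "\<forall>l<n. W i (\<sigma> l x) = 0" using ge sum_nonneg_eq_0_iff[of "{..<n}" "\<lambda>l. W i (\<sigma> l x)"] by auto
    then show False using i by auto
  qed
  then show ?thesis
    using finite_coeff_support[OF cp] finite_support[OF norm_mem norm_nz] x finite_subset by blast
qed simp

text \<open>Summing over the conjugates first leaves the product formula for the norm.\<close>

lemma product_formula_ext:
  assumes x: "x \<in> E" "x \<noteq> 0"
  shows "fsum (\<lambda>(i, l). d i * W i (\<sigma> l x)) (V \<times> {..<n}) = 0"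
proof -
  have "finite {i \<in> V. \<exists>l<n. d i * W i (\<sigma> l x) \<noteq> 0}"
    by (rule finite_subset[OF _ finite_support_ext[OF x]]) auto
  then have "fsum (\<lambda>(i, l). d i * W i (\<sigma> l x)) (V \<times> {..<n}) = fsum (\<lambda>i. \<Sum>l<n. d i * W i (\<sigma> l x)) V"
    by (subst fsum_Times) auto
  also have "\<dots> = fsum (\<lambda>i. d i * v i (norm x)) V"
    using x by (intro fsum_cong) (simp add: v_norm sum_distrib_left)
  also have "\<dots> = 0" using product_formula norm_mem norm_nz x by blast
  finally show ?thesis .
qed

definition height_ext :: "'b \<Rightarrow> real" where
  "height_ext x = fsum (\<lambda>(i, l). d i * max 0 (- W i (\<sigma> l x))) (V \<times> {..<n})"

text \<open>At each place and conjugate the pole of y - x is at most the pole of y plus that of x.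
  The case y = 0 is separate because \<open>v i 0\<close> carries no information.\<close>

lemma height_norm_diff:
  assumes x: "x \<in> E" "x \<noteq> 0" and y: "y \<in> L" "y \<noteq> x"
  shows "height (norm (y - x)) \<le> real n * (if y = 0 then 0 else height y) + height_ext x"
proof -
  define hy where "hy i = (if y = 0 then 0 else d i * max 0 (- v i y))" for i
  define hx where "hx i = (\<Sum>l<n. d i * max 0 (- W i (\<sigma> l x)))" for i
  have yE: "y \<in> E" using y base_subset_adjoin by auto
  have yx: "y - x \<in> E" "y - x \<noteq> 0" using yE x y by auto
  have fy: "finite {i \<in> V. real n * hy i \<noteq> 0}"
  proof (cases "y = 0")
    case False
    show ?thesis by (rule finite_subset[OF _ finite_support[OF y(1) False]]) (auto simp: hy_def max_def split: if_splits)
  qed (simp add: hy_def)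
  have fx: "finite {i \<in> V. \<exists>l<n. d i * max 0 (- W i (\<sigma> l x)) \<noteq> 0}"
    by (rule finite_subset[OF _ finite_support_ext[OF x]]) (auto simp: max_def split: if_splits)
  have fhx: "finite {i \<in> V. hx i \<noteq> 0}"
  proof (rule finite_subset[OF _ fx], rule subsetI, rule ccontr)
    fix i assume i: "i \<in> {i \<in> V. hx i \<noteq> 0}"
      and "i \<notin> {i \<in> V. \<exists>l<n. d i * max 0 (- W i (\<sigma> l x)) \<noteq> 0}"
    then have "hx i = 0" unfolding hx_def by (intro sum.neutral) blast
    then show False using i by simp
  qed
  have fn: "finite {i \<in> V. d i * max 0 (- v i (norm (y - x))) \<noteq> 0}"
    by (rule finite_subset[OF _ finite_support[OF norm_mem[OF yx(1)] norm_nz[OF yx]]]) auto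
  have le: "d i * max 0 (- v i (norm (y - x))) \<le> real n * hy i + hx i" if i: "i \<in> V" for i
  proof -
    interpret ev: extended_valuation_roots L F \<theta> "v i" "R i" "G i" "W i" using roots i by blast
    have di: "d i > 0" using weight_pos i by blast
    define hy' where "hy' = (if y = 0 then 0 else max 0 (- v i y))"
    have each: "- W i (\<sigma> l (y - x)) \<le> hy' + max 0 (- W i (\<sigma> l x))" if l: "l < n" for l
    proof -
      interpret vE: valued_field E "\<lambda>x. W i (\<sigma> l x)" by (rule ev.valued_sigma[OF l])
      show ?thesis
      proof (cases "y = 0")
        case True
        then show ?thesis using vE.w_minus[OF x] by (simp add: hy'_def)
      next
        case False
        have "W i (\<sigma> l (y - x)) \<ge> min (W i (\<sigma> l y)) (W i (\<sigma> l x))"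
          using vE.w_diff[OF yE False x yx(2)] by simp
        moreover have "W i (\<sigma> l y) = v i y" using ev.W_sigma_base y False l by blast
        ultimately show ?thesis using False by (auto simp: hy'_def)
      qed
    qed
    have "- v i (norm (y - x)) = (\<Sum>l<n. - W i (\<sigma> l (y - x)))" using v_norm[OF i yx] by (simp add: sum_negf)
    also have "\<dots> \<le> (\<Sum>l<n. hy' + max 0 (- W i (\<sigma> l x)))" using each by (intro sum_mono) auto
    also have "\<dots> = real n * hy' + (\<Sum>l<n. max 0 (- W i (\<sigma> l x)))" by (simp add: sum.distrib)
    finally have "max 0 (- v i (norm (y - x))) \<le> real n * hy' + (\<Sum>l<n. max 0 (- W i (\<sigma> l x)))"
      by (simp add: hy'_def sum_nonneg)
    then have "d i * max 0 (- v i (norm (y - x))) \<le> d i * (real n * hy' + (\<Sum>l<n. max 0 (- W i (\<sigma> l x))))"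
      using di by (intro mult_left_mono) auto
    also have "\<dots> = real n * hy i + hx i"
      by (simp add: hy_def hy'_def hx_def sum_distrib_left algebra_simps)
    finally show ?thesis .
  qed
  have "height (norm (y - x)) \<le> fsum (\<lambda>i. real n * hy i + hx i) V"
    unfolding height_def
  proof (rule fsum_mono[OF fn _ le])
    show "finite {i \<in> V. real n * hy i + hx i \<noteq> 0}"
      by (rule finite_subset[OF _ finite_UnI[OF fy fhx]]) auto
  qed
  also have "\<dots> = real n * fsum hy V + fsum hx V" by (simp add: fsum_add[OF fy fhx] fsum_cmult)
  also have "fsum hy V = (if y = 0 then 0 else height y)" by (simp add: hy_def height_def fsum_def)
  also have "fsum hx V = height_ext x"
    unfolding height_ext_def hx_def using fx by (subst fsum_Times) auto
  finally show ?thesis .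
qed

text \<open>The characteristic polynomial of \<open>x\<close> is determined by its values at more than \<open>n\<close> elements
  of the base, and these values are norms of bounded height.\<close>

lemma northcott_ext: "finite {x \<in> E. x \<noteq> 0 \<and> height_ext x \<le> B}"
proof (cases "finite L")
  case True
  then show ?thesis using finite_extension_finite[OF simple_extension_axioms] by auto
next
  case False
  obtain A where A: "finite A" "card A = Suc n" "A \<subseteq> L"
    using infinite_arbitrarily_large[OF False] by blast
  define Z where "Z = {x \<in> E. x \<noteq> 0 \<and> height_ext x \<le> B}"
  \<comment> \<open>0 is added for the case y = x, where the characteristic polynomial
    vanishes.\<close>
  define Y where "Y y = insert 0 {x \<in> L. x \<noteq> 0 \<and> height x \<le> real n * (if y = 0 then 0 else height y) + B}" for y
  have Y: "finite (Y y)" for y using northcott by (auto simp: Y_def height_def)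
  have val: "poly (charpoly x) y \<in> Y y" if "x \<in> Z" "y \<in> A" for x y
  proof (cases "y = x")
    case True
    have "x \<in> E" using that by (auto simp: Z_def)
    then have "poly (charpoly x) x = 0" using charpoly_props(4)[of 0 x] n_pos sigma_0 by simp
    then show ?thesis using True by (simp add: Y_def)
  next
    case ne: False
    have x: "x \<in> E" "x \<noteq> 0" "height_ext x \<le> B" using that by (auto simp: Z_def)
    have y: "y \<in> L" using that A by auto
    have "poly (charpoly x) y = norm (y - x)" using charpoly_value x y by (simp add: norm_def)
    moreover have "y - x \<in> E" using x y base_subset_adjoin by auto
    moreover have "y - x \<noteq> 0" using ne by simp
    ultimately show ?thesis
      using height_norm_diff[OF x(1,2) y ne] x(3) norm_mem norm_nz by (auto simp: Y_def)
  qed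
  define \<Phi> where "\<Phi> P = restrict (poly P) A" for P :: "'b poly"
  have "\<Phi> ` charpoly ` Z \<subseteq> PiE A Y" using val by (auto simp: \<Phi>_def)
  then have fin: "finite (\<Phi> ` charpoly ` Z)" using finite_PiE[OF A(1)] Y finite_subset by blast
  have "inj_on \<Phi> (charpoly ` Z)"
  proof (rule inj_onI)
    fix P Q assume "P \<in> charpoly ` Z" "Q \<in> charpoly ` Z" and eq: "\<Phi> P = \<Phi> Q"
    then have deg: "degree P = n" "degree Q = n" by (auto simp: charpoly_props)
    show "P = Q"
    proof (rule ccontr)
      assume "P \<noteq> Q"
      then have nz: "P - Q \<noteq> 0" by simp
      have "poly P y = poly Q y" if "y \<in> A" for y using eq that by (simp add: \<Phi>_def restrict_def fun_eq_iff) metis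
      then have "A \<subseteq> {y. poly (P - Q) y = 0}" by auto
      then have "card A \<le> card {y. poly (P - Q) y = 0}" by (intro card_mono poly_roots_finite nz)
      also have "\<dots> \<le> degree (P - Q)" using nz by (rule card_poly_roots_bound)
      also have "\<dots> \<le> n" using degree_diff_le_max[of P Q] deg by simp
      finally show False using A by simp
    qed
  qed
  then have "finite (charpoly ` Z)" using fin finite_imageD by blast
  \<comment> \<open>Each x is a root of its own characteristic polynomial, so finitely many
    polynomials leave finitely many x.\<close>
  then have "finite (\<Union>P\<in>charpoly ` Z. {x. poly P x = 0})"
    by (intro finite_UN_I) (auto intro!: poly_roots_finite simp: charpoly_props)
  moreover have "Z \<subseteq> (\<Union>P\<in>charpoly ` Z. {x. poly P x = 0})"
  proof
    fix x assume x: "x \<in> Z"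
    then have "x \<in> E" by (auto simp: Z_def)
    then have "poly (charpoly x) x = 0" using charpoly_props(4)[of 0 x] n_pos sigma_0 by simp
    then show "x \<in> (\<Union>P\<in>charpoly ` Z. {x. poly P x = 0})" using x by auto
  qed
  ultimately show ?thesis unfolding Z_def[symmetric] by (rule finite_subset[rotated])
qed

text \<open>Outside these places F and \<open>kappa D\<close> are integral and F'(\<theta> 0) is a
  unit at every conjugate, so that 1 clears all denominators and the lifted derivations preserve
  integrality.\<close>

definition bad :: "'i set" where
  "bad = S \<union> coeff_support F \<union> {i \<in> V. v i (norm (poly (pderiv F) (\<theta> 0))) \<noteq> 0} \<union>
     (\<Union>D\<in>Ds. coeff_support (kappa D))"

lemma pderiv_generator: "poly (pderiv F) (\<theta> 0) \<in> E" "poly (pderiv F) (\<theta> 0) \<noteq> 0"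
  "l < n \<Longrightarrow> \<sigma> l (poly (pderiv F) (\<theta> 0)) = poly (pderiv F) (\<theta> l)"
  using F_poly pderiv_root_nz[of 0] n_pos sigma_poly[of "pderiv F" l] by auto

lemma finite_bad: "finite bad" "bad \<subseteq> V"
proof -
  have "finite (coeff_support F)" by (rule finite_coeff_support[OF F_poly])
  moreover have "finite (coeff_support (kappa D))" if "D \<in> Ds" for D
    using that by (intro finite_coeff_support kappa deriv)
  moreover have "finite {i \<in> V. v i (norm (poly (pderiv F) (\<theta> 0))) \<noteq> 0}"
    using pderiv_generator by (intro finite_support norm_mem norm_nz) auto
  ultimately show "finite bad" unfolding bad_def using finite_S finite_Ds by blast
  show "bad \<subseteq> V" using S_V by (auto simp: bad_def coeff_support_def)
qed

lemma good_lift: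
  assumes i: "i \<in> V - bad" and D: "D \<in> Ds" and f: "f \<in> E" "l < n" "\<sigma> l f \<in> R i"
  shows "\<sigma> l (lift_deriv D f) \<in> R i"
proof -
  interpret ev: extended_valuation_roots L F \<theta> "v i" "R i" "G i" "W i" using roots i by blast
  have FR: "F \<in> polys (R i)" using i F_poly by (intro polys_R) (auto simp: bad_def)
  have thR: "\<theta> l \<in> R i" if "l < n" for l
    using ev.ext.integrally_closed[OF FR F_monic root[OF that]] .
  define z where "z = poly (pderiv F) (\<theta> 0)"
  have z: "z \<in> E" "z \<noteq> 0" using pderiv_generator by (auto simp: z_def)
  have sz: "\<sigma> l z = poly (pderiv F) (\<theta> l)" if "l < n" for l using pderiv_generator that by (simp add: z_def)
  have "\<sigma> l z \<in> R i" if "l < n" for l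
    using sz[OF that] thR[OF that] FR ev.ext.polys_pderiv ev.ext.poly_mem by metis
  then have ge: "W i (\<sigma> l z) \<ge> 0" if "l < n" for l using ev.R_sigma_iff z that by blast
  \<comment> \<open>Nonnegative values with sum 0: every conjugate of F'(\<theta> 0) is a
    unit.\<close>
  have "(\<Sum>l<n. W i (\<sigma> l z)) = 0" using v_norm[of i z] i z by (auto simp: bad_def z_def)
  then have W0: "\<forall>l<n. W i (\<sigma> l z) = 0" using ge sum_nonneg_eq_0_iff[of "{..<n}" "\<lambda>l. W i (\<sigma> l z)"] by auto
  have invR: "1 / poly (pderiv F) (\<theta> l) \<in> R i" if l: "l < n" for l
  proof -
    have "W i (inverse (\<sigma> l z)) = 0" using W0 l ev.W_inverse ev.sigma_G z by simp
    then have "inverse (\<sigma> l z) \<in> R i" using ev.R_iff ev.inverse_G ev.sigma_G z l by simp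
    then show ?thesis using sz[OF l] by (simp add: divide_inverse)
  qed
  have kR: "kappa D \<in> polys (R i)" using i D deriv kappa(1) by (intro polys_R) (auto simp: bad_def)
  have "ev.clears D (1 ^ n * 1) 1"
  proof (rule ev.clearsI)
    show "1 * D c \<in> R i" if c: "c \<in> L" "c \<in> R i" for c
    proof (cases "D c = 0")
      case False
      interpret D: derivation L D using deriv D .
      have "c \<noteq> 0" using False by auto
      then have "v i (D c) \<ge> 0" using good_deriv[of i D c] i D c False ev.R_base_iff[of c] by (auto simp: bad_def)
      then show ?thesis using ev.R_base_iff[of "D c"] False c D.D_mem by auto
    qed simp
    show "1 * coeff (kappa D) j \<in> R i" for j using kR by auto
  qed (use thR invR in auto)
  then show ?thesis using ev.lift_deriv_bound[OF deriv[OF D] _ f, of 1 1] by simp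
qed

text \<open>Embeddings that induce the same valuation stay separate indices with the weight of the
  place below, so multiplicity plays the part of the local degree.\<close>

theorem product_formula_field_ext:
  "product_formula_field E (V \<times> {..<n}) (\<lambda>(i, l). d i) (\<lambda>(i, l) x. W i (\<sigma> l x)) (bad \<times> {..<n}) (lift_deriv ` Ds)"
proof (intro product_formula_field.intro product_formula_field_axioms.intro)
  show "subfield_set E" by (rule E.subfield_set_axioms)
  show "Factorial_Ring.prime CHAR('b)" by (rule prime_char)
  show "finite (lift_deriv ` Ds)" using finite_Ds by simp
  show "finite (bad \<times> {..<n})" "bad \<times> {..<n} \<subseteq> V \<times> {..<n}" using finite_bad by auto
next
  fix x assume x: "x \<in> E" "x \<noteq> 0"
  show "finite {i \<in> V \<times> {..<n}. (case i of (i, l) \<Rightarrow> \<lambda>x. W i (\<sigma> l x)) x \<noteq> 0}"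
    by (rule finite_subset[OF _ finite_cartesian_product[OF finite_support_ext[OF x] finite_lessThan[of n]]]) auto
  show "fsum (\<lambda>i. (case i of (i, l) \<Rightarrow> d i) * (case i of (i, l) \<Rightarrow> \<lambda>x. W i (\<sigma> l x)) x) (V \<times> {..<n}) = 0"
    using product_formula_ext[OF x] unfolding case_prod_unfold .
next
  fix B
  show "finite {x \<in> E. x \<noteq> 0 \<and>
     fsum (\<lambda>i. (case i of (i, l) \<Rightarrow> d i) * max 0 (- (case i of (i, l) \<Rightarrow> \<lambda>x. W i (\<sigma> l x)) x)) (V \<times> {..<n}) \<le> B}"
    using northcott_ext[of B] unfolding height_ext_def case_prod_unfold .
next
  fix D assume "D \<in> lift_deriv ` Ds"
  then show "derivation E D" using derivation_lift deriv by auto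
next
  fix x assume "x \<in> E" "\<And>D. D \<in> lift_deriv ` Ds \<Longrightarrow> D x = 0"
  then show "\<exists>y\<in>E. x = y ^ CHAR('b)" by (intro lift_deriv_kernel[OF prime_char deriv kernel]) auto
next
  fix k assume "k \<in> V \<times> {..<n}"
  then obtain i l where k: "k = (i, l)" "i \<in> V" "l < n" by auto
  interpret ev: extended_valuation_roots L F \<theta> "v i" "R i" "G i" "W i" using roots k by blast
  show "0 < (case k of (i, l) \<Rightarrow> d i)" using k weight_pos by simp
  show "valued_field E ((\<lambda>(i, l) x. W i (\<sigma> l x)) k)" using ev.valued_sigma k by simp
  obtain u where u: "u \<in> L" "u \<noteq> 0" "v i u > 0" using nontrivial k by blast
  then show "\<exists>u\<in>E. u \<noteq> 0 \<and> 0 < (case k of (i, l) \<Rightarrow> \<lambda>x. W i (\<sigma> l x)) u"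
    using base_subset_adjoin ev.W_sigma_base[of u l] k by (intro bexI[of _ u]) auto
  obtain C where C: "\<forall>D\<in>Ds. \<forall>x\<in>L. x \<noteq> 0 \<longrightarrow> v i x \<ge> 0 \<longrightarrow> D x \<noteq> 0 \<longrightarrow> v i (D x) \<ge> - C"
    using bounded_deriv k by blast
  have "\<exists>t. t \<in> L \<and> t \<noteq> 0 \<and> (\<forall>f\<in>E. \<sigma> l f \<in> R i \<longrightarrow> t * \<sigma> l (lift_deriv D f) \<in> R i)" if D: "D \<in> Ds" for D
  proof -
    obtain s w where sw: "ev.clears D s w" using ev.exists_clears[OF u deriv[OF D], of C] C D by blast
    then have "s \<in> L" "s \<noteq> 0" "w \<in> L" "w \<noteq> 0" by (auto simp: ev.clears_def)
    then show ?thesis using ev.lift_deriv_bound[OF deriv[OF D] sw _ k(3)]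
      by (intro exI[of _ "s ^ (n + degree (kappa D)) * w * (s ^ (2 * n)) ^ 2"]) auto
  qed
  then obtain t where t: "\<And>D. D \<in> Ds \<Longrightarrow> t D \<in> L \<and> t D \<noteq> 0 \<and>
      (\<forall>f\<in>E. \<sigma> l f \<in> R i \<longrightarrow> t D * \<sigma> l (lift_deriv D f) \<in> R i)" by metis
  \<comment> \<open>One constant for all derivations: t D times the derivative is integral, so the
    derivative has value at least the negative of that of t D.\<close>
  define C' where "C' = (\<Sum>D\<in>Ds. \<bar>v i (t D)\<bar>)"
  have "W i (\<sigma> l (lift_deriv D x)) \<ge> - C'"
    if D: "D \<in> Ds" and x: "x \<in> E" "x \<noteq> 0" "W i (\<sigma> l x) \<ge> 0" "lift_deriv D x \<noteq> 0" for D x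
  proof -
    interpret DE: derivation E "lift_deriv D" by (rule derivation_lift[OF deriv[OF D]])
    have "t D * \<sigma> l (lift_deriv D x) \<in> R i" using t[OF D] x ev.R_sigma_iff k by blast
    moreover have "t D \<in> G i" "\<sigma> l (lift_deriv D x) \<in> G i"
      using t[OF D] ev.base_G ev.sigma_G[OF DE.D_mem[OF x(1)] x(4) k(3)] by auto
    ultimately have "v i (t D) + W i (\<sigma> l (lift_deriv D x)) \<ge> 0"
      using ev.R_iff[of "t D * \<sigma> l (lift_deriv D x)"] ev.mult_G ev.W_mult ev.W_base t[OF D] by simp
    moreover have "\<bar>v i (t D)\<bar> \<le> C'" unfolding C'_def using finite_Ds D by (intro member_le_sum) auto
    ultimately show ?thesis by linarith
  qed
  moreover have "C' \<ge> 0" by (auto simp: C'_def intro: sum_nonneg)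
  ultimately show "\<exists>C\<ge>0. \<forall>D\<in>lift_deriv ` Ds. \<forall>x\<in>E. x \<noteq> 0 \<longrightarrow> 0 \<le> (case k of (i, l) \<Rightarrow> \<lambda>x. W i (\<sigma> l x)) x \<longrightarrow>
      D x \<noteq> 0 \<longrightarrow> - C \<le> (case k of (i, l) \<Rightarrow> \<lambda>x. W i (\<sigma> l x)) (D x)"
    using k by auto
next
  fix k assume "k \<in> V \<times> {..<n} - bad \<times> {..<n}"
  then obtain i l where k: "k = (i, l)" "i \<in> V - bad" "l < n" by auto
  interpret ev: extended_valuation_roots L F \<theta> "v i" "R i" "G i" "W i" using roots k by blast
  have iS: "i \<in> V - S" using k by (auto simp: bad_def)
  obtain u D where u: "u \<in> L" "D \<in> Ds" "u \<noteq> 0" "v i u = 1" "D u \<noteq> 0" "v i (D u) = 0"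
    using good_uniformizer[OF iS] by blast
  have Du: "D u \<in> L" using derivation.D_mem[OF deriv[OF u(2)] u(1)] .
  have "lift_deriv D u = D u" using lift_deriv_base[OF deriv[OF u(2)] u(1)] .
  then show "\<exists>u\<in>E. \<exists>D\<in>lift_deriv ` Ds. u \<noteq> 0 \<and> (case k of (i, l) \<Rightarrow> \<lambda>x. W i (\<sigma> l x)) u = 1 \<and>
      D u \<noteq> 0 \<and> (case k of (i, l) \<Rightarrow> \<lambda>x. W i (\<sigma> l x)) (D u) = 0"
    using u Du k base_subset_adjoin ev.W_sigma_base[of u l] ev.W_sigma_base[of "D u" l]
    by (intro bexI[of _ u] bexI[of _ "lift_deriv D"]) auto
  fix x assume x: "x \<in> E" "x \<noteq> 0"
  have "W i (\<sigma> l x) \<in> \<int>"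
    using k u by (intro ev.integral_values[OF good_int[OF iS] u(1,3,4) deriv[OF u(2)] u(5,6) good_lift[OF k(2) u(2)] x]) auto
  then show "(case k of (i, l) \<Rightarrow> \<lambda>x. W i (\<sigma> l x)) x \<in> \<int>" using k by simp
  fix D' assume "D' \<in> lift_deriv ` Ds" and ge: "0 \<le> (case k of (i, l) \<Rightarrow> \<lambda>x. W i (\<sigma> l x)) x" and nz: "D' x \<noteq> 0"
  then obtain D where D: "D \<in> Ds" "D' = lift_deriv D" by auto
  interpret DE: derivation E "lift_deriv D" by (rule derivation_lift[OF deriv[OF D(1)]])
  have "\<sigma> l x \<in> R i" using ev.R_sigma_iff[OF x k(3)] ge k by simp
  then have "\<sigma> l (lift_deriv D x) \<in> R i" using good_lift k D x by blast
  then show "0 \<le> (case k of (i, l) \<Rightarrow> \<lambda>x. W i (\<sigma> l x)) (D' x)"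
    using ev.R_sigma_iff[OF DE.D_mem[OF x(1)] _ k(3)] nz D k by simp
qed

end

section \<open>The abc inequality and its consequence\<close>

text \<open>The bound is attained at (2, 6), where the sum is 1/2 + 1/6 + 1/6. The excluded pairs
  are exactly those with sum at least 1.\<close>

lemma reciprocal_sum_bound:
  fixes m n :: nat
  assumes "m > 1" "n > 1" "(m, n) \<notin> {(2, 2), (2, 3), (3, 2), (2, 4), (4, 2), (3, 3)}"
  shows "1 / real m + 1 / real n + 1 / real (lcm m n) \<le> 5 / 6"
proof -
  have rec: "1 / real a \<le> 1 / real b" if "b \<le> a" "b > 0" for a b :: nat
    using that by (simp add: frac_le)
  have key: "1 / real m + 1 / real n + 1 / real (lcm m n) \<le> 5 / 6"
    if mn: "m \<le> n" "m > 1" "(m, n) \<notin> {(2, 2), (2, 3), (2, 4), (3, 3)}" for m n :: nat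
  proof -
    have lcm: "lcm m n \<ge> n" using mn by (intro dvd_imp_le) (auto intro: lcm_pos_nat)
    have "m = 2 \<longrightarrow> n \<noteq> 2 \<and> n \<noteq> 3 \<and> n \<noteq> 4" "m = 3 \<longrightarrow> n \<noteq> 3" using mn(3) by auto
    then have "m = 2 \<and> n = 5 \<or> m = 2 \<and> n \<ge> 6 \<or> m = 3 \<and> n = 4 \<or> m = 3 \<and> n \<ge> 5 \<or> m \<ge> 4 \<and> n \<ge> 4"
      using mn(1,2) by presburger
    then consider "m = 2" "n = 5" | "m = 2" "n \<ge> 6" | "m = 3" "n = 4" | "m = 3" "n \<ge> 5" | "m \<ge> 4" "n \<ge> 4"
      by blast
    then show ?thesis
    proof cases
      case 1
      \<comment> \<open>Here the general estimate lcm m n \<ge> n is too weak: 1/2 + 1/5 + 1/5 =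
        9/10.\<close>
      have "lcm 2 5 = (10 :: nat)" by (simp add: lcm_nat_def gcd_non_0_nat)
      then show ?thesis using 1 by simp
    next
      case 2
      then have "1 / real m = 1 / 2" "1 / real n \<le> 1 / 6" "1 / real (lcm m n) \<le> 1 / 6"
        using rec[of 6 n] rec[of 6 "lcm m n"] lcm by auto
      then show ?thesis by linarith
    next
      case 3
      have "lcm 3 4 = (12 :: nat)" by (simp add: lcm_nat_def gcd_non_0_nat)
      then show ?thesis using 3 by simp
    next
      case 4
      then have "1 / real m = 1 / 3" "1 / real n \<le> 1 / 5" "1 / real (lcm m n) \<le> 1 / 5"
        using rec[of 5 n] rec[of 5 "lcm m n"] lcm by auto
      then show ?thesis by linarith
    next
      case 5
      then have "1 / real m \<le> 1 / 4" "1 / real n \<le> 1 / 4" "1 / real (lcm m n) \<le> 1 / 4"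
        using rec[of 4 m] rec[of 4 n] rec[of 4 "lcm m n"] lcm by auto
      then show ?thesis by linarith
    qed
  qed
  show ?thesis
  proof (cases "m \<le> n")
    case True
    then show ?thesis using key[of m n] assms by auto
  next
    case False
    then have "1 / real n + 1 / real m + 1 / real (lcm n m) \<le> 5 / 6" using assms by (intro key) auto
    then show ?thesis by (simp add: lcm.commute)
  qed
qed

section \<open>Orders of derivatives and the abc inequality\<close>

context product_formula_field
begin

lemma char_pos: "CHAR('b) > 0" and char_gt_1: "CHAR('b) > 1"
  using prime_gt_0_nat[OF prime_char] prime_gt_1_nat[OF prime_char] .

text \<open>Write x = y u^j with j the rounded-down quotient of values, so that y is integral. In
  the product rule the first term loses v u through the rounding, the second through the exponent j
  - 1, and the hypothesis costs C in each.\<close>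

lemma deriv_bound:
  assumes i: "i \<in> V" and u: "u \<in> L" "u \<noteq> 0" "v i u > 0" and D: "D \<in> Ds" and C: "C \<ge> 0"
    and bound: "\<And>x. x \<in> L \<Longrightarrow> x \<noteq> 0 \<Longrightarrow> v i x \<ge> 0 \<Longrightarrow> D x \<noteq> 0 \<Longrightarrow> v i (D x) \<ge> - C"
    and x: "x \<in> L" "x \<noteq> 0" "D x \<noteq> 0"
  shows "v i (D x) \<ge> v i x - v i u - C"
proof -
  interpret vi: valued_field L "v i" by (rule valued[OF i])
  interpret D: derivation L D by (rule deriv[OF D])
  interpret A: subring_set "vi.atleast 0" by (rule vi.subring_atleast)
  define j where "j = \<lfloor>v i x / v i u\<rfloor>"
  have j: "of_int j * v i u \<le> v i x" "v i x - v i u \<le> of_int j * v i u"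
  proof -
    have "of_int j \<le> v i x / v i u" "v i x / v i u < of_int j + 1" by (auto simp: j_def)
    then show "of_int j * v i u \<le> v i x" "v i x - v i u \<le> of_int j * v i u"
      using u by (auto simp: field_simps)
  qed
  define y where "y = x * u powi (- j)"
  have y: "y \<in> L" "y \<noteq> 0" using x u by (auto simp: y_def power_int_mem)
  have vy: "v i y = v i x - of_int j * v i u"
    using x u by (simp add: y_def vi.w_mult power_int_mem vi.w_power_int)
  have x_eq: "x = y * u powi j" using u by (simp add: y_def power_int_minus)
  have Db: "D z \<in> vi.atleast (- C)" if "z \<in> L" "z \<noteq> 0" "v i z \<ge> 0" for z
    using bound that D.D_mem by (auto intro!: vi.atleastI)
  have pow: "u powi k \<in> vi.atleast (of_int k * v i u)" for k
    using u by (auto intro!: vi.atleastI simp: power_int_mem vi.w_power_int)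
  have "D y * u powi j \<in> vi.atleast (- C + of_int j * v i u)"
    using Db[OF y] pow vy j by (intro vi.atleast_mult) auto
  moreover have "y * (of_int j * u powi (j - 1) * D u) \<in> vi.atleast (v i y + (0 + of_int (j - 1) * v i u + (- C)))"
    using Db[OF u(1,2)] u(3) y by (intro vi.atleast_mult pow A.of_int_mem) (auto intro: vi.atleastI)
  ultimately have "D y * u powi j + y * (of_int j * u powi (j - 1) * D u) \<in> vi.atleast (v i x - v i u - C)"
    using j vy by (intro vi.atleast_add; elim vi.atleast_mono) (auto simp: algebra_simps)
  moreover have "D x = D y * u powi j + y * (of_int j * u powi (j - 1) * D u)"
    using y u by (subst x_eq) (simp add: D.D_mult power_int_mem D.D_power_int)
  ultimately show ?thesis using x(3) vi.atleastD by metis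
qed

lemma good_deriv_bound:
  assumes "i \<in> V - S" "D \<in> Ds" "x \<in> L" "x \<noteq> 0" "D x \<noteq> 0"
  shows "v i (D x) \<ge> v i x - 1"
proof -
  obtain u where "u \<in> L" "u \<noteq> 0" "v i u = 1" using good_uniformizer[OF assms(1)] by blast
  then show ?thesis using deriv_bound[of i u D 0 x] good_deriv[OF assms(1,2)] assms by auto
qed

lemma exists_deriv_bound:
  assumes i: "i \<in> V"
  shows "\<exists>C\<ge>0. \<forall>D\<in>Ds. \<forall>x\<in>L. x \<noteq> 0 \<longrightarrow> D x \<noteq> 0 \<longrightarrow> v i (D x) \<ge> v i x - C"
proof -
  obtain u where u: "u \<in> L" "u \<noteq> 0" "v i u > 0" using nontrivial[OF i] by blast
  obtain C where "C \<ge> 0" "\<forall>D\<in>Ds. \<forall>x\<in>L. x \<noteq> 0 \<longrightarrow> v i x \<ge> 0 \<longrightarrow> D x \<noteq> 0 \<longrightarrow> v i (D x) \<ge> - C"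
    using bounded_deriv[OF i] by blast
  then show ?thesis using deriv_bound[OF i u, of _ C] u
    by (intro exI[of _ "v i u + C"]) force
qed

text \<open>Among v 1 = 0, v \<gamma> and v \<delta> the least value must occur at least
  twice.\<close>

lemma unit_equation_cases:
  assumes i: "i \<in> V" and \<gamma>: "\<gamma> \<in> L" "\<gamma> \<noteq> 0" and \<delta>: "\<delta> \<in> L" "\<delta> \<noteq> 0" and sum: "\<gamma> + \<delta> = 1"
  obtains "v i \<gamma> > 0" "v i \<delta> = 0" | "v i \<delta> > 0" "v i \<gamma> = 0" | "v i \<gamma> < 0" "v i \<delta> = v i \<gamma>"
    | "v i \<gamma> = 0" "v i \<delta> = 0"
proof -
  interpret vi: valued_field L "v i" by (rule valued[OF i])
  have lt: "v i (\<gamma> + \<delta>) = v i \<gamma>" if "v i \<gamma> < v i \<delta>" using vi.w_add_eq[OF \<gamma> \<delta> that] by simp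
  have gt: "v i (\<gamma> + \<delta>) = v i \<delta>" if "v i \<delta> < v i \<gamma>" using vi.w_add_eq[OF \<delta> \<gamma> that] by (simp add: add.commute)
  have ge: "min (v i \<gamma>) (v i \<delta>) \<le> 0" using vi.w_add[OF \<gamma> \<delta>] sum by simp
  consider "v i \<gamma> < v i \<delta>" | "v i \<delta> < v i \<gamma>" | "v i \<gamma> = v i \<delta>" by linarith
  then show ?thesis
  proof cases
    case 1
    then show ?thesis using lt sum that(2) by simp
  next
    case 2
    then show ?thesis using gt sum that(1) by simp
  next
    case 3
    show ?thesis
    proof (cases "v i \<gamma> = 0")
      case True
      then show ?thesis using 3 by (intro that(4)) simp_all
    next
      case False
      then show ?thesis using 3 ge by (intro that(3)) simp_all
    qed
  qed
qed

text \<open>The analogue of the Mason--Stothers inequality: \<open>D \<gamma> = - D \<delta>\<close> vanishes at the zeros of \<open>\<gamma>\<close> and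
  \<open>\<delta>\<close> to nearly the same order, and its values sum to zero.\<close>

lemma mason_stothers:
  assumes \<gamma>: "\<gamma> \<in> L" "\<gamma> \<noteq> 0" and \<delta>: "\<delta> \<in> L" "\<delta> \<noteq> 0" and sum: "\<gamma> + \<delta> = 1"
    and D: "D \<in> Ds" "D \<gamma> \<noteq> 0" and pos: "m > 0" "n > 0" "l > 0"
    and T: "finite T" "S \<subseteq> T" "T \<subseteq> V"
    and C: "\<And>i. i \<in> T \<Longrightarrow> C i \<ge> 0"
      "\<And>i x. i \<in> T \<Longrightarrow> x \<in> L \<Longrightarrow> x \<noteq> 0 \<Longrightarrow> D x \<noteq> 0 \<Longrightarrow> v i (D x) \<ge> v i x - C i"
    and m: "\<And>i. i \<in> V - T \<Longrightarrow> v i \<gamma> > 0 \<Longrightarrow> v i \<gamma> \<ge> m"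
    and n: "\<And>i. i \<in> V - T \<Longrightarrow> v i \<delta> > 0 \<Longrightarrow> v i \<delta> \<ge> n"
    and l: "\<And>i. i \<in> V - T \<Longrightarrow> v i \<gamma> < 0 \<Longrightarrow> - v i \<gamma> \<ge> l"
  shows "height \<gamma> * (1 - 1 / m - 1 / n - 1 / l) \<le> (\<Sum>i\<in>T. d i * C i)"
proof -
  interpret D: derivation L D by (rule deriv[OF D(1)])
  have Dg: "D \<gamma> \<in> L" using D.D_mem \<gamma> by blast
  have "D \<gamma> + D \<delta> = 0" using D.D_add[OF \<gamma>(1) \<delta>(1)] sum by simp
  then have Dd: "D \<delta> = - D \<gamma>" by (simp add: eq_neg_iff_add_eq_0 add.commute)
  then have Dd0: "D \<delta> \<noteq> 0" using D by simp
  have vDd: "v i (D \<delta>) = v i (D \<gamma>)" if "i \<in> V" for i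
    using valued_field.w_minus[OF valued[OF that] Dg D(2)] Dd by simp
  \<comment> \<open>Z0, Z1 and P weigh the zeros of \<gamma>, the zeros of \<delta> and their common
    poles. By the product formula each has total \<open>height \<gamma>\<close>. K collects the
    losses at places of T.\<close>
  define Z0 where "Z0 i = d i * max 0 (v i \<gamma>)" for i
  define Z1 where "Z1 i = d i * max 0 (v i \<delta>)" for i
  define P where "P i = d i * max 0 (- v i \<gamma>)" for i
  define K where "K i = (if i \<in> T then d i * C i else 0)" for i
  have fg: "finite {i \<in> V. v i \<gamma> \<noteq> 0}" and fd: "finite {i \<in> V. v i \<delta> \<noteq> 0}" and fD: "finite {i \<in> V. v i (D \<gamma>) \<noteq> 0}"
    using finite_support \<gamma> \<delta> Dg D by auto
  have fZ0: "finite {i \<in> V. Z0 i \<noteq> 0}" by (rule finite_subset[OF _ fg]) (auto simp: Z0_def)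
  have fZ1: "finite {i \<in> V. Z1 i \<noteq> 0}" by (rule finite_subset[OF _ fd]) (auto simp: Z1_def)
  have fP: "finite {i \<in> V. P i \<noteq> 0}" by (rule finite_subset[OF _ fg]) (auto simp: P_def)
  have fK: "finite {i \<in> V. K i \<noteq> 0}" by (rule finite_subset[OF _ T(1)]) (auto simp: K_def)
  have hP: "height \<gamma> = fsum P V" by (simp add: height_def P_def[abs_def])
  have Z0: "fsum Z0 V = height \<gamma>"
  proof -
    have "fsum (\<lambda>i. Z0 i + (- P i)) V = fsum (\<lambda>i. d i * v i \<gamma>) V"
      by (intro fsum_cong) (auto simp: Z0_def P_def max_def)
    also have "\<dots> = 0" using product_formula \<gamma> by blast
    finally have "fsum Z0 V + fsum (\<lambda>i. - P i) V = 0" using fZ0 fP by (subst (asm) fsum_add) auto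
    then show ?thesis by (simp add: fsum_minus hP)
  qed
  have Z1: "fsum Z1 V = height \<gamma>"
  proof -
    have "fsum (\<lambda>i. Z1 i + (- P i)) V = fsum (\<lambda>i. d i * v i \<delta>) V"
    proof (intro fsum_cong)
      fix i assume "i \<in> V"
      then show "Z1 i + - P i = d i * v i \<delta>"
        by (rule unit_equation_cases[OF _ \<gamma> \<delta> sum]) (auto simp: Z1_def P_def max_def)
    qed
    also have "\<dots> = 0" using product_formula \<delta> by blast
    finally have "fsum Z1 V + fsum (\<lambda>i. - P i) V = 0" using fZ1 fP by (subst (asm) fsum_add) auto
    then show ?thesis by (simp add: fsum_minus hP)
  qed
  \<comment> \<open>A is a lower bound for the order of D \<gamma>, place by place. Outside T
    differentiation costs at most 1, which is at most k/m, k/n or k/l for a zero of \<gamma>, a zero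
    of \<delta> or a pole of order k. Since the orders of D \<gamma> sum to 0, the total of A is at
    most 0, and this is the claim.\<close>
  define A where "A i = (1 - 1 / m) * Z0 i + ((1 - 1 / n) * Z1 i + ((- 1 - 1 / l) * P i + (- K i)))" for i
  have "A i \<le> d i * v i (D \<gamma>)" if i: "i \<in> V" for i
  proof -
    have di: "d i > 0" using weight_pos i by blast
    define z where "z = v i (D \<gamma>)"
    have "(1 - 1 / m) * max 0 (v i \<gamma>) + (1 - 1 / n) * max 0 (v i \<delta>) + (- 1 - 1 / l) * max 0 (- v i \<gamma>)
        - (if i \<in> T then C i else 0) \<le> z"
    proof (cases "i \<in> T")
      case True
      have b: "z \<ge> v i \<gamma> - C i" "z \<ge> v i \<delta> - C i"
        using C(2)[OF True \<gamma> D(2)] C(2)[OF True \<delta> Dd0] vDd[OF i] by (auto simp: z_def)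
      have q: "x / m \<ge> 0" "x / n \<ge> 0" "x / l \<ge> 0" if "x \<ge> 0" for x using that pos by auto
      show ?thesis
        by (rule unit_equation_cases[OF i \<gamma> \<delta> sum])
          (use True b q[of "v i \<gamma>"] q[of "v i \<delta>"] q[of "- v i \<gamma>"] in \<open>auto simp: max_def algebra_simps\<close>)
    next
      case False
      then have iS: "i \<in> V - S" "i \<in> V - T" using i T by auto
      have b: "z \<ge> v i \<gamma> - 1" "z \<ge> v i \<delta> - 1"
        using good_deriv_bound[OF iS(1) D(1) \<gamma> D(2)] good_deriv_bound[OF iS(1) D(1) \<delta> Dd0] vDd[OF i]
        by (auto simp: z_def)
      have b0: "z \<ge> 0" if "v i \<gamma> \<ge> 0" using good_deriv[OF iS(1) D(1) \<gamma> that D(2)] by (simp add: z_def)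
      have q: "v i \<gamma> > 0 \<Longrightarrow> v i \<gamma> / m \<ge> 1" "v i \<delta> > 0 \<Longrightarrow> v i \<delta> / n \<ge> 1" "v i \<gamma> < 0 \<Longrightarrow> - v i \<gamma> / l \<ge> 1"
        using m[OF iS(2)] n[OF iS(2)] l[OF iS(2)] pos by (auto simp: field_simps)
      show ?thesis
        by (rule unit_equation_cases[OF i \<gamma> \<delta> sum])
          (use False b b0 q in \<open>auto simp: max_def algebra_simps\<close>)
    qed
    then have "d i * ((1 - 1 / m) * max 0 (v i \<gamma>) + (1 - 1 / n) * max 0 (v i \<delta>) + (- 1 - 1 / l) * max 0 (- v i \<gamma>)
        - (if i \<in> T then C i else 0)) \<le> d i * z" using di by (intro mult_left_mono) auto
    moreover have "A i = d i * ((1 - 1 / m) * max 0 (v i \<gamma>) + (1 - 1 / n) * max 0 (v i \<delta>) + (- 1 - 1 / l) * max 0 (- v i \<gamma>)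
        - (if i \<in> T then C i else 0))"
      by (simp add: A_def Z0_def Z1_def P_def K_def algebra_simps)
    ultimately show ?thesis by (simp add: z_def)
  qed
  moreover have "finite {i \<in> V. A i \<noteq> 0}"
    by (rule finite_subset[of _ "{i \<in> V. Z0 i \<noteq> 0} \<union> {i \<in> V. Z1 i \<noteq> 0} \<union> {i \<in> V. P i \<noteq> 0} \<union> {i \<in> V. K i \<noteq> 0}"])
      (use fZ0 fZ1 fP fK in \<open>auto simp: A_def\<close>)
  moreover have "finite {i \<in> V. d i * v i (D \<gamma>) \<noteq> 0}" by (rule finite_subset[OF _ fD]) auto
  ultimately have "fsum A V \<le> fsum (\<lambda>i. d i * v i (D \<gamma>)) V" by (intro fsum_mono) auto
  also have "\<dots> = 0" using product_formula[OF Dg D(2)] .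
  finally have "fsum A V \<le> 0" .
  have f: "finite {i \<in> V. c * f i \<noteq> 0}" if "finite {i \<in> V. f i \<noteq> 0}" for c and f :: "'i \<Rightarrow> real"
    by (rule finite_subset[OF _ that]) auto
  have f2: "finite {i \<in> V. f i + g i \<noteq> 0}" if "finite {i \<in> V. f i \<noteq> 0}" "finite {i \<in> V. g i \<noteq> 0}" for f g :: "'i \<Rightarrow> real"
    by (rule finite_subset[OF _ finite_UnI[OF that]]) auto
  have fK': "finite {i \<in> V. - K i \<noteq> 0}" using fK by simp
  have "fsum A V = (1 - 1 / m) * fsum Z0 V + ((1 - 1 / n) * fsum Z1 V + ((- 1 - 1 / l) * fsum P V + (- fsum K V)))"
    unfolding A_def by (subst fsum_add fsum_minus fsum_cmult; (intro f f2 fZ0 fZ1 fP fK')?)+ simp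
  moreover have "fsum K V = (\<Sum>i\<in>T. d i * C i)"
    using T by (subst fsum_eq[of T]) (auto simp: K_def)
  ultimately show ?thesis using \<open>fsum A V \<le> 0\<close> Z0 Z1 hP by (simp add: algebra_simps)
qed

lemma height_power:
  assumes "x \<in> L" "x \<noteq> 0"
  shows "height (x ^ k) = real k * height x"
  unfolding height_def fsum_cmult[symmetric]
proof (rule fsum_cong)
  fix i assume "i \<in> V"
  then have "v i (x ^ k) = real k * v i x" using valued_field.w_power[OF valued] assms by blast
  moreover have "real k * max 0 (- v i x) = max 0 (- (real k * v i x))"
    by (simp add: max_mult_distrib_left)
  ultimately show "d i * max 0 (- v i (x ^ k)) = real k * (d i * max 0 (- v i x))"
    by (metis mult.left_commute)
qed

lemma finite_height: "finite {x \<in> L. x \<noteq> 0 \<and> height x \<le> B}"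
  using northcott[of B] by (simp add: height_def)

lemma height_nonneg: "height x \<ge> 0"
  unfolding height_def using weight_pos by (intro fsum_nonneg mult_nonneg_nonneg) (auto simp: less_imp_le)

text \<open>The successive roots g t have height at most that of u, so by finiteness two of them
  coincide, say for exponents s < t. Then p^s h = p^t h for their common height h, which must be
  0.\<close>

lemma height_perfect:
  assumes u: "u \<in> L" "u \<noteq> 0" and roots: "\<And>t. \<exists>g\<in>L. u = g ^ (CHAR('b) ^ t)"
  shows "height u = 0"
proof -
  obtain g where g: "\<And>t. g t \<in> L" "\<And>t. u = g t ^ (CHAR('b) ^ t)" using roots by metis
  have g0: "g t \<noteq> 0" for t using g(2)[of t] u char_pos by auto
  have h: "height u = real (CHAR('b) ^ t) * height (g t)" for t
    using height_power[OF g(1) g0, of t "CHAR('b) ^ t"] g(2)[of t] by simp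
  have "height (g t) \<le> height u" for t
  proof -
    have "1 * height (g t) \<le> real (CHAR('b) ^ t) * height (g t)"
      using char_pos by (intro mult_right_mono height_nonneg) (simp add: Suc_leI)
    then show ?thesis using h[of t] by simp
  qed
  then have "range g \<subseteq> {x \<in> L. x \<noteq> 0 \<and> height x \<le> height u}" using g g0 by auto
  then have "finite (range g)" using finite_height finite_subset by blast
  then have "\<not> inj g" using finite_imageD infinite_UNIV_nat by blast
  then obtain s t where st: "s < t" "g s = g t" by (metis injI linorder_neqE_nat)
  have "real (CHAR('b) ^ s) * height (g s) = real (CHAR('b) ^ t) * height (g s)" using h[of s] h[of t] st(2) by metis
  moreover have "CHAR('b) ^ s \<noteq> CHAR('b) ^ t" using power_inject_exp[OF char_gt_1] st by auto
  then have "real (CHAR('b) ^ s) \<noteq> real (CHAR('b) ^ t)" by (simp only: of_nat_eq_iff not_False_eq_True)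
  ultimately have "height (g s) = 0" using mult_right_cancel by blast
  then show ?thesis using h[of s] by simp
qed

theorem finite_generators:
  assumes a: "a \<in> L" "a \<noteq> 0" and b: "b \<in> L" "b \<noteq> 0"
  shows "\<exists>\<Gamma>. finite \<Gamma> \<and> (\<forall>x\<in>L. \<forall>y\<in>L. \<forall>m n. m > 1 \<longrightarrow> n > 1 \<longrightarrow> coprime m CHAR('b) \<longrightarrow> coprime n CHAR('b) \<longrightarrow>
       (m, n) \<notin> {(2, 2), (2, 3), (3, 2), (2, 4), (4, 2), (3, 3)} \<longrightarrow> a * x ^ m + b * y ^ n = 1 \<longrightarrow>
       (\<exists>\<gamma>\<in>\<Gamma>. \<exists>t. a * x ^ m = \<gamma> ^ (CHAR('b) ^ t)))"
proof -
  \<comment> \<open>Outside T the coefficients a and b have value 0, so that only the m-th and n-th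
    powers contribute to the orders.\<close>
  define T where "T = S \<union> {i \<in> V. v i a \<noteq> 0} \<union> {i \<in> V. v i b \<noteq> 0}"
  have T: "finite T" "S \<subseteq> T" "T \<subseteq> V" using finite_S S_V finite_support a b by (auto simp: T_def)
  have "\<forall>i\<in>T. \<exists>C\<ge>0. \<forall>D\<in>Ds. \<forall>x\<in>L. x \<noteq> 0 \<longrightarrow> D x \<noteq> 0 \<longrightarrow> v i (D x) \<ge> v i x - C"
    using exists_deriv_bound T by blast
  then obtain C where C: "\<And>i. i \<in> T \<Longrightarrow> C i \<ge> 0"
    "\<And>i D x. i \<in> T \<Longrightarrow> D \<in> Ds \<Longrightarrow> x \<in> L \<Longrightarrow> x \<noteq> 0 \<Longrightarrow> D x \<noteq> 0 \<Longrightarrow> v i (D x) \<ge> v i x - C i"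
    by metis
  define K where "K = (\<Sum>i\<in>T. d i * C i)"
  have K0: "K \<ge> 0" unfolding K_def using C weight_pos T
    by (intro sum_nonneg mult_nonneg_nonneg) (auto simp: less_imp_le subset_iff)
  \<comment> \<open>0 and 1 serve the degenerate solutions in which one summand vanishes. The factor
    6 inverts 1 - 5/6 from \<open>reciprocal_sum_bound\<close>.\<close>
  define \<Gamma> where "\<Gamma> = {0, 1} \<union> {x \<in> L. x \<noteq> 0 \<and> height x \<le> 6 * K}"
  \<comment> \<open>The orders satisfy p^t v g = m v x with integral values, and m is prime to p, so
    m divides v g.\<close>
  have multiple: "\<exists>k::int. v i g = of_int (int m * k)"
    if i: "i \<in> V - T" and eq: "g ^ (CHAR('b) ^ t) = c * x ^ m" and vc: "v i c = 0" and "c \<in> L" "c \<noteq> 0" "x \<in> L" "x \<noteq> 0"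
      "g \<in> L" "g \<noteq> 0" "coprime m CHAR('b)" for i g t c x m
  proof -
    interpret vi: valued_field L "v i" using valued i by blast
    have iS: "i \<in> V - S" using i T by auto
    obtain e where e: "v i g = of_int e" using good_int[OF iS \<open>g \<in> L\<close> \<open>g \<noteq> 0\<close>] by (rule Ints_cases)
    obtain f where f: "v i x = of_int f" using good_int[OF iS \<open>x \<in> L\<close> \<open>x \<noteq> 0\<close>] by (rule Ints_cases)
    have "real (CHAR('b) ^ t) * v i g = real m * v i x"
    proof -
      have "v i (g ^ (CHAR('b) ^ t)) = real (CHAR('b) ^ t) * v i g" using that by (intro vi.w_power)
      moreover have "v i (c * x ^ m) = real m * v i x"
        using that by (simp add: vi.w_mult vi.w_power power_mem)
      ultimately show ?thesis using eq by metis
    qed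
    then have "real_of_int (int (CHAR('b) ^ t) * e) = real_of_int (int m * f)" unfolding e f by simp
    then have "int (CHAR('b) ^ t) * e = int m * f" by (rule of_int_eq_iff[THEN iffD1])
    then have "int m dvd int (CHAR('b) ^ t) * e" by simp
    moreover have "coprime (int m) (int (CHAR('b) ^ t))" using that by simp
    ultimately have "int m dvd e" using coprime_dvd_mult_right_iff by blast
    then show ?thesis using e by auto
  qed
  have main: "\<exists>\<gamma>\<in>\<Gamma>. \<exists>t. a * x ^ m = \<gamma> ^ (CHAR('b) ^ t)"
    if x: "x \<in> L" and y: "y \<in> L" and mn: "m > 1" "n > 1" "coprime m CHAR('b)" "coprime n CHAR('b)"
      "(m, n) \<notin> {(2, 2), (2, 3), (3, 2), (2, 4), (4, 2), (3, 3)}" and eq: "a * x ^ m + b * y ^ n = 1" for x y m n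
  proof (cases "a * x ^ m = 0 \<or> b * y ^ n = 0")
    case True
    then have "a * x ^ m = 0 \<or> a * x ^ m = 1" using eq by (metis add.right_neutral)
    then have "a * x ^ m \<in> \<Gamma>" unfolding \<Gamma>_def by blast
    then show ?thesis by (intro bexI[of _ "a * x ^ m"] exI[of _ 0]) auto
  next
    case nz: False
    define u where "u = a * x ^ m"
    have u: "u \<in> L" "u \<noteq> 0" using x a nz by (auto simp: u_def)
    have xy0: "x \<noteq> 0" "y \<noteq> 0" using nz mn by (auto simp: power_0_left)
    show ?thesis
    proof (cases "\<forall>t. \<exists>g\<in>L. u = g ^ (CHAR('b) ^ t)")
      case True
      then have "height u = 0" using height_perfect u by blast
      then have "u \<in> \<Gamma>" using u K0 by (simp add: \<Gamma>_def)
      then show ?thesis by (intro bexI[of _ u] exI[of _ 0]) (auto simp: u_def)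
    next
      case False
      \<comment> \<open>s is the first exponent for which u has no root in L. The root \<gamma> one
        exponent earlier is thus not a p-th power, and some derivation does not kill it.\<close>
      define s where "s = (LEAST t. \<not> (\<exists>g\<in>L. u = g ^ (CHAR('b) ^ t)))"
      have s: "\<not> (\<exists>g\<in>L. u = g ^ (CHAR('b) ^ s))" unfolding s_def
        by (rule LeastI_ex[where P = "\<lambda>t. \<not> (\<exists>g\<in>L. u = g ^ (CHAR('b) ^ t))"]) (use False in blast)
      have "s \<noteq> 0"
      proof
        assume "s = 0"
        then show False using s u by auto
      qed
      then obtain t where t: "s = Suc t" by (cases s) auto
      then have "\<exists>g\<in>L. u = g ^ (CHAR('b) ^ t)" using not_less_Least[of t "\<lambda>t. \<not> (\<exists>g\<in>L. u = g ^ (CHAR('b) ^ t))"] by (auto simp: s_def)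
      then obtain \<gamma> where \<gamma>: "\<gamma> \<in> L" "u = \<gamma> ^ (CHAR('b) ^ t)" by blast
      have \<gamma>0: "\<gamma> \<noteq> 0" using \<gamma> u char_pos by auto
      have "\<not> (\<exists>y\<in>L. \<gamma> = y ^ CHAR('b))"
      proof
        assume "\<exists>y\<in>L. \<gamma> = y ^ CHAR('b)"
        then obtain g where "g \<in> L" "\<gamma> = g ^ CHAR('b)" by blast
        then have "u = g ^ (CHAR('b) ^ s)" using \<gamma> t by (simp flip: power_mult)
        then show False using s \<open>g \<in> L\<close> by blast
      qed
      then obtain D where D: "D \<in> Ds" "D \<gamma> \<noteq> 0" using kernel \<gamma> by blast
      define \<delta> where "\<delta> = 1 - \<gamma>"
      have sum: "\<gamma> + \<delta> = 1" by (simp add: \<delta>_def)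
      have \<delta>: "\<delta> \<in> L" using \<gamma> by (auto simp: \<delta>_def)
      \<comment> \<open>By additivity of the Frobenius, 1 - \<gamma> is a root of b y^n with the
        same exponent, so both summands are replaced together.\<close>
      have "(\<gamma> + \<delta>) ^ (CHAR('b) ^ t) = \<gamma> ^ (CHAR('b) ^ t) + \<delta> ^ (CHAR('b) ^ t)" by (rule freshmans_dream'[OF prime_char refl])
      then have \<delta>eq: "\<delta> ^ (CHAR('b) ^ t) = b * y ^ n" 
        using sum eq \<gamma>(2) unfolding u_def by (metis add_left_cancel power_one)
      then have \<delta>0: "\<delta> \<noteq> 0" using nz char_pos by (metis power_eq_0_iff zero_less_power zero_power)
      have \<gamma>m: "\<exists>k::int. v i \<gamma> = of_int (int m * k)" if "i \<in> V - T" for i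
        using multiple[OF that, of \<gamma> t a x m] \<gamma> \<gamma>0 a x xy0 mn that by (auto simp: u_def T_def)
      have \<delta>n: "\<exists>k::int. v i \<delta> = of_int (int n * k)" if "i \<in> V - T" for i
        using multiple[OF that \<delta>eq] \<delta> \<delta>0 b y xy0 mn that by (auto simp: T_def)
      have posm: "z \<ge> real m" if "z = of_int (int m * k)" "z > 0" for z :: real and m :: nat and k :: int
      proof -
        have "k \<ge> 1" using that by (simp add: zero_less_mult_iff)
        then have "real m * 1 \<le> real m * of_int k" by (intro mult_left_mono) auto
        then show ?thesis using that by simp
      qed
      have "height \<gamma> * (1 - 1 / real m - 1 / real n - 1 / real (lcm m n)) \<le> K"
        unfolding K_def
      proof (rule mason_stothers[OF \<gamma>(1) \<gamma>0 \<delta> \<delta>0 sum D _ _ _ T C(1)])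
        show "real m > 0" "real n > 0" "real (lcm m n) > 0" using mn by (auto simp: lcm_pos_nat)
        show "v i z - C i \<le> v i (D z)" if "i \<in> T" "z \<in> L" "z \<noteq> 0" "D z \<noteq> 0" for i z using C(2) D that by blast
        fix i assume i: "i \<in> V - T"
        show "v i \<gamma> \<ge> real m" if "v i \<gamma> > 0" using \<gamma>m[OF i] posm that by blast
        show "v i \<delta> \<ge> real n" if "v i \<delta> > 0" using \<delta>n[OF i] posm that by blast
        \<comment> \<open>At a pole \<gamma> and \<delta> have the same order, which is therefore
          divisible by both m and n.\<close>
        show "- v i \<gamma> \<ge> real (lcm m n)" if neg: "v i \<gamma> < 0"
        proof -
          have eqv: "v i \<delta> = v i \<gamma>" using neg i
            by (cases rule: unit_equation_cases[OF _ \<gamma>(1) \<gamma>0 \<delta> \<delta>0 sum, of i]) auto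
          obtain j k where jk: "v i \<gamma> = of_int (int m * j)" "v i \<delta> = of_int (int n * k)" using \<gamma>m[OF i] \<delta>n[OF i] by blast
          then have "int m * j = int n * k" using eqv by (metis of_int_eq_iff)
          then have "int m dvd int m * j" "int n dvd int m * j" by (metis dvd_triv_left)+
          then have "int (lcm m n) dvd int m * j" by (metis lcm_int_int_eq lcm_least)
          then obtain e where "int m * j = int (lcm m n) * e" by (rule dvdE)
          then have "- v i \<gamma> = of_int (int (lcm m n) * (- e))" using jk by simp
          then show ?thesis by (rule posm) (use neg in simp)
        qed
      qed
      moreover have "height \<gamma> * (1 / 6) \<le> height \<gamma> * (1 - 1 / real m - 1 / real n - 1 / real (lcm m n))"
        using reciprocal_sum_bound[OF mn(1,2,5)] by (intro mult_left_mono height_nonneg) linarith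
      ultimately have "height \<gamma> \<le> 6 * K" by linarith
      then have "\<gamma> \<in> \<Gamma>" using \<gamma> \<gamma>0 by (simp add: \<Gamma>_def)
      then show ?thesis using \<gamma> by (auto simp: u_def)
    qed
  qed
  have fin: "finite \<Gamma>" using finite_height by (simp add: \<Gamma>_def)
  show ?thesis by (intro exI[of _ \<Gamma>] conjI ballI allI impI fin main)
qed

end

section \<open>Transcendental extensions\<close>

context valued_field
begin

definition gauss :: "'b poly \<Rightarrow> real" where
  "gauss A = Min {w (coeff A j) |j. coeff A j \<noteq> 0}"

lemma gauss_set:
  assumes "A \<noteq> 0"
  shows "finite {w (coeff A j) |j. coeff A j \<noteq> 0}" "{w (coeff A j) |j. coeff A j \<noteq> 0} \<noteq> {}"
proof -
  have "{w (coeff A j) |j. coeff A j \<noteq> 0} \<subseteq> (\<lambda>j. w (coeff A j)) ` {..degree A}" by (auto intro: le_degree)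
  then show "finite {w (coeff A j) |j. coeff A j \<noteq> 0}" by (rule finite_subset) simp
  show "{w (coeff A j) |j. coeff A j \<noteq> 0} \<noteq> {}" using leading_coeff_neq_0[OF assms] by blast
qed

lemma gauss_le: "coeff A j \<noteq> 0 \<Longrightarrow> gauss A \<le> w (coeff A j)"
proof -
  assume j: "coeff A j \<noteq> 0"
  then have "A \<noteq> 0" by auto
  then show ?thesis unfolding gauss_def using gauss_set(1) j by (intro Min_le) auto
qed

lemma gauss_attained:
  assumes "A \<noteq> 0"
  obtains j where "coeff A j \<noteq> 0" "gauss A = w (coeff A j)"
proof -
  have "gauss A \<in> {w (coeff A j) |j. coeff A j \<noteq> 0}" unfolding gauss_def by (rule Min_in) (use gauss_set[OF assms] in auto)
  then show ?thesis using that by blast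
qed

lemma gauss_ge: "A \<noteq> 0 \<Longrightarrow> (\<And>j. coeff A j \<noteq> 0 \<Longrightarrow> w (coeff A j) \<ge> c) \<Longrightarrow> gauss A \<ge> c"
  by (erule gauss_attained) auto

lemma gauss_coeff_atleast: "A \<in> polys L \<Longrightarrow> coeff A j \<in> atleast (gauss A)"
  using gauss_le by (intro atleastI) auto

lemma gauss_const:
  assumes "c \<noteq> 0"
  shows "gauss [:c:] = w c"
proof -
  have "[:c:] \<noteq> 0" using assms by simp
  then obtain j where "coeff [:c:] j \<noteq> 0" "gauss [:c:] = w (coeff [:c:] j)" by (rule gauss_attained)
  then show ?thesis by (cases j) auto
qed

lemma gauss_smult:
  assumes "c \<in> L" "c \<noteq> 0" "A \<in> polys L" "A \<noteq> 0"
  shows "gauss (smult c A) = w c + gauss A"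
proof (rule antisym)
  obtain j where j: "coeff A j \<noteq> 0" "gauss A = w (coeff A j)" using assms(4) by (rule gauss_attained)
  show "gauss (smult c A) \<le> w c + gauss A"
    using gauss_le[of "smult c A" j] j assms by (simp add: w_mult coeff_polys)
  show "w c + gauss A \<le> gauss (smult c A)"
    using assms by (intro gauss_ge) (auto simp: w_mult coeff_polys gauss_le)
qed

lemma gauss_add:
  assumes "A \<in> polys L" "B \<in> polys L" "A + B \<noteq> 0"
  shows "gauss (A + B) \<ge> min (gauss A) (gauss B)"
proof (rule gauss_ge)
  fix j assume nz: "coeff (A + B) j \<noteq> 0"
  have "coeff A j + coeff B j \<in> atleast (min (gauss A) (gauss B))"
    by (intro atleast_add atleast_mono[OF gauss_coeff_atleast[OF assms(1)]]
        atleast_mono[OF gauss_coeff_atleast[OF assms(2)]]) auto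
  then show "min (gauss A) (gauss B) \<le> w (coeff (A + B) j)" using nz atleastD by simp
qed fact

text \<open>Gauss's lemma: the product of the first coefficients of least value dominates its
  coefficient of the product.\<close>

lemma gauss_mult:
  assumes A: "A \<in> polys L" "A \<noteq> 0" and B: "B \<in> polys L" "B \<noteq> 0"
  shows "gauss (A * B) = gauss A + gauss B"
proof (rule antisym)
  show "gauss A + gauss B \<le> gauss (A * B)"
  proof (rule gauss_ge)
    fix k assume nz: "coeff (A * B) k \<noteq> 0"
    have "coeff (A * B) k \<in> atleast (gauss A + gauss B)"
      unfolding coeff_mult using gauss_coeff_atleast A B by (intro atleast_sum atleast_mult) auto
    then show "gauss A + gauss B \<le> w (coeff (A * B) k)" using nz atleastD by blast
  qed (use A B in simp)
  define PA where "PA j \<longleftrightarrow> coeff A j \<noteq> 0 \<and> w (coeff A j) = gauss A" for j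
  define PB where "PB j \<longleftrightarrow> coeff B j \<noteq> 0 \<and> w (coeff B j) = gauss B" for j
  define a where "a = (LEAST j. PA j)"
  define b where "b = (LEAST j. PB j)"
  have "\<exists>j. PA j" using gauss_attained[OF A(2)] by (metis PA_def)
  then have a: "PA a" unfolding a_def by (rule LeastI_ex)
  have "\<exists>j. PB j" using gauss_attained[OF B(2)] by (metis PB_def)
  then have b: "PB b" unfolding b_def by (rule LeastI_ex)
  have la: "w (coeff A j) > gauss A" if "j < a" "coeff A j \<noteq> 0" for j
  proof -
    have "\<not> PA j" using not_less_Least[of j PA] that(1) by (simp add: a_def)
    then show ?thesis using gauss_le[OF that(2)] that(2) by (auto simp: PA_def)
  qed
  have lb: "w (coeff B j) > gauss B" if "j < b" "coeff B j \<noteq> 0" for j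
  proof -
    have "\<not> PB j" using not_less_Least[of j PB] that(1) by (simp add: b_def)
    then show ?thesis using gauss_le[OF that(2)] that(2) by (auto simp: PB_def)
  qed
  define rest where "rest = (\<Sum>i\<in>{..a + b} - {a}. coeff A i * coeff B (a + b - i))"
  define main where "main = coeff A a * coeff B b"
  have main: "main \<in> L" "main \<noteq> 0" "w main = gauss A + gauss B"
    using a b A B by (auto simp: main_def PA_def PB_def w_mult coeff_polys mult_mem)
  have split: "coeff (A * B) (a + b) = main + rest"
    unfolding coeff_mult main_def rest_def by (subst sum.remove[of _ a]) auto
  have termL: "coeff A i * coeff B j \<in> L" for i j using A B by (intro mult_mem coeff_polys)
  have big: "w (coeff A i * coeff B (a + b - i)) > gauss A + gauss B"
    if i: "i \<in> {..a + b} - {a}" and nz: "coeff A i * coeff B (a + b - i) \<noteq> 0" for i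
  proof -
    have nz': "coeff A i \<noteq> 0" "coeff B (a + b - i) \<noteq> 0" using nz by auto
    have w: "w (coeff A i * coeff B (a + b - i)) = w (coeff A i) + w (coeff B (a + b - i))"
      using nz' A B by (simp add: w_mult coeff_polys)
    show ?thesis
    proof (cases "i < a")
      case True
      then show ?thesis unfolding w using la[OF True nz'(1)] gauss_le[OF nz'(2)] by linarith
    next
      case False
      then have "a + b - i < b" using i by auto
      then show ?thesis unfolding w using lb[OF _ nz'(2)] gauss_le[OF nz'(1)] by fastforce
    qed
  qed
  \<comment> \<open>Strictness is essential: the remaining terms must lie strictly above the main
    one for \<open>w_add_eq\<close> to give the exact value.\<close>
  have sumbig: "sum f I \<noteq> 0 \<Longrightarrow> w (sum f I) > c"
    if "finite I" "\<And>i. i \<in> I \<Longrightarrow> f i \<in> L" "\<And>i. i \<in> I \<Longrightarrow> f i \<noteq> 0 \<Longrightarrow> w (f i) > c" for f and I :: "nat set" and c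
    using that
  proof (induction I)
    case (insert i I)
    show ?case
    proof (cases "f i = 0 \<or> sum f I = 0")
      case False
      have s: "sum f I \<in> L" using insert.prems by (intro sum_mem) auto
      have "f i + sum f I \<noteq> 0" using insert by simp
      then have "w (f i + sum f I) \<ge> min (w (f i)) (w (sum f I))" using insert.prems(2) s False by (intro w_add) auto
      moreover have "w (f i) > c" "w (sum f I) > c" using insert False by auto
      ultimately show ?thesis using insert.hyps by simp
    qed (use insert in auto)
  qed simp
  have "coeff (A * B) (a + b) \<noteq> 0 \<and> w (coeff (A * B) (a + b)) = gauss A + gauss B"
  proof (cases "rest = 0")
    case False
    have restL: "rest \<in> L" unfolding rest_def by (intro sum_mem termL)
    have "w rest > gauss A + gauss B" using False unfolding rest_def
      by (intro sumbig termL big) auto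
    then show ?thesis unfolding split using w_add_eq[OF main(1,2) restL False] main(3) by simp
  qed (use split main in simp)
  then show "gauss (A * B) \<le> gauss A + gauss B" using gauss_le by metis
qed

end

section \<open>Rational functions in a transcendental element\<close>

locale transcendental_extension = subfield_set L for L :: "'b::field set" +
  fixes t :: 'b
  assumes transcendental: "t \<notin> algebraic_over L"
begin

lemma eval_eq_0_iff: "A \<in> polys L \<Longrightarrow> poly A t = 0 \<longleftrightarrow> A = 0"
  using transcendental by (auto simp: algebraic_over_def)

lemma eval_inj: "A \<in> polys L \<Longrightarrow> B \<in> polys L \<Longrightarrow> poly A t = poly B t \<longleftrightarrow> A = B"
  using eval_eq_0_iff[of "A - B"] by auto

definition M :: "'b set" where
  "M = {poly A t / poly B t |A B. A \<in> polys L \<and> B \<in> polys L \<and> B \<noteq> 0}"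

lemma MI: "A \<in> polys L \<Longrightarrow> B \<in> polys L \<Longrightarrow> B \<noteq> 0 \<Longrightarrow> poly A t / poly B t \<in> M"
  by (auto simp: M_def)

lemma ME:
  assumes "x \<in> M"
  obtains A B where "A \<in> polys L" "B \<in> polys L" "B \<noteq> 0" "x = poly A t / poly B t"
  using assms by (auto simp: M_def)

lemma eval_M: "A \<in> polys L \<Longrightarrow> poly A t \<in> M"
  using MI[of A 1] by simp

lemma base_M: "L \<subseteq> M"
proof
  fix x assume "x \<in> L"
  then show "x \<in> M" using eval_M[of "[:x:]"] by (simp add: pCons_polys_iff)
qed

lemma generator_M: "t \<in> M"
  using eval_M[of "[:0, 1:]"] by (simp add: pCons_polys_iff)

lemma subfield_M: "subfield_set M"
proof
  show "0 \<in> M" "1 \<in> M" using base_M by auto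
  fix x assume "x \<in> M"
  then obtain A B where AB: "A \<in> polys L" "B \<in> polys L" "B \<noteq> 0" "x = poly A t / poly B t" by (rule ME)
  have B0: "poly B t \<noteq> 0" using AB eval_eq_0_iff by simp
  have "poly (- A) t / poly B t \<in> M" using AB by (intro MI polys_uminus)
  then show "- x \<in> M" using AB by simp
  show "inverse x \<in> M"
  proof (cases "A = 0")
    case False
    then have "poly B t / poly A t \<in> M" using AB by (intro MI)
    then show ?thesis using AB by simp
  qed (use AB base_M in auto)
  fix y assume "y \<in> M"
  then obtain A' B' where AB': "A' \<in> polys L" "B' \<in> polys L" "B' \<noteq> 0" "y = poly A' t / poly B' t" by (rule ME)
  have B0': "poly B' t \<noteq> 0" using AB' eval_eq_0_iff by simp
  have "poly (A * B' + A' * B) t / poly (B * B') t \<in> M" using AB AB' by (intro MI polys_add polys_mult) auto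
  then show "x + y \<in> M" using AB AB' B0 B0' by (simp add: add_frac_eq)
  have "poly (A * A') t / poly (B * B') t \<in> M" using AB AB' by (intro MI polys_mult) auto
  then show "x * y \<in> M" using AB AB' by simp
qed

sublocale M: subfield_set M
  by (rule subfield_M)

text \<open>The passage from an order on polynomials to one on fractions. The description is
  meaningful for orders with \<open>poly_valuation\<close>, for which \<open>fval_eq\<close> shows
  independence of the fraction.\<close>

definition fval :: "('b poly \<Rightarrow> real) \<Rightarrow> 'b \<Rightarrow> real" where
  "fval ord x = (THE r. \<exists>A B. A \<in> polys L \<and> A \<noteq> 0 \<and> B \<in> polys L \<and> B \<noteq> 0 \<and>
     x = poly A t / poly B t \<and> r = ord A - ord B)"

definition poly_valuation :: "('b poly \<Rightarrow> real) \<Rightarrow> bool" where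
  "poly_valuation ord \<longleftrightarrow>
    (\<forall>A\<in>polys L. \<forall>B\<in>polys L. A \<noteq> 0 \<longrightarrow> B \<noteq> 0 \<longrightarrow> ord (A * B) = ord A + ord B) \<and>
    (\<forall>A\<in>polys L. \<forall>B\<in>polys L. A \<noteq> 0 \<longrightarrow> B \<noteq> 0 \<longrightarrow> A + B \<noteq> 0 \<longrightarrow> ord (A + B) \<ge> min (ord A) (ord B))"

lemma fval_eq:
  assumes ord: "poly_valuation ord" and A: "A \<in> polys L" "A \<noteq> 0" and B: "B \<in> polys L" "B \<noteq> 0"
  shows "fval ord (poly A t / poly B t) = ord A - ord B"
  unfolding fval_def
proof (rule the_equality)
  fix r assume "\<exists>A' B'. A' \<in> polys L \<and> A' \<noteq> 0 \<and> B' \<in> polys L \<and> B' \<noteq> 0 \<and>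
     poly A t / poly B t = poly A' t / poly B' t \<and> r = ord A' - ord B'"
  then obtain A' B' where AB': "A' \<in> polys L" "A' \<noteq> 0" "B' \<in> polys L" "B' \<noteq> 0"
    "poly A t / poly B t = poly A' t / poly B' t" and r: "r = ord A' - ord B'" by blast
  have "poly B t \<noteq> 0" "poly B' t \<noteq> 0" using B AB' eval_eq_0_iff by auto
  then have "poly (A * B') t = poly (A' * B) t" using AB'(5) by (simp add: frac_eq_eq)
  then have "A * B' = A' * B"
    using eval_inj[OF polys_mult[OF A(1) AB'(3)] polys_mult[OF AB'(1) B(1)]] by blast
  then have "ord A + ord B' = ord A' + ord B" using ord A B AB' unfolding poly_valuation_def by metis
  then show "r = ord A - ord B" using r by simp
qed (use A B in blast)

lemma ord_1: "poly_valuation ord \<Longrightarrow> ord 1 = 0"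
  unfolding poly_valuation_def by (metis add_cancel_right_right mult_1 one_neq_zero polys_1)

lemma fval_eval:
  assumes "poly_valuation ord" "A \<in> polys L" "A \<noteq> 0"
  shows "fval ord (poly A t) = ord A"
  using fval_eq[OF assms, of 1] ord_1[OF assms(1)] by simp

lemma ME_nz:
  assumes "x \<in> M" "x \<noteq> 0"
  obtains A B where "A \<in> polys L" "A \<noteq> 0" "B \<in> polys L" "B \<noteq> 0" "x = poly A t / poly B t"
proof -
  obtain A B where AB: "A \<in> polys L" "B \<in> polys L" "B \<noteq> 0" "x = poly A t / poly B t" using assms(1) by (rule ME)
  then have "A \<noteq> 0" using assms(2) by (metis div_0 poly_0)
  then show ?thesis using that AB by blast
qed

lemma valued_fval:
  assumes ord: "poly_valuation ord"
  shows "valued_field M (fval ord)"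
proof unfold_locales
  fix x y assume "x \<in> M" "x \<noteq> 0" and "y \<in> M" "y \<noteq> 0"
  obtain A B where AB: "A \<in> polys L" "A \<noteq> 0" "B \<in> polys L" "B \<noteq> 0" "x = poly A t / poly B t"
    using \<open>x \<in> M\<close> \<open>x \<noteq> 0\<close> by (rule ME_nz)
  obtain A' B' where AB': "A' \<in> polys L" "A' \<noteq> 0" "B' \<in> polys L" "B' \<noteq> 0" "y = poly A' t / poly B' t"
    using \<open>y \<in> M\<close> \<open>y \<noteq> 0\<close> by (rule ME_nz)
  have mult: "ord (F * G) = ord F + ord G" if "F \<in> polys L" "F \<noteq> 0" "G \<in> polys L" "G \<noteq> 0" for F G
    using ord that unfolding poly_valuation_def by blast
  have vx: "fval ord x = ord A - ord B" and vy: "fval ord y = ord A' - ord B'"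
    using fval_eq[OF ord] AB AB' by auto
  have "x * y = poly (A * A') t / poly (B * B') t" using AB AB' by simp
  then have "fval ord (x * y) = ord (A * A') - ord (B * B')"
    using fval_eq[OF ord, of "A * A'" "B * B'"] AB AB' by (simp add: polys_mult)
  then show "fval ord (x * y) = fval ord x + fval ord y" using vx vy AB AB' by (simp add: mult)
  assume nz: "x + y \<noteq> 0"
  have "poly B t \<noteq> 0" "poly B' t \<noteq> 0" using AB AB' eval_eq_0_iff by auto
  then have sum: "x + y = poly (A * B' + A' * B) t / poly (B * B') t" using AB AB' by (simp add: add_frac_eq)
  then have N0: "A * B' + A' * B \<noteq> 0" using nz by (metis div_0 poly_0)
  have "fval ord (x + y) = ord (A * B' + A' * B) - ord (B * B')"
    using fval_eq[OF ord, of "A * B' + A' * B" "B * B'"] AB AB' N0 sum by (simp add: polys_mult polys_add)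
  moreover have "ord (A * B' + A' * B) \<ge> min (ord (A * B')) (ord (A' * B))"
    using ord AB AB' N0 unfolding poly_valuation_def by (meson no_zero_divisors polys_mult)
  ultimately show "fval ord (x + y) \<ge> min (fval ord x) (fval ord y)"
    using vx vy AB AB' by (simp add: mult)
qed

definition poly_derivation :: "('b poly \<Rightarrow> 'b poly) \<Rightarrow> bool" where
  "poly_derivation \<delta> \<longleftrightarrow> (\<forall>A\<in>polys L. \<delta> A \<in> polys L) \<and>
     (\<forall>A\<in>polys L. \<forall>B\<in>polys L. \<delta> (A + B) = \<delta> A + \<delta> B) \<and>
     (\<forall>A\<in>polys L. \<forall>B\<in>polys L. \<delta> (A * B) = \<delta> A * B + A * \<delta> B)"

lemma poly_derivationD:
  assumes "poly_derivation \<delta>" "A \<in> polys L"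
  shows "\<delta> A \<in> polys L" "B \<in> polys L \<Longrightarrow> \<delta> (A + B) = \<delta> A + \<delta> B"
    "B \<in> polys L \<Longrightarrow> \<delta> (A * B) = \<delta> A * B + A * \<delta> B"
  using assms by (auto simp: poly_derivation_def)

text \<open>The quotient rule taken as a definition; \<open>fderiv_eq\<close> shows that it does not
  depend on the fraction.\<close>

definition fderiv :: "('b poly \<Rightarrow> 'b poly) \<Rightarrow> 'b \<Rightarrow> 'b" where
  "fderiv \<delta> x = (THE y. \<exists>A B. A \<in> polys L \<and> B \<in> polys L \<and> B \<noteq> 0 \<and> x = poly A t / poly B t \<and>
     y = poly (\<delta> A * B - A * \<delta> B) t / poly (B * B) t)"

lemma fderiv_eq:
  assumes \<delta>: "poly_derivation \<delta>" and A: "A \<in> polys L" and B: "B \<in> polys L" "B \<noteq> 0"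
  shows "fderiv \<delta> (poly A t / poly B t) = poly (\<delta> A * B - A * \<delta> B) t / poly (B * B) t"
  unfolding fderiv_def
proof (rule the_equality)
  fix y assume "\<exists>A' B'. A' \<in> polys L \<and> B' \<in> polys L \<and> B' \<noteq> 0 \<and>
     poly A t / poly B t = poly A' t / poly B' t \<and> y = poly (\<delta> A' * B' - A' * \<delta> B') t / poly (B' * B') t"
  then obtain A' B' where AB': "A' \<in> polys L" "B' \<in> polys L" "B' \<noteq> 0"
    "poly A t / poly B t = poly A' t / poly B' t" and y: "y = poly (\<delta> A' * B' - A' * \<delta> B') t / poly (B' * B') t" by blast
  have nz: "poly B t \<noteq> 0" "poly B' t \<noteq> 0" using B AB' eval_eq_0_iff by auto
  then have "poly (A * B') t = poly (A' * B) t" using AB'(4) by (simp add: frac_eq_eq)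
  then have eq: "A * B' = A' * B"
    using eval_inj[OF polys_mult[OF A AB'(2)] polys_mult[OF AB'(1) B(1)]] by blast
  then have "\<delta> (A * B') = \<delta> (A' * B)" by simp
  then have d: "\<delta> A * B' + A * \<delta> B' = \<delta> A' * B + A' * \<delta> B" using poly_derivationD[OF \<delta>] A B AB' by simp
  \<comment> \<open>The cross-multiplied form of the claim, obtained by combining A B' = A' B with
    its derivative.\<close>
  have "(\<delta> A * B - A * \<delta> B) * (B' * B') = (\<delta> A' * B' - A' * \<delta> B') * (B * B)"
  proof -
    have "(\<delta> A * B - A * \<delta> B) * (B' * B') = (\<delta> A * B') * (B * B') - (A * B') * (\<delta> B * B')" by (simp add: algebra_simps)
    also have "\<delta> A * B' = \<delta> A' * B + A' * \<delta> B - A * \<delta> B'" using d by (simp add: algebra_simps)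
    also have "(\<delta> A' * B + A' * \<delta> B - A * \<delta> B') * (B * B') - (A * B') * (\<delta> B * B') =
      (\<delta> A' * B + A' * \<delta> B) * (B * B') - (A * B') * (B * \<delta> B') - (A * B') * (\<delta> B * B')" by (simp add: algebra_simps)
    also have "\<dots> = (\<delta> A' * B' - A' * \<delta> B') * (B * B)" unfolding eq by (simp add: algebra_simps)
    finally show ?thesis .
  qed
  then have "poly (\<delta> A * B - A * \<delta> B) t * poly (B' * B') t = poly (\<delta> A' * B' - A' * \<delta> B') t * poly (B * B) t"
    by (metis poly_mult)
  then show "y = poly (\<delta> A * B - A * \<delta> B) t / poly (B * B) t" using nz unfolding y by (simp add: frac_eq_eq)
qed (use A B in blast)

lemma fderiv_eval:
  assumes "poly_derivation \<delta>" "A \<in> polys L"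
  shows "fderiv \<delta> (poly A t) = poly (\<delta> A) t"
proof -
  have "\<delta> 1 = 0" using poly_derivationD(3)[OF assms(1), of 1 1]
    by (metis add_cancel_right_right mult.right_neutral mult_1 polys_1)
  then show ?thesis using fderiv_eq[OF assms, of 1] by simp
qed

lemma derivation_fderiv:
  assumes \<delta>: "poly_derivation \<delta>"
  shows "derivation M (fderiv \<delta>)"
proof unfold_locales
  note D = poly_derivationD[OF \<delta>]
  fix x assume "x \<in> M"
  then obtain A B where AB: "A \<in> polys L" "B \<in> polys L" "B \<noteq> 0" "x = poly A t / poly B t" by (rule ME)
  have B0: "poly B t \<noteq> 0" using AB eval_eq_0_iff by simp
  have dx: "fderiv \<delta> x = poly (\<delta> A * B - A * \<delta> B) t / poly (B * B) t" using AB fderiv_eq[OF \<delta>] by simp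
  show "fderiv \<delta> x \<in> M" unfolding dx using AB by (intro MI polys_mult polys_diff D(1)) simp_all
  fix y assume "y \<in> M"
  then obtain A' B' where AB': "A' \<in> polys L" "B' \<in> polys L" "B' \<noteq> 0" "y = poly A' t / poly B' t" by (rule ME)
  have B0': "poly B' t \<noteq> 0" using AB' eval_eq_0_iff by simp
  have dy: "fderiv \<delta> y = poly (\<delta> A' * B' - A' * \<delta> B') t / poly (B' * B') t" using AB' fderiv_eq[OF \<delta>] by simp
  define a b a' b' da db da' db' where defs: "a = poly A t" "b = poly B t" "a' = poly A' t" "b' = poly B' t"
    "da = poly (\<delta> A) t" "db = poly (\<delta> B) t" "da' = poly (\<delta> A') t" "db' = poly (\<delta> B') t"
  have nz: "b \<noteq> 0" "b' \<noteq> 0" using B0 B0' defs by auto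
  have dx': "fderiv \<delta> x = (da * b - a * db) / (b * b)" and dy': "fderiv \<delta> y = (da' * b' - a' * db') / (b' * b')"
    unfolding dx dy by (simp_all add: defs)
  have "x + y = poly (A * B' + A' * B) t / poly (B * B') t" using AB AB' B0 B0' by (simp add: add_frac_eq)
  then have "fderiv \<delta> (x + y) = poly (\<delta> (A * B' + A' * B) * (B * B') - (A * B' + A' * B) * \<delta> (B * B')) t / poly ((B * B') * (B * B')) t"
    using AB AB' fderiv_eq[OF \<delta>, of "A * B' + A' * B" "B * B'"] by (simp add: polys_add polys_mult)
  also have "\<dots> = ((da * b' + a * db' + (da' * b + a' * db)) * (b * b') - (a * b' + a' * b) * (db * b' + b * db')) / ((b * b') * (b * b'))"
    using AB AB' by (simp add: D polys_mult defs)
  also have "\<dots> = ((da * b - a * db) * (b' * b') + (da' * b' - a' * db') * (b * b)) / ((b * b) * (b' * b'))"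
    by (intro arg_cong2[of _ _ _ _ "(/)"]) (simp_all add: algebra_simps)
  also have "\<dots> = (da * b - a * db) / (b * b) + (da' * b' - a' * db') / (b' * b')"
    using nz by (intro add_frac_eq[symmetric]) auto
  finally show "fderiv \<delta> (x + y) = fderiv \<delta> x + fderiv \<delta> y" using dx' dy' by simp
  have "x * y = poly (A * A') t / poly (B * B') t" using AB AB' by simp
  then have "fderiv \<delta> (x * y) = poly (\<delta> (A * A') * (B * B') - (A * A') * \<delta> (B * B')) t / poly ((B * B') * (B * B')) t"
    using AB AB' fderiv_eq[OF \<delta>, of "A * A'" "B * B'"] by (simp add: polys_mult)
  also have "\<dots> = ((da * a' + a * da') * (b * b') - (a * a') * (db * b' + b * db')) / ((b * b') * (b * b'))"
    using AB AB' by (simp add: D polys_mult defs)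
  also have "\<dots> = ((da * b - a * db) * (a' * b') + (a * b) * (da' * b' - a' * db')) / ((b * b) * (b' * b'))"
    by (intro arg_cong2[of _ _ _ _ "(/)"]) (simp_all add: algebra_simps)
  also have "\<dots> = (da * b - a * db) / (b * b) * (a' / b') + (a / b) * ((da' * b' - a' * db') / (b' * b'))"
    unfolding add_divide_distrib by (intro arg_cong2[of _ _ _ _ "(+)"]; simp add: nz)
  finally show "fderiv \<delta> (x * y) = fderiv \<delta> x * y + x * fderiv \<delta> y" using dx' dy' AB AB' by (simp add: defs)
qed

text \<open>A representation without denominator of positive order suffices to bound the derivative.\<close>

lemma fderiv_bound:
  assumes ord: "poly_valuation ord" and \<delta>: "poly_derivation \<delta>"
    and A: "A \<in> polys L" "A \<noteq> 0" "ord A \<ge> 0" and B: "B \<in> polys L" "B \<noteq> 0" "ord B = 0"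
    and \<delta>_ge: "\<And>A. A \<in> polys L \<Longrightarrow> A \<noteq> 0 \<Longrightarrow> ord A \<ge> 0 \<Longrightarrow> \<delta> A \<noteq> 0 \<Longrightarrow> ord (\<delta> A) \<ge> 0"
    and nz: "fderiv \<delta> (poly A t / poly B t) \<noteq> 0"
  shows "fval ord (fderiv \<delta> (poly A t / poly B t)) \<ge> 0"
proof -
  define N where "N = \<delta> A * B - A * \<delta> B"
  have N: "N \<in> polys L" unfolding N_def using A B poly_derivationD(1)[OF \<delta>] by (intro polys_diff polys_mult) auto
  have eq: "fderiv \<delta> (poly A t / poly B t) = poly N t / poly (B * B) t" unfolding N_def using A B by (intro fderiv_eq \<delta>)
  then have N0: "N \<noteq> 0" using nz by (metis div_0 poly_0)
  have mult: "ord (F * G) = ord F + ord G" if "F \<in> polys L" "F \<noteq> 0" "G \<in> polys L" "G \<noteq> 0" for F G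
    using ord that unfolding poly_valuation_def by blast
  have "fval ord (fderiv \<delta> (poly A t / poly B t)) = ord N - ord (B * B)"
    unfolding eq using N N0 B by (intro fval_eq ord polys_mult) auto
  moreover have "ord (B * B) = 0" using B by (simp add: mult)
  moreover have "ord N \<ge> 0"
  proof -
    have 1: "ord (\<delta> A * B) \<ge> 0" if "\<delta> A * B \<noteq> 0"
      using that A B \<delta>_ge[OF A] poly_derivationD(1)[OF \<delta> A(1)] by (simp add: mult)
    have 2: "ord (A * (- \<delta> B)) \<ge> 0" if "A * (- \<delta> B) \<noteq> 0"
    proof -
      have "ord ((- 1) * (- 1)) = ord (- 1) + ord (- 1)" by (intro mult) auto
      then have "ord (- 1) = 0" using ord_1[OF ord] by simp
      then have "ord (- \<delta> B) = ord (\<delta> B)" using mult[of "- 1" "\<delta> B"] that poly_derivationD(1)[OF \<delta> B(1)] by auto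
      moreover have "ord (\<delta> B) \<ge> 0" using \<delta>_ge[of B] B that by auto
      ultimately show ?thesis using that A poly_derivationD(1)[OF \<delta> B(1)] by (simp add: mult polys_uminus del: mult_minus_right)
    qed
    have N_eq: "N = \<delta> A * B + A * (- \<delta> B)" by (simp add: N_def)
    show ?thesis
    proof (cases "\<delta> A * B = 0 \<or> A * (- \<delta> B) = 0")
      case True
      then show ?thesis using 1 2 N0 unfolding N_eq by auto
    next
      case False
      then have "ord N \<ge> min (ord (\<delta> A * B)) (ord (A * (- \<delta> B)))"
        using ord N0 A B poly_derivationD(1)[OF \<delta>] unfolding N_eq poly_valuation_def
        by (meson polys_mult polys_uminus)
      then show ?thesis using 1 2 False by linarith
    qed
  qed
  ultimately show ?thesis by simp
qed

end

lemma fsum_insert: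
  assumes "a \<notin> V" "finite {i \<in> V. f i \<noteq> 0}"
  shows "fsum f (insert a V) = f a + fsum f V"
proof -
  have "{i \<in> insert a V. f i \<noteq> 0} = (if f a = 0 then {} else {a}) \<union> {i \<in> V. f i \<noteq> 0}" by auto
  then show ?thesis using assms by (simp add: fsum_def)
qed

lemma finite_polys_bounded:
  fixes Z :: "'b::zero set"
  assumes "finite Z"
  shows "finite {A. degree A \<le> N \<and> (\<forall>j. coeff A j \<in> Z)}"
proof (rule finite_imageD)
  let ?f = "\<lambda>A. restrict (coeff A) {..N}"
  have sub: "?f ` {A. degree A \<le> N \<and> (\<forall>j. coeff A j \<in> Z)} \<subseteq> PiE {..N} (\<lambda>_. Z)"
    by (rule image_subsetI) (simp add: restrict_PiE_iff)
  have "finite (PiE {..N} (\<lambda>_. Z))" using assms by (intro finite_PiE) auto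
  then show "finite (?f ` {A. degree A \<le> N \<and> (\<forall>j. coeff A j \<in> Z)})" by (rule finite_subset[OF sub])
  show "inj_on ?f {A. degree A \<le> N \<and> (\<forall>j. coeff A j \<in> Z)}"
  proof (rule inj_onI)
    fix A B :: "'b poly" assume *: "A \<in> {A. degree A \<le> N \<and> (\<forall>j. coeff A j \<in> Z)}"
      "B \<in> {A. degree A \<le> N \<and> (\<forall>j. coeff A j \<in> Z)}" "?f A = ?f B"
    show "A = B"
    proof (rule poly_eqI)
      fix j
      show "coeff A j = coeff B j"
      proof (cases "j \<le> N")
        case True
        then show ?thesis using fun_cong[OF *(3), of j] by simp
      next
        case False
        then show ?thesis using * by (simp add: coeff_eq_0)
      qed
    qed
  qed
qed

text \<open>Iterated rational function fields have integral values, uniformizers and integral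
  derivations at every place, those of S included. The induction needs this, because all places of L
  reappear through their Gauss extensions. Places in S differ only in that a derivation turning a
  uniformizer into a unit is not demanded.\<close>

locale rational_field = product_formula_field L V d v S Ds
  for L :: "'b::field set" and V :: "'i set" and d v S Ds +
  assumes all_int: "i \<in> V \<Longrightarrow> x \<in> L \<Longrightarrow> x \<noteq> 0 \<Longrightarrow> v i x \<in> \<int>"
    and all_uniformizer: "i \<in> V \<Longrightarrow> \<exists>u\<in>L. u \<noteq> 0 \<and> v i u = 1"
    and all_deriv: "i \<in> V \<Longrightarrow> D \<in> Ds \<Longrightarrow> x \<in> L \<Longrightarrow> x \<noteq> 0 \<Longrightarrow> v i x \<ge> 0 \<Longrightarrow> D x \<noteq> 0 \<Longrightarrow> v i (D x) \<ge> 0"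

section \<open>Places of a rational function field\<close>

locale rational_extension = rational_field L V d v S Ds + transcendental_extension L t
  for L :: "'b::field set" and V :: "'i set" and d v S Ds t
begin

abbreviation gv :: "'i \<Rightarrow> 'b poly \<Rightarrow> real" where
  "gv i \<equiv> valued_field.gauss (v i)"

lemma gv_mult: "i \<in> V \<Longrightarrow> A \<in> polys L \<Longrightarrow> A \<noteq> 0 \<Longrightarrow> B \<in> polys L \<Longrightarrow> B \<noteq> 0 \<Longrightarrow> gv i (A * B) = gv i A + gv i B"
  by (rule valued_field.gauss_mult[OF valued])

lemma gv_le: "i \<in> V \<Longrightarrow> coeff A j \<noteq> 0 \<Longrightarrow> gv i A \<le> v i (coeff A j)"
  by (rule valued_field.gauss_le[OF valued])

lemma finite_gv:
  assumes A: "A \<in> polys L" "A \<noteq> 0"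
  shows "finite {i \<in> V. gv i A \<noteq> 0}"
proof -
  have "{i \<in> V. gv i A \<noteq> 0} \<subseteq> (\<Union>j\<in>{j. j \<le> degree A \<and> coeff A j \<noteq> 0}. {i \<in> V. v i (coeff A j) \<noteq> 0})"
  proof safe
    fix i assume i: "i \<in> V" "gv i A \<noteq> 0"
    obtain j where "coeff A j \<noteq> 0" "gv i A = v i (coeff A j)"
      using valued_field.gauss_attained[OF valued[OF i(1)] A(2)] by blast
    then show "i \<in> (\<Union>j\<in>{j. j \<le> degree A \<and> coeff A j \<noteq> 0}. {i \<in> V. v i (coeff A j) \<noteq> 0})"
      using i by (auto intro: le_degree)
  qed
  moreover have "finite \<dots>" using finite_support coeff_polys[OF A(1)] by auto
  ultimately show ?thesis by (rule finite_subset)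
qed

text \<open>The projective height of the coefficient vector. It is additive on products by Gauss's
  lemma and 0 on nonzero constants by the product formula of L.\<close>

definition poly_height :: "'b poly \<Rightarrow> real" where
  "poly_height A = fsum (\<lambda>i. d i * (- gv i A)) V"

lemma finite_d_gv:
  assumes "A \<in> polys L" "A \<noteq> 0"
  shows "finite {i \<in> V. d i * (- gv i A) \<noteq> 0}"
  by (rule finite_subset[OF _ finite_gv[OF assms]]) auto

lemma poly_height_mult:
  assumes "A \<in> polys L" "A \<noteq> 0" "B \<in> polys L" "B \<noteq> 0"
  shows "poly_height (A * B) = poly_height A + poly_height B"
proof -
  have "poly_height (A * B) = fsum (\<lambda>i. d i * (- gv i A) + d i * (- gv i B)) V"
    unfolding poly_height_def using assms by (intro fsum_cong) (simp add: gv_mult algebra_simps)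
  also have "\<dots> = poly_height A + poly_height B"
    unfolding poly_height_def using assms by (intro fsum_add finite_d_gv)
  finally show ?thesis .
qed

lemma poly_height_const:
  assumes "c \<in> L" "c \<noteq> 0"
  shows "poly_height [:c:] = 0"
proof -
  have "poly_height [:c:] = fsum (\<lambda>i. - (d i * v i c)) V"
    unfolding poly_height_def using assms by (intro fsum_cong) (simp add: valued_field.gauss_const[OF valued])
  then show ?thesis using product_formula[OF assms] by (simp add: fsum_minus)
qed

lemma gv_monic: "i \<in> V \<Longrightarrow> lead_coeff A = 1 \<Longrightarrow> gv i A \<le> 0"
  using gv_le[of i A "degree A"] valued_field.w_1[OF valued, of i] by simp

lemma poly_height_monic: "lead_coeff A = 1 \<Longrightarrow> poly_height A \<ge> 0"
  unfolding poly_height_def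
proof (rule fsum_nonneg)
  fix i assume "lead_coeff A = 1" "i \<in> V"
  then show "0 \<le> d i * (- gv i A)" using gv_monic[of i A] weight_pos[of i] by (simp add: mult_nonneg_nonpos less_imp_le)
qed

definition Irr :: "'b poly set" where
  "Irr = {P. irred_over L P}"

lemma zero_notin_Irr: "0 \<notin> Irr"
  using irred_overD(4) by (auto simp: Irr_def)

text \<open>Height and degree are both additive on products and vanish on constants, so they
  distribute over the irreducible factors. This is the product formula of L(t) for polynomials,
  before the place at infinity and the Gauss places are moved to the other side.\<close>

lemma degree_height_factorization:
  assumes "A \<in> polys L" "A \<noteq> 0"
  shows "finite {P \<in> Irr. pord P A \<noteq> 0} \<and>
    fsum (\<lambda>P. (poly_height P + real (degree P)) * real (pord P A)) Irr = poly_height A + real (degree A)"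
  using assms
proof (induction "degree A" arbitrary: A rule: less_induct)
  case less
  show ?case
  proof (cases "degree A = 0")
    case True
    then obtain c where c: "A = [:c:]" by (elim degree_eq_zeroE)
    have "pord P A = 0" if "P \<in> Irr" for P
    proof (rule ccontr)
      assume "pord P A \<noteq> 0"
      then have "P dvd A" using pord_pos_iff[of P A] irred_overD(3)[of L P] that less.prems by (auto simp: Irr_def)
      then have "degree P \<le> degree A" using less.prems by (intro dvd_imp_degree_le)
      then show False using True irred_overD(3)[of L P] that by (auto simp: Irr_def)
    qed
    then have 1: "fsum (\<lambda>P. (poly_height P + real (degree P)) * real (pord P A)) Irr = 0"
      and 2: "{P \<in> Irr. pord P A \<noteq> 0} = {}"
      by (auto simp: fsum_def intro!: sum.neutral)
    have "poly_height A = 0" using less.prems c poly_height_const[of c] by (auto simp: pCons_polys_iff)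
    then show ?thesis unfolding 1 2 using True by simp
  next
    case False
    then obtain Q where Q: "irred_over L Q" "Q dvd A" using exists_irred_factor[OF less.prems(1)] by blast
    note QL = irred_overD[OF Q(1)]
    define B where "B = A div Q"
    have A_eq: "A = Q * B" using Q(2) by (simp add: B_def)
    have B: "B \<in> polys L" "B \<noteq> 0"
      unfolding B_def using polys_div_mod(1)[OF less.prems(1) QL(1)] Q(2) less.prems(2) by auto
    have "degree A = degree Q + degree B" unfolding A_eq using QL B by (intro degree_mult_eq) auto
    then have IH: "finite {P \<in> Irr. pord P B \<noteq> 0}"
      "fsum (\<lambda>P. (poly_height P + real (degree P)) * real (pord P B)) Irr = poly_height B + real (degree B)"
      using less.hyps[OF _ B] QL(3) by auto
    have pord: "pord P A = (if P = Q then 1 else 0) + pord P B" if "P \<in> Irr" for P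
      unfolding A_eq using that pord_mult[of P Q B] pord_irred[of P Q] QL Q(1) B by (simp add: Irr_def)
    have fin: "finite {P \<in> Irr. pord P A \<noteq> 0}"
      by (rule finite_subset[OF _ finite.insertI[OF IH(1), of Q]]) (auto simp: pord)
    have "fsum (\<lambda>P. (poly_height P + real (degree P)) * real (pord P A)) Irr =
      fsum (\<lambda>P. (if P = Q then poly_height Q + real (degree Q) else 0) + (poly_height P + real (degree P)) * real (pord P B)) Irr"
      by (intro fsum_cong) (auto simp: pord algebra_simps)
    also have "\<dots> = fsum (\<lambda>P. if P = Q then poly_height Q + real (degree Q) else 0) Irr +
      fsum (\<lambda>P. (poly_height P + real (degree P)) * real (pord P B)) Irr"
    proof (rule fsum_add)
      show "finite {P \<in> Irr. (if P = Q then poly_height Q + real (degree Q) else 0) \<noteq> 0}"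
        by (rule finite_subset[of _ "{Q}"]) auto
      show "finite {P \<in> Irr. (poly_height P + real (degree P)) * real (pord P B) \<noteq> 0}"
        by (rule finite_subset[OF _ IH(1)]) auto
    qed
    also have "fsum (\<lambda>P. if P = Q then poly_height Q + real (degree Q) else 0) Irr = poly_height Q + real (degree Q)"
      using Q(1) by (subst fsum_eq[of "{Q}"]) (auto simp: Irr_def)
    also note IH(2)
    also have "poly_height Q + real (degree Q) + (poly_height B + real (degree B)) = poly_height A + real (degree A)"
      using poly_height_mult[OF QL(1,4) B] \<open>degree A = degree Q + degree B\<close> A_eq by simp
    finally show ?thesis using fin by simp
  qed
qed

text \<open>The Gauss extensions of the places of L are indispensable: the other places take the
  value 0 on all nonzero constants, so for infinite L the Northcott property would fail without
  them.\<close>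

definition V' :: "('i + 'b poly) set" where
  "V' = V <+> insert 0 Irr"

text \<open>The degree of P balances the place at infinity, its height the Gauss places. The degree
  also keeps the weight positive when the height is 0.\<close>

definition d' :: "'i + 'b poly \<Rightarrow> real" where
  "d' = case_sum d (\<lambda>P. if P = 0 then 1 else poly_height P + real (degree P))"

text \<open>The index \<open>Inr 0\<close> stands for the place at infinity.\<close>

definition ord' :: "'i + 'b poly \<Rightarrow> 'b poly \<Rightarrow> real" where
  "ord' = case_sum gv (\<lambda>P A. if P = 0 then - real (degree A) else real (pord P A))"

definition v' :: "'i + 'b poly \<Rightarrow> 'b \<Rightarrow> real" where
  "v' k = fval (ord' k)"

text \<open>Infinity is exceptional: coefficientwise derivations do not lower the order there and
  differentiation by t raises it, so no uniformizer becomes a unit.\<close>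

definition S' :: "('i + 'b poly) set" where
  "S' = insert (Inr 0) (Inl ` S)"

definition Ds' :: "('b \<Rightarrow> 'b) set" where
  "Ds' = insert (fderiv pderiv) ((\<lambda>D. fderiv (map_poly D)) ` Ds)"

lemma V'_mem: "i \<in> V \<Longrightarrow> Inl i \<in> V'" "irred_over L P \<Longrightarrow> Inr P \<in> V'" "Inr 0 \<in> V'"
  by (auto simp: V'_def Irr_def intro: InlI InrI)

lemma V'_cases:
  assumes "k \<in> V'"
  obtains (gauss) i where "k = Inl i" "i \<in> V" | (irred) P where "k = Inr P" "irred_over L P" "P \<noteq> 0" | (inf) "k = Inr 0"
proof (cases k)
  case (Inl i)
  then show ?thesis using assms that(1) by (auto simp: V'_def)
next
  case (Inr P)
  then have "P = 0 \<or> irred_over L P" using assms by (auto simp: V'_def Irr_def)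
  then show ?thesis using Inr that(2,3) irred_overD(4)[of L P] by blast
qed

lemma d'_pos: "k \<in> V' \<Longrightarrow> d' k > 0"
proof (erule V'_cases)
  fix P assume P: "k = Inr P" "irred_over L P" "P \<noteq> 0"
  then show "d' k > 0" using poly_height_monic[of P] irred_overD[OF P(2)] by (simp add: d'_def)
qed (auto simp: d'_def weight_pos)

lemma poly_valuation_ord': "k \<in> V' \<Longrightarrow> poly_valuation (ord' k)"
proof (erule V'_cases)
  fix i assume "k = Inl i" "i \<in> V"
  then show "poly_valuation (ord' k)"
    using gv_mult[of i] valued_field.gauss_add[OF valued, of i] by (auto simp: poly_valuation_def ord'_def)
next
  fix P assume P: "k = Inr P" "irred_over L P" "P \<noteq> 0"
  have "min (real (pord P A)) (real (pord P B)) \<le> real (pord P (A + B))"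
    if "A \<noteq> 0" "B \<noteq> 0" "A + B \<noteq> 0" for A B
    using pord_add[OF irred_overD(3)[OF P(2)] that] by simp
  then show "poly_valuation (ord' k)"
    using P pord_mult[OF P(2)] by (auto simp: poly_valuation_def ord'_def)
next
  assume k: "k = Inr 0"
  have "min (- real (degree A)) (- real (degree B)) \<le> - real (degree (A + B))" for A B :: "'b poly"
    using degree_add_le_max[of A B] by auto
  then show "poly_valuation (ord' k)" using k by (auto simp: poly_valuation_def ord'_def degree_mult_eq)
qed

lemma finite_ord':
  assumes A: "A \<in> polys L" "A \<noteq> 0"
  shows "finite {k \<in> V'. ord' k A \<noteq> 0}"
proof -
  have "{k \<in> V'. ord' k A \<noteq> 0} \<subseteq> Inl ` {i \<in> V. gv i A \<noteq> 0} \<union> Inr ` {P \<in> Irr. pord P A \<noteq> 0} \<union> {Inr 0}"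
    by (auto simp: V'_def ord'_def)
  then show ?thesis using finite_gv[OF A] degree_height_factorization[OF A]
    by (meson finite.emptyI finite.insertI finite_UnI finite_imageI finite_subset)
qed

lemma fsum_V':
  assumes "finite {i \<in> V. f (Inl i) \<noteq> 0}" "finite {P \<in> Irr. f (Inr P) \<noteq> 0}"
  shows "fsum f V' = fsum (\<lambda>i. f (Inl i)) V + (f (Inr 0) + fsum (\<lambda>P. f (Inr P)) Irr)"
proof -
  have "finite {P \<in> insert 0 Irr. f (Inr P) \<noteq> 0}"
    by (rule finite_subset[OF _ finite.insertI[OF assms(2), of 0]]) auto
  then show ?thesis unfolding V'_def
    using assms fsum_insert[OF zero_notin_Irr, of "\<lambda>P. f (Inr P)"] by (simp add: fsum_Plus)
qed

lemma product_formula_poly: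
  assumes A: "A \<in> polys L" "A \<noteq> 0"
  shows "fsum (\<lambda>k. d' k * ord' k A) V' = 0"
proof -
  note fac = degree_height_factorization[OF A]
  have "finite {i \<in> V. d' (Inl i) * ord' (Inl i) A \<noteq> 0}"
    by (rule finite_subset[OF _ finite_gv[OF A]]) (auto simp: ord'_def)
  moreover have "finite {P \<in> Irr. d' (Inr P) * ord' (Inr P) A \<noteq> 0}"
    using zero_notin_Irr by (intro finite_subset[OF _ conjunct1[OF fac]]) (auto simp: ord'_def)
  ultimately have "fsum (\<lambda>k. d' k * ord' k A) V' = fsum (\<lambda>i. d' (Inl i) * ord' (Inl i) A) V +
      (d' (Inr 0) * ord' (Inr 0) A + fsum (\<lambda>P. d' (Inr P) * ord' (Inr P) A) Irr)"
    by (rule fsum_V')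
  also have "fsum (\<lambda>i. d' (Inl i) * ord' (Inl i) A) V = - poly_height A"
    unfolding poly_height_def fsum_minus[symmetric] by (intro fsum_cong) (simp add: d'_def ord'_def)
  also have "fsum (\<lambda>P. d' (Inr P) * ord' (Inr P) A) Irr = poly_height A + real (degree A)"
    unfolding conjunct2[OF fac, symmetric] using zero_notin_Irr by (intro fsum_cong) (auto simp: d'_def ord'_def)
  finally show ?thesis by (simp add: d'_def ord'_def)
qed

lemma v'_eq:
  "k \<in> V' \<Longrightarrow> A \<in> polys L \<Longrightarrow> A \<noteq> 0 \<Longrightarrow> B \<in> polys L \<Longrightarrow> B \<noteq> 0 \<Longrightarrow> v' k (poly A t / poly B t) = ord' k A - ord' k B"
  unfolding v'_def by (intro fval_eq poly_valuation_ord')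

lemma v'_eval: "k \<in> V' \<Longrightarrow> A \<in> polys L \<Longrightarrow> A \<noteq> 0 \<Longrightarrow> v' k (poly A t) = ord' k A"
  unfolding v'_def by (intro fval_eval poly_valuation_ord')

lemma v'_support_formula:
  assumes "x \<in> M" "x \<noteq> 0"
  shows "finite {k \<in> V'. v' k x \<noteq> 0}" "fsum (\<lambda>k. d' k * v' k x) V' = 0"
proof -
  obtain A B where AB: "A \<in> polys L" "A \<noteq> 0" "B \<in> polys L" "B \<noteq> 0" "x = poly A t / poly B t"
    using assms by (rule ME_nz)
  have v: "v' k x = ord' k A - ord' k B" if "k \<in> V'" for k using that AB v'_eq by simp
  show "finite {k \<in> V'. v' k x \<noteq> 0}"
    by (rule finite_subset[OF _ finite_UnI[OF finite_ord'[OF AB(1,2)] finite_ord'[OF AB(3,4)]]]) (auto simp: v)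
  have f: "finite {k \<in> V'. c k * ord' k C \<noteq> 0}" if "C \<in> polys L" "C \<noteq> 0" for c C
    by (rule finite_subset[OF _ finite_ord'[OF that]]) auto
  have "fsum (\<lambda>k. d' k * v' k x) V' = fsum (\<lambda>k. d' k * ord' k A + (- d' k) * ord' k B) V'"
    by (intro fsum_cong) (simp add: v algebra_simps)
  also have "\<dots> = fsum (\<lambda>k. d' k * ord' k A) V' + fsum (\<lambda>k. (- d' k) * ord' k B) V'"
    by (intro fsum_add f AB)
  also have "fsum (\<lambda>k. (- d' k) * ord' k B) V' = - fsum (\<lambda>k. d' k * ord' k B) V'"
    by (subst fsum_minus[symmetric]) simp
  finally show "fsum (\<lambda>k. d' k * v' k x) V' = 0" using product_formula_poly AB by simp
qed

text \<open>A fraction whose denominator has least degree admits no common irreducible factor. In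
  this form the poles of x at irreducible polynomials are exactly the zeros of B.\<close>

lemma reduced_representation:
  assumes x: "x \<in> M" "x \<noteq> 0"
  obtains A B where "A \<in> polys L" "A \<noteq> 0" "B \<in> polys L" "B \<noteq> 0" "x = poly A t / poly B t"
    "lead_coeff B = 1" "\<And>P. irred_over L P \<Longrightarrow> \<not> (P dvd A \<and> P dvd B)"
proof -
  define Q where "Q n \<longleftrightarrow> (\<exists>A B. A \<in> polys L \<and> A \<noteq> 0 \<and> B \<in> polys L \<and> B \<noteq> 0 \<and> x = poly A t / poly B t \<and> degree B = n)" for n
  have "\<exists>n. Q n"
  proof -
    obtain A B where "A \<in> polys L" "A \<noteq> 0" "B \<in> polys L" "B \<noteq> 0" "x = poly A t / poly B t"
      using x by (rule ME_nz)
    then have "Q (degree B)" unfolding Q_def by blast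
    then show ?thesis by blast
  qed
  define n where "n = (LEAST n. Q n)"
  have "Q n" unfolding n_def using \<open>\<exists>n. Q n\<close> by (rule LeastI_ex)
  then obtain A B where AB: "A \<in> polys L" "A \<noteq> 0" "B \<in> polys L" "B \<noteq> 0" "x = poly A t / poly B t" "degree B = n"
    unfolding Q_def by blast
  define c where "c = inverse (lead_coeff B)"
  have c: "c \<in> L" "c \<noteq> 0" using AB by (auto simp: c_def inverse_mem coeff_polys)
  show ?thesis
  proof (rule that[of "smult c A" "smult c B"])
    show "smult c A \<in> polys L" "smult c A \<noteq> 0" "smult c B \<in> polys L" "smult c B \<noteq> 0" using AB c by auto
    show "x = poly (smult c A) t / poly (smult c B) t" using AB c by simp
    have "lead_coeff B \<noteq> 0" using AB(4) by simp
    then show "lead_coeff (smult c B) = 1" by (simp add: c_def)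
    fix P assume P: "irred_over L P"
    note PL = irred_overD[OF P]
    show "\<not> (P dvd smult c A \<and> P dvd smult c B)"
    proof
      assume "P dvd smult c A \<and> P dvd smult c B"
      then have d: "P dvd A" "P dvd B" using c by (auto simp: dvd_smult_iff)
      define A1 where "A1 = A div P"
      define B1 where "B1 = B div P"
      have eq: "A = P * A1" "B = P * B1" using d by (auto simp: A1_def B1_def)
      have 1: "A1 \<in> polys L" "B1 \<in> polys L" using polys_div_mod AB PL by (auto simp: A1_def B1_def)
      have nz: "A1 \<noteq> 0" "B1 \<noteq> 0" "poly P t \<noteq> 0" using eq AB PL eval_eq_0_iff by auto
      have "x = poly A1 t / poly B1 t" unfolding AB(5) unfolding eq using nz by simp
      then have "Q (degree B1)" using 1 nz(1,2) unfolding Q_def by blast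
      then have "n \<le> degree B1" unfolding n_def by (rule Least_le)
      moreover have "degree B = degree P + degree B1" unfolding eq using PL nz by (intro degree_mult_eq) auto
      ultimately show False using PL(3) AB(6) by simp
    qed
  qed
qed

text \<open>For a reduced fraction A/B with monic B the height is a sum of three nonnegative parts:
  the Gauss places, the pole at infinity max 0 (deg A - deg B), and the height plus degree of B.
  Together they bound the degrees of A and B and the heights of all their coefficients, so Northcott
  for L leaves finitely many A and B.\<close>

lemma northcott_rational:
  "finite {x \<in> M. x \<noteq> 0 \<and> fsum (\<lambda>k. d' k * max 0 (- v' k x)) V' \<le> B0}"
proof -
  define N where "N = nat \<lceil>2 * B0\<rceil>"
  define Z where "Z = insert 0 {c \<in> L. c \<noteq> 0 \<and> height c \<le> 2 * B0}"
  have finZ: "finite Z" unfolding Z_def using finite_height by simp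
  define Y where "Y = {A. degree A \<le> N \<and> (\<forall>j. coeff A j \<in> Z)}"
  have "finite Y" unfolding Y_def using finZ by (rule finite_polys_bounded)
  then have fin: "finite ((\<lambda>(A, B). poly A t / poly B t) ` (Y \<times> Y))" by simp
  have mem: "x \<in> (\<lambda>(A, B). poly A t / poly B t) ` (Y \<times> Y)"
    if x: "x \<in> M" "x \<noteq> 0" and h: "fsum (\<lambda>k. d' k * max 0 (- v' k x)) V' \<le> B0" for x
  proof -
    obtain A B where AB: "A \<in> polys L" "A \<noteq> 0" "B \<in> polys L" "B \<noteq> 0" "x = poly A t / poly B t"
      "lead_coeff B = 1" "\<And>P. irred_over L P \<Longrightarrow> \<not> (P dvd A \<and> P dvd B)"
      using x by (rule reduced_representation) blast
    have v: "v' k x = ord' k A - ord' k B" if "k \<in> V'" for k using that AB v'_eq by simp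
    define G where "G i = d i * max 0 (gv i B - gv i A)" for i
    have fG: "finite {i \<in> V. G i \<noteq> 0}"
      by (rule finite_subset[OF _ finite_UnI[OF finite_gv[OF AB(1,2)] finite_gv[OF AB(3,4)]]]) (auto simp: G_def)
    have G0: "G i \<ge> 0" if "i \<in> V" for i using weight_pos[OF that] by (simp add: G_def)
    have irr: "d' (Inr P) * max 0 (- v' (Inr P) x) = (poly_height P + real (degree P)) * real (pord P B)" if P: "P \<in> Irr" for P
    proof -
      have P': "irred_over L P" "degree P > 0" "P \<noteq> 0" using P irred_overD[of L P] by (auto simp: Irr_def)
      have "pord P A = 0 \<or> pord P B = 0" using AB(7)[OF P'(1)] pord_pos_iff[OF P'(2)] AB by blast
      then have "max 0 (- v' (Inr P) x) = real (pord P B)"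
      proof -
        have "Inr P \<in> V'" using P by (auto simp: V'_def intro: InrI)
        then show ?thesis using v \<open>pord P A = 0 \<or> pord P B = 0\<close> P' by (auto simp: ord'_def)
      qed
      then show ?thesis using P' by (simp add: d'_def)
    qed
    have "fsum (\<lambda>k. d' k * max 0 (- v' k x)) V' = fsum (\<lambda>i. d' (Inl i) * max 0 (- v' (Inl i) x)) V +
      (d' (Inr 0) * max 0 (- v' (Inr 0) x) + fsum (\<lambda>P. d' (Inr P) * max 0 (- v' (Inr P) x)) Irr)"
    proof (rule fsum_V')
      have fin': "finite {k \<in> V'. d' k * max 0 (- v' k x) \<noteq> 0}"
        by (rule finite_subset[OF _ v'_support_formula(1)[OF x]]) auto
      note fin = finite_vimageI[OF fin' inj_Inl] finite_vimageI[OF fin' inj_Inr]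
      show "finite {i \<in> V. d' (Inl i) * max 0 (- v' (Inl i) x) \<noteq> 0}"
        by (rule finite_subset[OF _ fin(1)]) (auto simp: V'_def)
      show "finite {P \<in> Irr. d' (Inr P) * max 0 (- v' (Inr P) x) \<noteq> 0}"
        by (rule finite_subset[OF _ fin(2)]) (auto simp: V'_def)
    qed
    also have "fsum (\<lambda>i. d' (Inl i) * max 0 (- v' (Inl i) x)) V = fsum G V"
      by (intro fsum_cong) (simp add: v V'_mem d'_def ord'_def G_def)
    also have "fsum (\<lambda>P. d' (Inr P) * max 0 (- v' (Inr P) x)) Irr = poly_height B + real (degree B)"
      unfolding conjunct2[OF degree_height_factorization[OF AB(3,4)], symmetric] by (intro fsum_cong irr)
    also have "d' (Inr 0) * max 0 (- v' (Inr 0) x) = max 0 (real (degree A) - real (degree B))"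
      by (simp add: v V'_mem d'_def ord'_def)
    finally have sum: "fsum G V + (max 0 (real (degree A) - real (degree B)) + (poly_height B + real (degree B))) \<le> B0"
      using h by simp
    have G_nonneg: "fsum G V \<ge> 0" using G0 by (rule fsum_nonneg)
    have hB: "poly_height B \<ge> 0" using AB(6) by (rule poly_height_monic)
    have deg: "real (degree A) \<le> 2 * B0" "real (degree B) \<le> 2 * B0" using sum G_nonneg hB by (auto simp: max_def split: if_splits)
    have degN: "degree A \<le> N" "degree B \<le> N" using deg unfolding N_def by linarith+
    have fB: "finite {i \<in> V. d i * (- gv i B) \<noteq> 0}" by (rule finite_d_gv[OF AB(3,4)])
    have fc: "finite {i \<in> V. d i * max 0 (- v i c) \<noteq> 0}" if "c \<in> L" "c \<noteq> 0" for c
      by (rule finite_subset[OF _ finite_support[OF that]]) auto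
    have coeffB: "coeff B j \<in> Z" for j
    proof (cases "coeff B j = 0")
      case False
      have "height (coeff B j) \<le> poly_height B"
        unfolding height_def poly_height_def
      proof (rule fsum_mono[OF fc[OF coeff_polys[OF AB(3)] False] fB])
        fix i assume i: "i \<in> V"
        have "max 0 (- v i (coeff B j)) \<le> - gv i B" using gv_le[OF i False] gv_monic[OF i AB(6)] by simp
        then show "d i * max 0 (- v i (coeff B j)) \<le> d i * (- gv i B)" using weight_pos[OF i] by (intro mult_left_mono) auto
      qed
      moreover have "poly_height B \<le> 2 * B0" using sum G_nonneg hB by linarith
      ultimately show ?thesis using False AB(3) by (auto simp: Z_def coeff_polys)
    qed (simp add: Z_def)
    have coeffA: "coeff A j \<in> Z" for j
    proof (cases "coeff A j = 0")
      case False
      have "height (coeff A j) \<le> fsum (\<lambda>i. d i * (- gv i B) + G i) V"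
        unfolding height_def
      proof (rule fsum_mono[OF fc[OF coeff_polys[OF AB(1)] False]])
        show "finite {i \<in> V. d i * (- gv i B) + G i \<noteq> 0}"
          by (rule finite_subset[OF _ finite_UnI[OF fB fG]]) auto
        fix i assume i: "i \<in> V"
        have "max 0 (- v i (coeff A j)) \<le> - gv i B + max 0 (gv i B - gv i A)"
          using gv_le[OF i False] gv_monic[OF i AB(6)] by linarith
        then have "d i * max 0 (- v i (coeff A j)) \<le> d i * (- gv i B + max 0 (gv i B - gv i A))"
          using weight_pos[OF i] by (intro mult_left_mono) auto
        then show "d i * max 0 (- v i (coeff A j)) \<le> d i * (- gv i B) + G i"
          unfolding G_def distrib_left .
      qed
      also have "\<dots> = poly_height B + fsum G V" unfolding poly_height_def by (rule fsum_add[OF fB fG])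
      also have "\<dots> \<le> 2 * B0" using sum G_nonneg hB by linarith
      finally show ?thesis using False AB(1) by (auto simp: Z_def coeff_polys)
    qed (simp add: Z_def)
    have "A \<in> Y" "B \<in> Y" using degN coeffA coeffB by (auto simp: Y_def)
    then show ?thesis using AB(5) by (intro image_eqI[of _ _ "(A, B)"]) auto
  qed
  show ?thesis
  proof (rule finite_subset[OF subsetI fin])
    fix x assume "x \<in> {x \<in> M. x \<noteq> 0 \<and> fsum (\<lambda>k. d' k * max 0 (- v' k x)) V' \<le> B0}"
    then show "x \<in> (\<lambda>(A, B). poly A t / poly B t) ` (Y \<times> Y)" using mem by blast
  qed
qed

end

context rational_extension
begin

lemma poly_derivation_pderiv: "poly_derivation pderiv"
  by (auto simp: poly_derivation_def pderiv_add pderiv_mult polys_pderiv algebra_simps)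

lemma poly_derivation_map: "D \<in> Ds \<Longrightarrow> poly_derivation (map_poly D)"
  using derivation.map_D_mem[OF deriv] derivation.map_D_add[OF deriv] derivation.map_D_mult[OF deriv]
  by (auto simp: poly_derivation_def)

lemma Ds'_cases:
  assumes "D' \<in> Ds'"
  obtains \<delta> where "D' = fderiv \<delta>" "poly_derivation \<delta>" "\<delta> = pderiv \<or> (\<exists>D\<in>Ds. \<delta> = map_poly D)"
  using assms poly_derivation_pderiv poly_derivation_map by (auto simp: Ds'_def)

text \<open>A vanishing derivative by t leaves only exponents divisible by p, and the
  coefficientwise derivations force each coefficient to be a p-th power in L. The Frobenius then
  reassembles A as a p-th power.\<close>

lemma poly_kernel:
  assumes A: "A \<in> polys L" and 1: "pderiv A = 0" and 2: "\<And>D. D \<in> Ds \<Longrightarrow> map_poly D A = 0"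
  shows "\<exists>B\<in>polys L. A = B ^ CHAR('b)"
proof -
  define p where "p = CHAR('b)"
  have p0: "p > 0" using char_pos by (simp add: p_def)
  have c0: "coeff A j = 0" if "\<not> p dvd j" for j
  proof (cases j)
    case (Suc k)
    have "of_nat (Suc k) * coeff A (Suc k) = 0" using arg_cong[OF 1, of "\<lambda>P. coeff P k"] by (simp add: coeff_pderiv)
    moreover have "(of_nat (Suc k) :: 'b) \<noteq> 0" using that Suc of_nat_eq_0_iff_char_dvd[where 'a = 'b] by (simp add: p_def del: of_nat_Suc)
    ultimately show ?thesis using Suc by simp
  qed (use that in simp)
  have D0: "D (coeff A j) = 0" if D: "D \<in> Ds" for D j
  proof -
    have "coeff (map_poly D A) j = D (coeff A j)" by (rule derivation.map_D_coeff[OF deriv[OF D]])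
    then show ?thesis using 2[OF D] by simp
  qed
  have ex: "\<exists>y\<in>L. coeff A j = y ^ p" for j unfolding p_def by (intro kernel coeff_polys A D0)
  then have "\<forall>j. \<exists>y. y \<in> L \<and> coeff A j = y ^ p" by blast
  from choice[OF this] obtain b where b: "\<And>j. b j \<in> L" "\<And>j. coeff A j = b j ^ p" by blast
  define B where "B = (\<Sum>k\<le>degree A. Polynomial.monom (b (p * k)) k)"
  have "B \<in> polys L" unfolding B_def by (intro polys_sum polys_monom b)
  moreover have "A = B ^ p"
  proof -
    have pc: "Factorial_Ring.prime CHAR('b poly)" using prime_char by simp
    have "B ^ p = (\<Sum>k\<le>degree A. Polynomial.monom (b (p * k)) k ^ p)"
      unfolding B_def by (rule freshmans_dream_sum[OF pc]) (simp add: p_def)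
    also have "\<dots> = (\<Sum>k\<le>degree A. Polynomial.monom (coeff A (p * k)) (p * k))"
      by (simp add: monom_power b(2) mult.commute)
    finally have BA: "B ^ p = (\<Sum>k\<le>degree A. Polynomial.monom (coeff A (p * k)) (p * k))" .
    show ?thesis
    proof (rule poly_eqI)
      fix j
      have *: "coeff (B ^ p) j = (\<Sum>k\<le>degree A. if p * k = j then coeff A (p * k) else 0)"
        by (simp add: BA coeff_sum)
      show "coeff A j = coeff (B ^ p) j"
      proof (cases "p dvd j \<and> j \<le> degree A")
        case True
        then obtain k where k: "j = p * k" by (elim conjE dvdE)
        have "k \<le> degree A" using True k p0 by (metis le_trans mult_le_mono1 nat_mult_1 Suc_leI One_nat_def)
        moreover have "(p * i = j) = (i = k)" for i using k p0 by simp
        ultimately show ?thesis unfolding * by (simp add: k)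
      next
        case False
        then have "coeff A j = 0" using c0[of j] by (auto simp: coeff_eq_0)
        moreover have "(\<Sum>k\<le>degree A. if p * k = j then coeff A (p * k) else 0) = 0"
          by (rule sum.neutral) (use \<open>coeff A j = 0\<close> in auto)
        ultimately show ?thesis unfolding * by simp
      qed
    qed
  qed
  ultimately show ?thesis by (auto simp: p_def)
qed

text \<open>Since A/B = A B^(p-1) / B^p and derivations treat p-th powers as constants, the claim
  reduces to the polynomial A B^(p-1).\<close>

lemma kernel_rational:
  assumes x: "x \<in> M" and D: "\<And>D'. D' \<in> Ds' \<Longrightarrow> D' x = 0"
  shows "\<exists>y\<in>M. x = y ^ CHAR('b)"
proof -
  define p where "p = CHAR('b)"
  have p0: "p > 0" using char_pos by (simp add: p_def)
  obtain A B where AB: "A \<in> polys L" "B \<in> polys L" "B \<noteq> 0" "x = poly A t / poly B t" using x by (rule ME)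
  have B0: "poly B t \<noteq> 0" using AB eval_eq_0_iff by simp
  define C where "C = A * B ^ (p - 1)"
  have C: "C \<in> polys L" unfolding C_def using AB by (intro polys_mult polys_power) auto
  have "poly B t ^ p = poly B t * poly B t ^ (p - 1)" using p0 by (simp flip: power_Suc)
  then have Ct: "poly C t = x * poly B t ^ p" using B0 by (simp add: C_def AB(4) poly_power)
  have \<delta>C: "\<delta> C = 0" if \<delta>: "poly_derivation \<delta>" "fderiv \<delta> \<in> Ds'" for \<delta>
  proof -
    interpret D: derivation M "fderiv \<delta>" by (rule derivation_fderiv[OF \<delta>(1)])
    have BM: "poly B t \<in> M" using AB by (intro eval_M)
    have "fderiv \<delta> (poly C t) = fderiv \<delta> x * poly B t ^ p + x * fderiv \<delta> (poly B t ^ p)"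
      unfolding Ct using x BM by (intro D.D_mult M.power_mem) auto
    also have "fderiv \<delta> (poly B t ^ p) = 0" unfolding p_def using BM by (rule D.D_power_char)
    finally have "poly (\<delta> C) t = 0" using D[OF \<delta>(2)] fderiv_eval[OF \<delta>(1) C] by simp
    then show ?thesis using eval_eq_0_iff poly_derivationD(1)[OF \<delta>(1) C] by blast
  qed
  have "pderiv C = 0" using \<delta>C poly_derivation_pderiv by (simp add: Ds'_def)
  moreover have "map_poly D C = 0" if "D \<in> Ds" for D using \<delta>C[OF poly_derivation_map] that by (simp add: Ds'_def)
  ultimately obtain Q where Q: "Q \<in> polys L" "C = Q ^ p" using poly_kernel[OF C] by (auto simp: p_def)
  have "x = poly C t / poly B t ^ p" using Ct B0 by simp
  also have "\<dots> = (poly Q t / poly B t) ^ p" by (simp add: Q poly_power power_divide)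
  finally show ?thesis using Q AB MI by (auto simp: p_def)
qed

text \<open>At an irreducible polynomial all polynomials have nonnegative order, and at a Gauss
  place the claim is checked on coefficients.\<close>

lemma ord'_derivative:
  assumes k: "k \<in> V'" "k \<noteq> Inr 0" and \<delta>: "\<delta> = pderiv \<or> (\<exists>D\<in>Ds. \<delta> = map_poly D)"
    and A: "A \<in> polys L" "A \<noteq> 0" "ord' k A \<ge> 0" "\<delta> A \<noteq> 0"
  shows "ord' k (\<delta> A) \<ge> 0"
  using k(1)
proof (cases rule: V'_cases)
  case (gauss i)
  interpret vi: valued_field L "v i" using valued gauss by blast
  have g: "gv i A \<ge> 0" using A gauss by (simp add: ord'_def)
  have cf: "v i (coeff A j) \<ge> 0" if "coeff A j \<noteq> 0" for j using vi.gauss_le[OF that] g by linarith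
  have "gv i (\<delta> A) \<ge> 0"
  proof (rule vi.gauss_ge[OF A(4)])
    fix j assume nz: "coeff (\<delta> A) j \<noteq> 0"
    show "0 \<le> v i (coeff (\<delta> A) j)"
    proof (cases "\<delta> = pderiv")
      case True
      interpret R: subring_set "vi.atleast 0" by (rule vi.subring_atleast)
      have "coeff A (Suc j) \<in> vi.atleast 0" using cf A(1) by (intro vi.atleastI) auto
      then have "coeff (\<delta> A) j \<in> vi.atleast 0" unfolding True coeff_pderiv by (intro R.mult_mem R.of_nat_mem)
      then show ?thesis using nz vi.atleastD by blast
    next
      case False
      then obtain D where D: "D \<in> Ds" "\<delta> = map_poly D" using \<delta> by blast
      interpret D: derivation L D using deriv D by blast
      have "coeff (\<delta> A) j = D (coeff A j)" using D by simp
      moreover have "coeff A j \<noteq> 0" using nz calculation by auto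
      ultimately show ?thesis using all_deriv[OF gauss(2) D(1), of "coeff A j"] nz cf A(1) by (simp add: coeff_polys)
    qed
  qed
  then show ?thesis using gauss by (simp add: ord'_def)
qed (use k in \<open>auto simp: ord'_def\<close>)

text \<open>Every element of nonnegative value has a representation whose denominator has value zero.\<close>

lemma integral_representation:
  assumes k: "k \<in> V'" "k \<noteq> Inr 0" and x: "x \<in> M" "x \<noteq> 0" "v' k x \<ge> 0"
  obtains A B where "A \<in> polys L" "A \<noteq> 0" "ord' k A \<ge> 0" "B \<in> polys L" "B \<noteq> 0" "ord' k B = 0" "x = poly A t / poly B t"
proof -
  obtain A B where AB: "A \<in> polys L" "A \<noteq> 0" "B \<in> polys L" "B \<noteq> 0" "x = poly A t / poly B t"
    using x(1,2) by (rule ME_nz)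
  have le: "ord' k B \<le> ord' k A" using v'_eq[OF k(1) AB(1-4)] x(3) AB(5) by simp
  show ?thesis using k(1)
  proof (cases rule: V'_cases)
    case (gauss i)
    interpret vi: valued_field L "v i" using valued gauss by blast
    obtain u where u: "u \<in> L" "u \<noteq> 0" "v i u = 1" using all_uniformizer gauss by blast
    obtain j where j: "coeff B j \<noteq> 0" "gv i B = v i (coeff B j)" using vi.gauss_attained[OF AB(4)] by blast
    have "gv i B \<in> \<int>" unfolding j(2) using gauss(2) j(1) AB(3) by (intro all_int coeff_polys)
    then obtain e where e: "gv i B = of_int e" by (rule Ints_cases)
    \<comment> \<open>c is a constant whose value cancels that of the denominator.\<close>
    define c where "c = u powi (- e)"
    have c: "c \<in> L" "c \<noteq> 0" "v i c = - of_int e" using u by (auto simp: c_def power_int_mem vi.w_power_int)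
    show ?thesis
    proof (rule that[of "smult c A" "smult c B"])
      show "smult c A \<in> polys L" "smult c A \<noteq> 0" "smult c B \<in> polys L" "smult c B \<noteq> 0" using c AB by auto
      show "ord' k (smult c B) = 0" using gauss c AB e by (simp add: ord'_def vi.gauss_smult)
      show "ord' k (smult c A) \<ge> 0" using gauss c AB e le by (simp add: ord'_def vi.gauss_smult)
      show "x = poly (smult c A) t / poly (smult c B) t" using AB c by simp
    qed
  next
    case (irred P)
    note PL = irred_overD[OF irred(2)]
    define b where "b = pord P B"
    have "P ^ b dvd A"
    proof -
      have "b \<le> pord P A" using le irred by (simp add: ord'_def b_def)
      then show ?thesis using pord_power_dvd[OF PL(3) AB(2)] by (meson dvd_trans le_imp_power_dvd)
    qed
    then obtain A1 where A1: "A = P ^ b * A1" by (rule dvdE)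
    obtain B1 where B1: "B = P ^ b * B1" "\<not> P dvd B1" using pord_decompose[OF PL(3) AB(4)] by (auto simp: b_def)
    have nz: "A1 \<noteq> 0" "B1 \<noteq> 0" "P ^ b \<noteq> 0" using A1 B1 AB PL by auto
    have PbL: "P ^ b \<in> polys L" using PL by (intro polys_power)
    have "A1 = A div P ^ b" "B1 = B div P ^ b" unfolding A1 B1(1) using nz(3) by simp_all
    then have L1: "A1 \<in> polys L" "B1 \<in> polys L" using polys_div_mod(1)[OF _ PbL] AB by auto
    have "poly (P ^ b) t \<noteq> 0" using eval_eq_0_iff[OF PbL] nz by blast
    then have "poly (P ^ b) t * poly A1 t / (poly (P ^ b) t * poly B1 t) = poly A1 t / poly B1 t"
      by (rule nonzero_mult_divide_mult_cancel_left)
    then have "x = poly A1 t / poly B1 t" unfolding AB(5) A1 B1(1) poly_mult .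
    moreover have "pord P B1 = 0" using pord_pos_iff[OF PL(3) nz(2)] B1(2) by simp
    ultimately show ?thesis using that[of A1 B1] irred nz L1 by (simp add: ord'_def)
  qed (use k in simp)
qed

lemma degree_derivative:
  assumes \<delta>: "\<delta> = pderiv \<or> (\<exists>D\<in>Ds. \<delta> = map_poly D)"
  shows "degree (\<delta> A) \<le> degree A"
proof (cases "\<delta> = pderiv")
  case True
  show ?thesis unfolding True by (rule degree_le) (simp add: coeff_pderiv coeff_eq_0)
next
  case False
  then show ?thesis using \<delta> map_poly_degree_leq by auto
qed

lemma v'_deriv:
  assumes k: "k \<in> V'" and D: "D' \<in> Ds'" and x: "x \<in> M" "x \<noteq> 0" "v' k x \<ge> 0" and nz: "D' x \<noteq> 0"
  shows "v' k (D' x) \<ge> 0"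
proof -
  obtain \<delta> where \<delta>: "D' = fderiv \<delta>" "poly_derivation \<delta>" "\<delta> = pderiv \<or> (\<exists>D\<in>Ds. \<delta> = map_poly D)"
    using D by (rule Ds'_cases)
  show ?thesis
  proof (cases "k = Inr 0")
    case False
    obtain A B where AB: "A \<in> polys L" "A \<noteq> 0" "ord' k A \<ge> 0" "B \<in> polys L" "B \<noteq> 0" "ord' k B = 0" "x = poly A t / poly B t"
      using k False x by (rule integral_representation)
    have nz': "fderiv \<delta> (poly A t / poly B t) \<noteq> 0" using nz \<delta>(1) AB(7) by simp
    show ?thesis unfolding v'_def \<delta>(1) AB(7)
      by (rule fderiv_bound[OF poly_valuation_ord'[OF k] \<delta>(2) AB(1-6) ord'_derivative[OF k False \<delta>(3)] nz'])
  next
    \<comment> \<open>At infinity nonconstant polynomials have negative order, so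
      \<open>fderiv_bound\<close> is of no use. Instead, neither product in the quotient rule
      exceeds the degree of A B.\<close>
    case True
    obtain A B where AB: "A \<in> polys L" "A \<noteq> 0" "B \<in> polys L" "B \<noteq> 0" "x = poly A t / poly B t"
      using x(1,2) by (rule ME_nz)
    have le: "degree A \<le> degree B" using v'_eq[OF k AB(1-4)] x(3) AB(5) True by (simp add: ord'_def)
    define N where "N = \<delta> A * B - A * \<delta> B"
    have N: "N \<in> polys L" unfolding N_def using AB poly_derivationD(1)[OF \<delta>(2)] by (intro polys_diff polys_mult) auto
    have eq: "D' x = poly N t / poly (B * B) t" unfolding N_def \<delta>(1) AB(5) using AB by (intro fderiv_eq \<delta>)
    then have N0: "N \<noteq> 0" using nz by (metis div_0 poly_0)
    have "degree N \<le> degree A + degree B"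
      unfolding N_def
    proof (rule degree_diff_le)
      show "degree (\<delta> A * B) \<le> degree A + degree B"
        using degree_mult_le[of "\<delta> A" B] degree_derivative[OF \<delta>(3), of A] by linarith
      show "degree (A * \<delta> B) \<le> degree A + degree B"
        using degree_mult_le[of A "\<delta> B"] degree_derivative[OF \<delta>(3), of B] by linarith
    qed
    moreover have "degree (B * B) = degree B + degree B" using AB by (intro degree_mult_eq)
    moreover have "v' k (D' x) = real (degree (B * B)) - real (degree N)"
      unfolding eq using v'_eq[OF k N N0, of "B * B"] AB True by (simp add: polys_mult ord'_def)
    ultimately show ?thesis using le by simp
  qed
qed

lemma v'_integral:
  assumes k: "k \<in> V'" and x: "x \<in> M" "x \<noteq> 0"
  shows "v' k x \<in> \<int>"
proof -
  obtain A B where AB: "A \<in> polys L" "A \<noteq> 0" "B \<in> polys L" "B \<noteq> 0" "x = poly A t / poly B t"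
    using x by (rule ME_nz)
  have "ord' k C \<in> \<int>" if C: "C \<in> polys L" "C \<noteq> 0" for C using k
  proof (cases rule: V'_cases)
    case (gauss i)
    obtain j where j: "coeff C j \<noteq> 0" "gv i C = v i (coeff C j)"
      using valued_field.gauss_attained[OF valued[OF gauss(2)] C(2)] by blast
    have "gv i C \<in> \<int>" unfolding j(2) using gauss(2) j(1) C(1) by (intro all_int coeff_polys)
    then show ?thesis using gauss by (simp add: ord'_def)
  qed (auto simp: ord'_def)
  then show ?thesis using v'_eq[OF k AB(1-4)] AB by simp
qed

text \<open>If every derivation killed P, it would be a p-th power by \<open>poly_kernel\<close>,
  against irreducibility. A nonzero derivative of the monic P has no term of top degree, so P cannot
  divide it.\<close>

lemma irred_derivative:
  assumes P: "irred_over L P"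
  shows "\<exists>\<delta>. fderiv \<delta> \<in> Ds' \<and> poly_derivation \<delta> \<and> \<delta> P \<noteq> 0 \<and> \<not> P dvd \<delta> P"
proof -
  note PL = irred_overD[OF P]
  have lt: "\<not> P dvd A" if "A \<noteq> 0" "coeff A (degree P) = 0" "degree A \<le> degree P" for A
  proof
    assume "P dvd A"
    then have "degree P \<le> degree A" using that(1) by (rule dvd_imp_degree_le)
    then have "degree A = degree P" using that(3) by simp
    then show False using that(1,2) leading_coeff_neq_0[OF that(1)] by simp
  qed
  have "pderiv P \<noteq> 0 \<or> (\<exists>D\<in>Ds. map_poly D P \<noteq> 0)"
  proof (rule ccontr)
    assume "\<not> ?thesis"
    then obtain Q where Q: "Q \<in> polys L" "P = Q ^ CHAR('b)" using poly_kernel[OF PL(1)] by blast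
    have eq: "P = Q * Q ^ (CHAR('b) - 1)" using Q(2) char_pos by (simp flip: power_Suc)
    have QL: "Q ^ (CHAR('b) - 1) \<in> polys L" using Q by (intro polys_power)
    have "\<forall>A\<in>polys L. \<forall>B\<in>polys L. P = A * B \<longrightarrow> degree A = 0 \<or> degree B = 0"
      using P unfolding irred_over_def by (elim conjE)
    from mp[OF bspec[OF bspec[OF this Q(1)] QL] eq]
    have "degree Q = 0 \<or> degree (Q ^ (CHAR('b) - 1)) = 0" .
    moreover have "degree (Q ^ m) = m * degree Q" for m using Q PL by (intro degree_power_eq) auto
    ultimately have "degree Q = 0" using char_gt_1 by auto
    then have "degree P = 0" using Q \<open>\<And>m. degree (Q ^ m) = m * degree Q\<close> by simp
    then show False using PL(3) by simp
  qed
  then show ?thesis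
  proof
    assume nz: "pderiv P \<noteq> 0"
    have "\<not> P dvd pderiv P" using nz degree_derivative[of pderiv P] by (intro lt) (auto simp: coeff_pderiv coeff_eq_0)
    then show ?thesis using nz poly_derivation_pderiv by (auto simp: Ds'_def)
  next
    assume "\<exists>D\<in>Ds. map_poly D P \<noteq> 0"
    then obtain D where D: "D \<in> Ds" "map_poly D P \<noteq> 0" by blast
    interpret D: derivation L D using deriv D by blast
    have "\<not> P dvd map_poly D P" using D PL(2) degree_derivative[of "map_poly D" P] by (intro lt) auto
    then show ?thesis using D poly_derivation_map by (auto simp: Ds'_def)
  qed
qed

theorem rational_field_extension: "rational_field M V' d' v' S' Ds'"
proof (intro rational_field.intro product_formula_field.intro product_formula_field_axioms.intro rational_field_axioms.intro)
  show "subfield_set M" by (rule subfield_M)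
  show "Factorial_Ring.prime CHAR('b)" by (rule prime_char)
  show "d' k > 0" if "k \<in> V'" for k using that by (rule d'_pos)
  show "valued_field M (v' k)" if "k \<in> V'" for k
    using valued_fval[OF poly_valuation_ord'[OF that]] by (simp add: v'_def[abs_def])
  show "finite {k \<in> V'. v' k x \<noteq> 0}" "fsum (\<lambda>k. d' k * v' k x) V' = 0" if "x \<in> M" "x \<noteq> 0" for x
    using v'_support_formula that by auto
  show "finite {x \<in> M. x \<noteq> 0 \<and> fsum (\<lambda>k. d' k * max 0 (- v' k x)) V' \<le> B}" for B by (rule northcott_rational)
  show "finite Ds'" using finite_Ds by (simp add: Ds'_def)
  show "derivation M D'" if "D' \<in> Ds'" for D' using that derivation_fderiv by (auto elim: Ds'_cases)
  show "\<exists>y\<in>M. x = y ^ CHAR('b)" if "x \<in> M" "\<And>D'. D' \<in> Ds' \<Longrightarrow> D' x = 0" for x using that by (rule kernel_rational)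
  show "finite S'" using finite_S by (simp add: S'_def)
  show "S' \<subseteq> V'" using S_V by (auto simp: S'_def V'_def)
  show int: "v' k x \<in> \<int>" if "k \<in> V'" "x \<in> M" "x \<noteq> 0" for k x using that by (rule v'_integral)
  then show "v' k x \<in> \<int>" if "k \<in> V' - S'" "x \<in> M" "x \<noteq> 0" for k x using that by blast
  show der: "v' k (D' x) \<ge> 0" if "k \<in> V'" "D' \<in> Ds'" "x \<in> M" "x \<noteq> 0" "v' k x \<ge> 0" "D' x \<noteq> 0" for k D' x
    using that by (rule v'_deriv)
  then show "v' k (D' x) \<ge> 0" if "k \<in> V' - S'" "D' \<in> Ds'" "x \<in> M" "x \<noteq> 0" "v' k x \<ge> 0" "D' x \<noteq> 0" for k D' x
    using that by blast
  show "\<exists>C\<ge>0. \<forall>D'\<in>Ds'. \<forall>x\<in>M. x \<noteq> 0 \<longrightarrow> v' k x \<ge> 0 \<longrightarrow> D' x \<noteq> 0 \<longrightarrow> v' k (D' x) \<ge> - C" if "k \<in> V'" for k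
    using der that by (intro exI[of _ 0]) auto
  show unif: "\<exists>u\<in>M. u \<noteq> 0 \<and> v' k u = 1" if k: "k \<in> V'" for k using k
  proof (cases rule: V'_cases)
    case (gauss i)
    obtain u where u: "u \<in> L" "u \<noteq> 0" "v i u = 1" using all_uniformizer gauss by blast
    have "v' k (poly [:u:] t) = 1"
      using v'_eval[OF k, of "[:u:]"] gauss u by (simp add: pCons_polys_iff ord'_def valued_field.gauss_const[OF valued])
    then show ?thesis using u base_M by (intro bexI[of _ u]) auto
  next
    case (irred P)
    note PL = irred_overD[OF irred(2)]
    have "v' k (poly P t) = 1" using v'_eval[OF k PL(1,4)] irred pord_irred[OF irred(2,2)] by (simp add: ord'_def)
    then show ?thesis using eval_M PL eval_eq_0_iff by (intro bexI[of _ "poly P t"]) auto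
  next
    case inf
    have tL: "[:0, 1:] \<in> polys L" by (auto simp: pCons_polys_iff)
    have "v' k (poly 1 t / poly [:0, 1:] t) = 1" using v'_eq[OF k, of 1 "[:0, 1:]"] tL inf by (simp add: ord'_def)
    moreover have "poly 1 t / poly [:0, 1:] t \<in> M" using tL by (intro MI) auto
    moreover have "poly [:0, 1:] t \<noteq> 0" using eval_eq_0_iff[OF tL] by simp
    ultimately show ?thesis by (intro bexI[of _ "poly 1 t / poly [:0, 1:] t"]) auto
  qed
  show "\<exists>u\<in>M. u \<noteq> 0 \<and> v' k u > 0" if k: "k \<in> V'" for k using unif[OF k] by force
  show "\<exists>u\<in>M. \<exists>D'\<in>Ds'. u \<noteq> 0 \<and> v' k u = 1 \<and> D' u \<noteq> 0 \<and> v' k (D' u) = 0" if kS: "k \<in> V' - S'" for k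
  proof -
    have k: "k \<in> V'" using kS by simp
    show ?thesis using k
    proof (cases rule: V'_cases)
      case (gauss i)
      then have "i \<in> V - S" using kS by (auto simp: S'_def)
      then obtain u D where u: "u \<in> L" "D \<in> Ds" "u \<noteq> 0" "v i u = 1" "D u \<noteq> 0" "v i (D u) = 0"
        using good_uniformizer by blast
      interpret D: derivation L D using deriv u by blast
      have Du: "D u \<in> L" using D.D_mem u by blast
      have c: "v' k (poly [:c:] t) = v i c" if "c \<in> L" "c \<noteq> 0" for c
        using v'_eval[OF k, of "[:c:]"] gauss that by (simp add: pCons_polys_iff ord'_def valued_field.gauss_const[OF valued])
      have "fderiv (map_poly D) (poly [:u:] t) = poly (map_poly D [:u:]) t"
        using u by (intro fderiv_eval poly_derivation_map) (auto simp: pCons_polys_iff)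
      then have "fderiv (map_poly D) u = D u" by (simp add: map_poly_pCons)
      then show ?thesis using u Du c[of u] c[of "D u"] base_M
        by (intro bexI[of _ u] bexI[of _ "fderiv (map_poly D)"]) (auto simp: Ds'_def)
    next
      case (irred P)
      note PL = irred_overD[OF irred(2)]
      obtain \<delta> where \<delta>: "fderiv \<delta> \<in> Ds'" "poly_derivation \<delta>" "\<delta> P \<noteq> 0" "\<not> P dvd \<delta> P"
        using irred_derivative[OF irred(2)] by blast
      have dP: "\<delta> P \<in> polys L" using poly_derivationD(1)[OF \<delta>(2) PL(1)] .
      have "v' k (poly P t) = 1" using v'_eval[OF k PL(1,4)] irred pord_irred[OF irred(2,2)] by (simp add: ord'_def)
      moreover have "fderiv \<delta> (poly P t) = poly (\<delta> P) t" by (rule fderiv_eval[OF \<delta>(2) PL(1)])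
      moreover have "v' k (poly (\<delta> P) t) = 0"
        using v'_eval[OF k dP \<delta>(3)] irred pord_pos_iff[OF PL(3) \<delta>(3)] \<delta>(4) by (simp add: ord'_def)
      moreover have "poly (\<delta> P) t \<noteq> 0" "poly P t \<noteq> 0" using eval_eq_0_iff dP PL \<delta> by auto
      ultimately show ?thesis using eval_M[OF PL(1)] \<delta>(1) by (intro bexI[of _ "poly P t"] bexI[of _ "fderiv \<delta>"]) auto
    next
      case inf
      then show ?thesis using kS by (simp add: S'_def)
    qed
  qed
qed

end

section \<open>Construction of the base field\<close>

text \<open>Each extension changes the type of the places. Transport along an injection returns to
  one fixed type, so that the construction can be iterated under an existential quantifier.\<close>

lemma product_formula_field_reindex:
  fixes L :: "'b::field set"
  assumes "product_formula_field L V d v S Ds" "inj_on h V"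
  defines "g \<equiv> inv_into V h"
  shows "product_formula_field L (h ` V) (\<lambda>k. d (g k)) (\<lambda>k. v (g k)) (h ` S) Ds"
proof -
  interpret product_formula_field L V d v S Ds by fact
  have g: "g (h i) = i" if "i \<in> V" for i using assms(2) that by (simp add: g_def)
  have gV: "g k \<in> V" if "k \<in> h ` V" for k using g that by auto
  have gS: "g k \<in> V - S" if "k \<in> h ` V - h ` S" for k using g that by auto
  have fs: "fsum (\<lambda>k. f (g k)) (h ` V) = fsum f V" for f
    unfolding fsum_image[OF assms(2)] by (intro fsum_cong) (simp add: g)
  show ?thesis
  proof (intro product_formula_field.intro product_formula_field_axioms.intro)
    show "subfield_set L" by (rule subfield_set_axioms)
    show "finite {k \<in> h ` V. v (g k) x \<noteq> 0}" if "x \<in> L" "x \<noteq> 0" for x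
    proof (rule finite_subset[OF _ finite_imageI[OF finite_support[OF that]]])
      show "{k \<in> h ` V. v (g k) x \<noteq> 0} \<subseteq> h ` {i \<in> V. v i x \<noteq> 0}" using g by auto
    qed
    show "fsum (\<lambda>k. d (g k) * v (g k) x) (h ` V) = 0" if "x \<in> L" "x \<noteq> 0" for x
      using product_formula[OF that] fs[of "\<lambda>i. d i * v i x"] by simp
    show "finite {x \<in> L. x \<noteq> 0 \<and> fsum (\<lambda>k. d (g k) * max 0 (- v (g k) x)) (h ` V) \<le> B}" for B
      using northcott[of B] fs[of "\<lambda>i. d i * max 0 (- v i _)"] by simp
    show "finite (h ` S)" "h ` S \<subseteq> h ` V" using finite_S S_V by auto
    show "Factorial_Ring.prime CHAR('b)" by (rule prime_char)
    show "finite Ds" by (rule finite_Ds)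
    show "derivation L D" if "D \<in> Ds" for D using that by (rule deriv)
    show "\<exists>y\<in>L. x = y ^ CHAR('b)" if "x \<in> L" "\<And>D. D \<in> Ds \<Longrightarrow> D x = 0" for x using that by (rule kernel)
  qed (fact weight_pos[OF gV] valued[OF gV] good_int[OF gS] good_uniformizer[OF gS]
      good_deriv[OF gS] nontrivial[OF gV] bounded_deriv[OF gV])+
qed

lemma rational_field_reindex:
  fixes L :: "'b::field set"
  assumes "rational_field L V d v S Ds" "inj_on h V"
  defines "g \<equiv> inv_into V h"
  shows "rational_field L (h ` V) (\<lambda>k. d (g k)) (\<lambda>k. v (g k)) (h ` S) Ds"
proof -
  interpret rational_field L V d v S Ds by fact
  have gV: "g k \<in> V" if "k \<in> h ` V" for k using that unfolding g_def by (rule inv_into_into)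
  show ?thesis
  proof (intro rational_field.intro rational_field_axioms.intro)
    show "product_formula_field L (h ` V) (\<lambda>k. d (g k)) (\<lambda>k. v (g k)) (h ` S) Ds"
      unfolding g_def by (rule product_formula_field_reindex[OF product_formula_field_axioms assms(2)])
  qed (fact all_int[OF gV] all_uniformizer[OF gV] all_deriv[OF gV])+
qed

text \<open>A single index type that absorbs the places created by either kind of extension.\<close>

type_synonym 'b place = "('b poly \<times> nat) list"

definition has_product_formula :: "'b::field set \<Rightarrow> bool" where
  "has_product_formula L \<longleftrightarrow> (\<exists>(V :: 'b place set) d v S Ds. product_formula_field L V d v S Ds)"

definition has_rational_product_formula :: "'b::field set \<Rightarrow> bool" where
  "has_rational_product_formula L \<longleftrightarrow> (\<exists>(V :: 'b place set) d v S Ds. rational_field L V d v S Ds)"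

lemma has_rational_imp: "has_rational_product_formula L \<Longrightarrow> has_product_formula L"
  unfolding has_rational_product_formula_def has_product_formula_def rational_field_def by blast

lemma has_rational_extension:
  fixes L :: "'b::field set"
  assumes "has_rational_product_formula L" "t \<notin> algebraic_over L"
  shows "has_rational_product_formula (transcendental_extension.M L t)"
proof -
  obtain V d v S Ds where R: "rational_field L (V :: 'b place set) d v S Ds"
    using assms(1) unfolding has_rational_product_formula_def by blast
  then interpret rational_field L V d v S Ds .
  interpret rational_extension L V d v S Ds t by unfold_locales (rule assms(2))
  \<comment> \<open>The second component of the head tells the cases apart: 0 marks an inherited
    place, 1 a new one.\<close>
  define h :: "'b place + 'b poly \<Rightarrow> 'b place" where "h = case_sum (\<lambda>i. (0, 0) # i) (\<lambda>P. [(P, 1)])"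
  have "inj h" by (auto simp: h_def inj_def split: sum.splits)
  then have "inj_on h V'" by (rule inj_on_subset) simp
  from rational_field_reindex[OF rational_field_extension this] show ?thesis
    unfolding has_rational_product_formula_def by blast
qed

lemma has_product_formula_extension:
  fixes L :: "'b::alg_closed_field set"
  assumes "has_product_formula L" "simple_extension L F \<theta>"
  shows "has_product_formula (adjoin L (\<theta> 0))"
proof -
  obtain V d v S Ds where R: "product_formula_field L (V :: 'b place set) d v S Ds"
    using assms(1) unfolding has_product_formula_def by blast
  then interpret product_formula_field L V d v S Ds .
  interpret simple_extension L F \<theta> by fact
  have "\<forall>i. \<exists>RGW. i \<in> V \<longrightarrow> extended_valuation L (v i) (fst RGW) (fst (snd RGW)) (snd (snd RGW))"
  proof
    fix i
    show "\<exists>RGW. i \<in> V \<longrightarrow> extended_valuation L (v i) (fst RGW) (fst (snd RGW)) (snd (snd RGW))"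
    proof (cases "i \<in> V")
      case True
      obtain u where u: "u \<in> L" "u \<noteq> 0" "v i u > 0" using nontrivial True by blast
      obtain R G W where "extended_valuation L (v i) R G W"
        using valued_field.exists_extension[OF valued[OF True] u] by blast
      then show ?thesis by (intro exI[of _ "(R, G, W)"]) simp
    qed simp
  qed
  from choice[OF this] obtain RGW where RGW: "\<And>i. i \<in> V \<Longrightarrow>
    extended_valuation L (v i) (fst (RGW i)) (fst (snd (RGW i))) (snd (snd (RGW i)))" by blast
  interpret product_formula_extension L F \<theta> V d v S Ds "\<lambda>i. fst (RGW i)" "\<lambda>i. fst (snd (RGW i))" "\<lambda>i. snd (snd (RGW i))"
    by (intro product_formula_extension.intro product_formula_extension_axioms.intro R assms(2) RGW)
  \<comment> \<open>The number of the embedding is pushed onto the name of the place below.\<close>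
  define h :: "'b place \<times> nat \<Rightarrow> 'b place" where "h = (\<lambda>(i, l). (0, l) # i)"
  have "inj h" by (auto simp: h_def inj_def)
  then have "inj_on h (V \<times> {..<n})" by (rule inj_on_subset) simp
  from product_formula_field_reindex[OF product_formula_field_ext this] show ?thesis
    unfolding has_product_formula_def by blast
qed

text \<open>The prime field is finite, so Northcott holds with no places at all, and by Fermat's
  little theorem each element is its own p-th power, so no derivation is called for.\<close>

lemma has_rational_prime_field:
  assumes p: "Factorial_Ring.prime CHAR('b::field)"
  shows "has_rational_product_formula (range (of_nat :: nat \<Rightarrow> 'b))"
proof -
  define p where "p = CHAR('b)"
  have p1: "p > 1" using prime_gt_1_nat[OF assms] by (simp add: p_def)
  have cong: "(of_nat (k mod p) :: 'b) = of_nat k" for k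
  proof -
    have "(of_nat k :: 'b) = of_nat (p * (k div p) + k mod p)" by simp
    also have "\<dots> = of_nat p * of_nat (k div p) + of_nat (k mod p)" by (simp only: of_nat_add of_nat_mult)
    finally show ?thesis by (simp add: p_def)
  qed
  have pow: "(of_nat k :: 'b) ^ p = of_nat k" for k
  proof (induction k)
    case 0
    then show ?case using p1 by simp
  next
    case (Suc k)
    have "(of_nat (Suc k) :: 'b) ^ p = (1 + of_nat k) ^ p" by simp
    also have "\<dots> = 1 ^ p + of_nat k ^ p" unfolding p_def by (rule frobenius_add[OF assms])
    finally show ?case using Suc by simp
  qed
  have "subfield_set (range (of_nat :: nat \<Rightarrow> 'b))"
  proof
    show "0 \<in> range (of_nat :: nat \<Rightarrow> 'b)" "1 \<in> range (of_nat :: nat \<Rightarrow> 'b)"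
      by (auto intro: range_eqI[of _ _ 0] range_eqI[of _ _ 1])
    fix x assume "x \<in> range (of_nat :: nat \<Rightarrow> 'b)"
    then obtain k where k: "x = of_nat k" by auto
    have "(of_nat ((p - 1) * k) :: 'b) + of_nat k = of_nat (p * k)"
      using p1 by (simp flip: of_nat_add add: algebra_simps)
    also have "\<dots> = 0" by (simp add: p_def)
    finally have "(of_nat k :: 'b) + of_nat ((p - 1) * k) = 0" by (simp only: add.commute)
    then have "- x = of_nat ((p - 1) * k)" unfolding k by (rule minus_unique)
    then show "- x \<in> range (of_nat :: nat \<Rightarrow> 'b)" by blast
    show "inverse x \<in> range (of_nat :: nat \<Rightarrow> 'b)"
    proof (cases "x = 0")
      case False
      have "x * (x * x ^ (p - 2)) = x ^ p"
        using p1 by (simp flip: power_Suc) (metis Suc_diff_Suc Suc_1 numeral_2_eq_2 diff_Suc_1 Suc_lessD less_imp_Suc_add)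
      then have "x * x ^ (p - 2) = 1" using False pow[of k] by (simp add: k)
      then have "inverse x = x ^ (p - 2)" by (rule inverse_unique)
      then have "inverse x = of_nat (k ^ (p - 2))" by (simp add: k)
      then show ?thesis by blast
    qed (auto intro: range_eqI[of _ _ 0])
    fix y assume "y \<in> range (of_nat :: nat \<Rightarrow> 'b)"
    then obtain j where j: "y = of_nat j" by auto
    show "x + y \<in> range (of_nat :: nat \<Rightarrow> 'b)" "x * y \<in> range (of_nat :: nat \<Rightarrow> 'b)"
      unfolding k j by (auto simp flip: of_nat_add of_nat_mult)
  qed
  moreover have fin: "finite (range (of_nat :: nat \<Rightarrow> 'b))"
  proof (rule finite_subset)
    show "range (of_nat :: nat \<Rightarrow> 'b) \<subseteq> of_nat ` {..<p}"
    proof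
      fix x assume "x \<in> range (of_nat :: nat \<Rightarrow> 'b)"
      then obtain k where "x = of_nat k" by auto
      then have "x = of_nat (k mod p)" by (simp add: cong)
      then show "x \<in> of_nat ` {..<p}" using p1 by auto
    qed
  qed simp
  moreover have "\<exists>y\<in>range of_nat. x = y ^ CHAR('b)" if "x \<in> range (of_nat :: nat \<Rightarrow> 'b)" for x
    using that pow by (auto simp: p_def)
  ultimately have "rational_field (range (of_nat :: nat \<Rightarrow> 'b)) ({} :: 'b place set) (\<lambda>_. 1) (\<lambda>_ _. 0) {} {}"
    using p by (intro rational_field.intro product_formula_field.intro product_formula_field_axioms.intro rational_field_axioms.intro)
      (auto simp: fsum_def intro: finite_subset[OF _ fin])
  then show ?thesis unfolding has_rational_product_formula_def by blast
qed

section \<open>Transcendental generators and separable powers of the algebraic ones\<close>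

lemma algebraic_over_mono: "L \<subseteq> M \<Longrightarrow> algebraic_over L \<subseteq> algebraic_over M"
  unfolding algebraic_over_def using polys_mono[of L M] by blast

lemma (in subfield_set) base_algebraic: "L \<subseteq> algebraic_over L"
proof
  fix x assume "x \<in> L"
  then show "x \<in> algebraic_over L"
    unfolding algebraic_over_def by (intro CollectI bexI[of _ "[:- x, 1:]"]) (auto simp: pCons_polys_iff)
qed

text \<open>A generator is adjoined only when it is transcendental over the field reached so far;
  the adjoined ones form a transcendence basis.\<close>

lemma exists_rational_base:
  fixes z :: "nat \<Rightarrow> 'b::field"
  assumes "Factorial_Ring.prime CHAR('b)"
  shows "\<exists>L. has_rational_product_formula L \<and> (\<forall>j<n. z j \<in> algebraic_over L)"
proof (induction n)
  case 0
  then show ?case using has_rational_prime_field[OF assms] by blast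
next
  case (Suc n)
  then obtain L where L: "has_rational_product_formula L" "\<And>j. j < n \<Longrightarrow> z j \<in> algebraic_over L" by blast
  show ?case
  proof (cases "z n \<in> algebraic_over L")
    case True
    then show ?thesis using L by (intro exI[of _ L]) (auto simp: less_Suc_eq)
  next
    case False
    interpret subfield_set L
      using L(1) unfolding has_rational_product_formula_def rational_field_def product_formula_field_def by blast
    interpret transcendental_extension L "z n" by unfold_locales (rule False)
    have "z n \<in> algebraic_over M" using M.base_algebraic generator_M by blast
    moreover have "z j \<in> algebraic_over M" if "j < n" for j using L(2)[OF that] algebraic_over_mono[OF base_M] by blast
    ultimately show ?thesis using has_rational_extension[OF L(1) False]
      by (intro exI[of _ M]) (auto simp: less_Suc_eq)
  qed
qed

text \<open>All exponents in A are divisible by p, so A(X) = B(X^p), and the degree drops.\<close>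

lemma (in subfield_set) pderiv_eq_0_contract:
  assumes A: "A \<in> polys L" "degree A > 0" "pderiv A = 0" and p: "Factorial_Ring.prime CHAR('b)"
  shows "\<exists>B\<in>polys L. B \<noteq> 0 \<and> degree B < degree A \<and> (\<forall>x. poly A x = poly B (x ^ CHAR('b)))"
proof -
  define p where "p = CHAR('b)"
  have p1: "p > 1" using prime_gt_1_nat[OF assms(4)] by (simp add: p_def)
  have c0: "coeff A j = 0" if "\<not> p dvd j" for j
  proof (cases j)
    case (Suc k)
    have "of_nat (Suc k) * coeff A (Suc k) = 0" using arg_cong[OF A(3), of "\<lambda>P. coeff P k"] by (simp add: coeff_pderiv)
    moreover have "(of_nat (Suc k) :: 'b) \<noteq> 0" using that Suc of_nat_eq_0_iff_char_dvd[where 'a = 'b] by (simp add: p_def del: of_nat_Suc)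
    ultimately show ?thesis using Suc by simp
  qed (use that in simp)
  define m where "m = degree A"
  define B where "B = (\<Sum>k\<le>m. Polynomial.monom (coeff A (p * k)) k)"
  have B: "B \<in> polys L" unfolding B_def using A by (intro polys_sum polys_monom) auto
  have cB: "coeff B k = (if k \<le> m then coeff A (p * k) else 0)" for k
    by (simp add: B_def coeff_sum)
  have lcA: "coeff A m \<noteq> 0" using A(2) by (auto simp: m_def)
  then obtain q where q: "m = p * q" using c0 by blast
  have "q \<le> m" using q p1 by simp
  then have B0: "B \<noteq> 0" using cB[of q] lcA q by auto
  have "coeff B (degree B) \<noteq> 0" using B0 by simp
  then have "coeff A (p * degree B) \<noteq> 0" using cB[of "degree B"] by (auto split: if_splits)
  then have "p * degree B \<le> m" unfolding m_def by (rule le_degree)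
  then have "degree B < m" using p1 A(2) unfolding m_def
    by (cases "degree B = 0") (auto intro: less_le_trans[of _ "p * degree B"])
  moreover have "poly A x = poly B (x ^ p)" for x
  proof -
    have inj: "inj_on (\<lambda>k. p * k) {..m}" using p1 by (auto simp: inj_on_def)
    have "poly B (x ^ p) = (\<Sum>k\<le>m. coeff A (p * k) * x ^ (p * k))"
      by (simp add: B_def poly_sum poly_monom power_mult)
    also have "\<dots> = (\<Sum>j\<in>(\<lambda>k. p * k) ` {..m}. coeff A j * x ^ j)" by (simp add: sum.reindex[OF inj])
    also have "\<dots> = (\<Sum>j\<le>p * m. coeff A j * x ^ j)"
    proof (rule sum.mono_neutral_left)
      show "\<forall>j\<in>{..p * m} - (\<lambda>k. p * k) ` {..m}. coeff A j * x ^ j = 0"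
      proof
        fix j assume j: "j \<in> {..p * m} - (\<lambda>k. p * k) ` {..m}"
        have "\<not> p dvd j"
        proof
          assume "p dvd j"
          then obtain k where k: "j = p * k" by (rule dvdE)
          then have "k \<le> m" using j p1 by simp
          then show False using j k by blast
        qed
        then show "coeff A j * x ^ j = 0" using c0 by simp
      qed
    qed (auto simp: mult_le_mono2)
    also have "\<dots> = (\<Sum>j\<le>m. coeff A j * x ^ j)"
    proof (rule sum.mono_neutral_right)
      show "{..m} \<subseteq> {..p * m}" using p1 by auto
      show "\<forall>j\<in>{..p * m} - {..m}. coeff A j * x ^ j = 0" by (auto simp: m_def coeff_eq_0)
    qed simp
    finally show ?thesis by (simp add: poly_altdef m_def)
  qed
  ultimately show ?thesis using B B0 by (auto simp: m_def p_def)
qed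

text \<open>Inseparability is removed by passing from z to its p-th power, which strictly lowers the
  degree of the minimal polynomial.\<close>

lemma (in subfield_set) exists_separable_power:
  assumes p: "Factorial_Ring.prime CHAR('b)" and P: "irred_over L P" "poly P z = 0"
  shows "\<exists>e Q. irred_over L Q \<and> poly Q (z ^ (CHAR('b) ^ e)) = 0 \<and> pderiv Q \<noteq> 0"
  using P
proof (induction "degree P" arbitrary: P z rule: less_induct)
  case less
  show ?case
  proof (cases "pderiv P = 0")
    case False
    then show ?thesis using less.prems by (intro exI[of _ 0] exI[of _ P]) auto
  next
    case True
    obtain B where B: "B \<in> polys L" "B \<noteq> 0" "degree B < degree P" "\<And>x. poly P x = poly B (x ^ CHAR('b))"
      using pderiv_eq_0_contract[OF irred_overD(1,3)[OF less.prems(1)] True p] by blast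
    have Bz: "poly B (z ^ CHAR('b)) = 0" using B(4)[of z] less.prems(2) by simp
    obtain P' where P': "irred_over L P'" "poly P' (z ^ CHAR('b)) = 0" using exists_min_poly[OF B(1,2) Bz] by blast
    have "P' dvd B" using irred_over_root_dvd[OF P' B(1) Bz] .
    then have "degree P' \<le> degree B" using B(2) by (rule dvd_imp_degree_le)
    then have "degree P' < degree P" using B(3) by simp
    from less.hyps[OF this P'] obtain e Q where "irred_over L Q" "poly Q ((z ^ CHAR('b)) ^ (CHAR('b) ^ e)) = 0" "pderiv Q \<noteq> 0"
      by blast
    then show ?thesis by (intro exI[of _ "Suc e"] exI[of _ Q]) (simp add: power_mult)
  qed
qed

text \<open>P is prime to its nonzero derivative, which has smaller degree, so its roots are simple
  and can be listed without repetition, with z first.\<close>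

lemma exists_simple_extension:
  fixes L :: "'b::alg_closed_field set"
  assumes "subfield_set L" and P: "irred_over L P" "poly P z = 0" "pderiv P \<noteq> 0"
  shows "\<exists>\<theta>. simple_extension L P \<theta> \<and> \<theta> 0 = z"
proof -
  interpret subfield_set L by fact
  note PL = irred_overD[OF P(1)]
  have dlt: "degree (pderiv P) < degree P"
  proof -
    have "degree (pderiv P) \<le> degree P - 1" by (rule degree_le) (auto simp: coeff_pderiv coeff_eq_0)
    then show ?thesis using PL(3) by simp
  qed
  have "\<not> P dvd pderiv P" using dvd_imp_degree_le[of P "pderiv P"] P(3) dlt by auto
  then obtain U W where UW: "U * P + W * pderiv P = 1" using irred_over_bezout[OF P(1) polys_pderiv[OF PL(1)]] by blast
  have simple: "poly (pderiv P) x \<noteq> 0" if "poly P x = 0" for x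
  proof
    assume "poly (pderiv P) x = 0"
    then have "poly (U * P + W * pderiv P) x = 0" using that by simp
    then show False by (simp add: UW)
  qed
  obtain A where A: "size A = degree P" "P = smult (lead_coeff P) (\<Prod>x\<in>#A. [:- x, 1:])"
    using alg_closed_imp_factorization[OF PL(4)] by blast
  have PA: "P = (\<Prod>x\<in>#A. [:- x, 1:])" using A(2) PL(2) by simp
  have count: "count A x \<le> 1" for x
  proof (rule ccontr)
    assume "\<not> count A x \<le> 1"
    then have "{#x, x#} \<subseteq># A" by (simp add: subseteq_mset_def)
    then obtain A' where "A = {#x, x#} + A'" by (metis subset_mset.le_iff_add)
    then have "P = [:- x, 1:] * ([:- x, 1:] * (\<Prod>x\<in>#A'. [:- x, 1:]))" using PA by simp
    then have "poly P x = 0" "poly (pderiv P) x = 0" by (simp_all add: pderiv_mult del: mult_pCons_left)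
    then show False using simple by blast
  qed
  have A_set: "A = mset_set (set_mset A)"
  proof (rule multiset_eqI)
    fix x
    show "count A x = count (mset_set (set_mset A)) x"
      using count[of x] by (cases "x \<in># A") (auto simp: not_in_iff count_greater_zero_iff[symmetric] le_Suc_eq simp del: count_greater_zero_iff)
  qed
  have zA: "z \<in># A"
  proof -
    have "(\<Prod>x\<in>#A. z - x) = 0" using P(2) PA by (simp add: poly_prod_mset)
    then show ?thesis by auto
  qed
  obtain xs where xs: "set xs = set_mset A - {z}" "distinct xs" using finite_distinct_list[of "set_mset A - {z}"] by auto
  define ys where "ys = z # xs"
  have ys: "set ys = set_mset A" "distinct ys" using xs zA by (auto simp: ys_def)
  have len: "length ys = degree P"
    using A(1) distinct_card[OF ys(2)] ys(1) A_set by (metis size_mset_set)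
  have bij: "bij_betw ((!) ys) {..<degree P} (set_mset A)"
    using bij_betw_nth[OF ys(2)] len ys(1) by simp
  have "P = (\<Prod>x\<in>set_mset A. [:- x, 1:])"
    using PA A_set by (metis prod_unfold_prod_mset)
  also have "\<dots> = (\<Prod>l<degree P. [:- (ys ! l), 1:])"
    using prod.reindex_bij_betw[OF bij, of "\<lambda>x. [:- x, 1:]"] by simp
  finally have "simple_extension L P ((!) ys)"
    using P(1) bij by unfold_locales (auto simp: bij_betw_def)
  then show ?thesis by (intro exI[of _ "(!) ys"]) (simp add: ys_def)
qed

text \<open>Generators are adjoined one at a time, each in a power that is separable over the
  current field. The exponents accumulate, since a power of an element of L by p^f stays in the
  extension.\<close>

lemma exists_product_formula_field:
  fixes z :: "nat \<Rightarrow> 'b::alg_closed_field"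
  assumes p: "Factorial_Ring.prime CHAR('b)"
  shows "\<exists>L e. has_product_formula L \<and> (\<forall>j<n. z j ^ (CHAR('b) ^ e) \<in> L)"
proof -
  obtain L0 where L0: "has_rational_product_formula L0" "\<And>j. j < n \<Longrightarrow> z j \<in> algebraic_over L0"
    using exists_rational_base[OF p] by blast
  have "\<exists>L e. L0 \<subseteq> L \<and> has_product_formula L \<and> (\<forall>j<m. z j ^ (CHAR('b) ^ e) \<in> L)" if "m \<le> n" for m
    using that
  proof (induction m)
    case 0
    then show ?case using has_rational_imp[OF L0(1)] by auto
  next
    case (Suc m)
    then obtain L e where L: "L0 \<subseteq> L" "has_product_formula L" "\<And>j. j < m \<Longrightarrow> z j ^ (CHAR('b) ^ e) \<in> L" by auto
    have sub: "subfield_set L" using L(2) unfolding has_product_formula_def product_formula_field_def by blast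
    interpret subfield_set L by (rule sub)
    have "z m \<in> algebraic_over L" using L0(2)[of m] Suc.prems algebraic_over_mono[OF L(1)] by auto
    then obtain P where P: "irred_over L P" "poly P (z m) = 0" using exists_min_poly by (auto simp: algebraic_over_def)
    obtain f Q where Q: "irred_over L Q" "poly Q (z m ^ (CHAR('b) ^ f)) = 0" "pderiv Q \<noteq> 0"
      using exists_separable_power[OF p P] by blast
    obtain \<theta> where \<theta>: "simple_extension L Q \<theta>" "\<theta> 0 = z m ^ (CHAR('b) ^ f)"
      using exists_simple_extension[OF sub Q] by blast
    have pf: "has_product_formula (adjoin L (\<theta> 0))" by (rule has_product_formula_extension[OF L(2) \<theta>(1)])
    interpret E: subfield_set "adjoin L (\<theta> 0)" using pf unfolding has_product_formula_def product_formula_field_def by blast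
    have "z j ^ (CHAR('b) ^ (e + f)) \<in> adjoin L (\<theta> 0)" if "j < Suc m" for j
    proof (cases "j = m")
      case True
      have "(\<theta> 0) ^ (CHAR('b) ^ e) \<in> adjoin L (\<theta> 0)" using generator_adjoin by (rule E.power_mem)
      then show ?thesis using True \<theta>(2) by (simp add: power_add mult.commute flip: power_mult)
    next
      case False
      then have "z j ^ (CHAR('b) ^ e) \<in> adjoin L (\<theta> 0)" using L(3)[of j] that base_subset_adjoin by auto
      then have "(z j ^ (CHAR('b) ^ e)) ^ (CHAR('b) ^ f) \<in> adjoin L (\<theta> 0)" by (rule E.power_mem)
      then show ?thesis by (simp add: power_add flip: power_mult)
    qed
    moreover have "L0 \<subseteq> adjoin L (\<theta> 0)" using L(1) base_subset_adjoin by blast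
    ultimately show ?case using pf by blast
  qed
  then show ?thesis by blast
qed

section \<open>Descent to the given field\<close>

lemma minus_ring_of_type_algebra:
  fixes x :: "'a::field"
  shows "\<ominus>\<^bsub>(ring_of_type_algebra :: 'a ring)\<^esub> x = - x"
proof -
  interpret K: Ring.field "ring_of_type_algebra :: 'a ring" by (rule field_from_type_algebra)
  have "x \<oplus>\<^bsub>(ring_of_type_algebra :: 'a ring)\<^esub> (\<ominus>\<^bsub>(ring_of_type_algebra :: 'a ring)\<^esub> x) = \<zero>\<^bsub>(ring_of_type_algebra :: 'a ring)\<^esub>"
    by (rule K.r_neg) (simp add: ring_of_type_algebra_def)
  then have "x + (\<ominus>\<^bsub>(ring_of_type_algebra :: 'a ring)\<^esub> x) = 0" by (simp add: ring_of_type_algebra_def)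
  then show ?thesis by (rule minus_unique[symmetric])
qed

lemma inv_ring_of_type_algebra:
  fixes x :: "'a::field"
  assumes "x \<noteq> 0"
  shows "inv\<^bsub>(ring_of_type_algebra :: 'a ring)\<^esub> x = inverse x"
proof -
  interpret K: Ring.field "ring_of_type_algebra :: 'a ring" by (rule field_from_type_algebra)
  have "x \<in> Units (ring_of_type_algebra :: 'a ring)"
    using assms unfolding K.field_Units by (simp add: ring_of_type_algebra_def)
  from K.Units_r_inv[OF this] have "x * (inv\<^bsub>(ring_of_type_algebra :: 'a ring)\<^esub> x) = 1"
    by (simp add: ring_of_type_algebra_def)
  then show ?thesis by (rule inverse_unique[symmetric])
qed

text \<open>\<open>generate_field\<close> speaks of the operations of a ring record. The two
  preceding lemmas identify its inverses with those of the type class, which gives an induction rule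
  free of the record.\<close>

lemma generated_subfield_induct [consumes 1, case_names one gen uminus inverse add mult]:
  fixes x :: "'a::field"
  assumes "x \<in> generated_subfield Z"
    and "P 1" "\<And>z. z \<in> Z \<Longrightarrow> P z" "\<And>x. P x \<Longrightarrow> P (- x)" "\<And>x. P x \<Longrightarrow> x \<noteq> 0 \<Longrightarrow> P (inverse x)"
      "\<And>x y. P x \<Longrightarrow> P y \<Longrightarrow> P (x + y)" "\<And>x y. P x \<Longrightarrow> P y \<Longrightarrow> P (x * y)"
  shows "P x"
  using assms(1)
proof (induction rule: generate_field.induct)
  case one
  show ?case using assms(2) by (simp add: ring_of_type_algebra_def)
next
  case (incl h)
  then show ?case by (rule assms(3))
next
  case (a_inv h)
  show ?case using assms(4)[OF a_inv.IH] by (simp add: minus_ring_of_type_algebra)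
next
  case (m_inv h)
  have "h \<noteq> 0" using m_inv.hyps by (simp add: ring_of_type_algebra_def)
  then show ?case using assms(5)[OF m_inv.IH] by (simp add: inv_ring_of_type_algebra)
next
  case (eng_add h1 h2)
  show ?case using assms(6)[OF eng_add.IH] by (simp add: ring_of_type_algebra_def)
next
  case (eng_mult h1 h2)
  show ?case using assms(7)[OF eng_mult.IH] by (simp add: ring_of_type_algebra_def)
qed

lemma frobenius_power_inj:
  fixes x y :: "'b::field"
  assumes "Factorial_Ring.prime CHAR('b)" "x ^ (CHAR('b) ^ k) = y ^ (CHAR('b) ^ k)"
  shows "x = y"
  using assms(2)
proof (induction k)
  case (Suc k)
  have "(x ^ (CHAR('b) ^ k)) ^ CHAR('b) = (y ^ (CHAR('b) ^ k)) ^ CHAR('b)"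
    using Suc.prems by (simp add: mult.commute flip: power_mult)
  then show ?case using Suc.IH frobenius_inj[OF assms(1)] by blast
qed simp

theorem theorem1:
  fixes p r :: nat and z :: "nat \<Rightarrow> 'a::field" and a b :: 'a
  assumes "Factorial_Ring.prime p"
    and "CHAR('a) = p"
    and "generated_subfield (z ` {1..r}) = UNIV"
    and "a \<noteq> 0" and "b \<noteq> 0"
  shows "\<exists>T :: ('a \<times> 'a) set. finite T \<and>
    (\<forall>(x::'a) (y::'a) (m::nat) (n::nat).
       m > 1 \<longrightarrow> n > 1 \<longrightarrow> coprime m p \<longrightarrow> coprime n p \<longrightarrow>
       (m, n) \<notin> {(2, 2), (2, 3), (3, 2), (2, 4), (4, 2), (3, 3)} \<longrightarrow>
       a * x ^ m + b * y ^ n = 1 \<longrightarrow>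
       (\<exists>(\<gamma>, \<delta>) \<in> T. \<exists>t::nat. a * x ^ m = \<gamma> ^ (p ^ t) \<and> b * y ^ n = \<delta> ^ (p ^ t)))"
proof -
  have char: "CHAR('a) = p" "CHAR('a alg_closure) = p" using assms(2) by simp_all
  have pa: "Factorial_Ring.prime CHAR('a)" and pb: "Factorial_Ring.prime CHAR('a alg_closure)"
    using assms(1) by (simp_all add: char)
  obtain L e where L: "has_product_formula L" "\<And>j. j < r \<Longrightarrow> to_ac (z (Suc j)) ^ (p ^ e) \<in> L"
    using exists_product_formula_field[OF pb, of r "\<lambda>j. to_ac (z (Suc j))"] unfolding char by blast
  obtain V :: "'a alg_closure place set" and d v S Ds where "product_formula_field L V d v S Ds"
    using L(1) unfolding has_product_formula_def by blast
  then interpret product_formula_field L V d v S Ds .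
  \<comment> \<open>The twisted embedding \<phi> is an injective ring homomorphism into L. It
    carries the equation to one over L with coefficients \<phi> a and \<phi> b.\<close>
  define \<phi> where "\<phi> x = to_ac x ^ (p ^ e)" for x :: 'a
  have \<phi>_add: "\<phi> (x + y) = \<phi> x + \<phi> y" for x y
    unfolding \<phi>_def by (simp add: freshmans_dream'[OF pb] char)
  have \<phi>_mult: "\<phi> (x * y) = \<phi> x * \<phi> y" and \<phi>_power: "\<phi> (x ^ k) = \<phi> x ^ k" for x y k
    by (simp_all add: \<phi>_def power_mult_distrib mult.commute flip: power_mult)
  have \<phi>_0: "\<phi> 0 = 0" and \<phi>_1: "\<phi> 1 = 1" using prime_gt_0_nat[OF assms(1)] by (simp_all add: \<phi>_def)
  have \<phi>_inj: "x = y" if "\<phi> x = \<phi> y" for x y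
    using frobenius_power_inj[OF pb, of "to_ac x" e "to_ac y"] that by (simp add: \<phi>_def char)
  have \<phi>_L: "\<phi> x \<in> L" for x
  proof -
    have "x \<in> generated_subfield (z ` {1..r})" using assms(3) by simp
    then show ?thesis
    proof (induction rule: generated_subfield_induct)
      case (gen x)
      then obtain j where j: "j \<in> {1..r}" "x = z j" by blast
      then have "j - 1 < r" by auto
      then show ?case using L(2)[of "j - 1"] j by (simp add: \<phi>_def)
    next
      case (uminus x)
      have "\<phi> x + \<phi> (- x) = 0" using \<phi>_0 by (simp flip: \<phi>_add)
      then have "\<phi> (- x) = - \<phi> x" by (rule minus_unique[symmetric])
      then show ?case using uminus by auto
    next
      case (inverse x)
      then show ?case using inverse_mem[of "\<phi> x"] by (simp add: \<phi>_def power_inverse)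
    qed (auto simp: \<phi>_1 \<phi>_add \<phi>_mult intro: add_mem mult_mem)
  qed
  have nz: "\<phi> a \<noteq> 0" "\<phi> b \<noteq> 0" using assms(4,5) \<phi>_inj[of _ 0] by (auto simp: \<phi>_0)
  obtain \<Gamma> where \<Gamma>: "finite \<Gamma>" "\<And>x y m n. x \<in> L \<Longrightarrow> y \<in> L \<Longrightarrow> m > 1 \<Longrightarrow> n > 1 \<Longrightarrow>
      coprime m p \<Longrightarrow> coprime n p \<Longrightarrow> (m, n) \<notin> {(2, 2), (2, 3), (3, 2), (2, 4), (4, 2), (3, 3)} \<Longrightarrow>
      \<phi> a * x ^ m + \<phi> b * y ^ n = 1 \<Longrightarrow> \<exists>\<gamma>\<in>\<Gamma>. \<exists>t. \<phi> a * x ^ m = \<gamma> ^ (p ^ t)"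
    using finite_generators[OF \<phi>_L nz(1) \<phi>_L nz(2)] unfolding char by metis
  \<comment> \<open>An element \<gamma> of \<Gamma> need not come from the given field. The
    exponents t for which its power by p^t does are closed upwards, so the power with the least one
    generates all the others; a single root per \<gamma> therefore suffices.\<close>
  define t0 where "t0 \<gamma> = (LEAST t. \<gamma> ^ (p ^ t) \<in> range \<phi>)" for \<gamma>
  define root where "root \<gamma> = (SOME u. \<phi> u = \<gamma> ^ (p ^ t0 \<gamma>))" for \<gamma>
  define T where "T = (\<lambda>\<gamma>. (root \<gamma>, 1 - root \<gamma>)) ` \<Gamma>"
  have main: "\<exists>(\<gamma>, \<delta>)\<in>T. \<exists>t. a * x ^ m = \<gamma> ^ (p ^ t) \<and> b * y ^ n = \<delta> ^ (p ^ t)"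
    if mn: "m > 1" "n > 1" "coprime m p" "coprime n p" "(m, n) \<notin> {(2, 2), (2, 3), (3, 2), (2, 4), (4, 2), (3, 3)}"
      and eq: "a * x ^ m + b * y ^ n = 1" for x y m n
  proof -
    have "\<phi> (a * x ^ m + b * y ^ n) = \<phi> 1" by (simp only: eq)
    then have "\<phi> a * \<phi> x ^ m + \<phi> b * \<phi> y ^ n = 1" by (simp only: \<phi>_add \<phi>_mult \<phi>_power \<phi>_1)
    from \<Gamma>(2)[OF \<phi>_L \<phi>_L mn this] obtain \<gamma> t where \<gamma>: "\<gamma> \<in> \<Gamma>" "\<phi> a * \<phi> x ^ m = \<gamma> ^ (p ^ t)" by blast
    have t: "\<phi> (a * x ^ m) = \<gamma> ^ (p ^ t)" using \<gamma>(2) by (simp only: \<phi>_mult \<phi>_power)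
    then have mem: "\<gamma> ^ (p ^ t) \<in> range \<phi>" by (metis rangeI)
    then have "\<gamma> ^ (p ^ t0 \<gamma>) \<in> range \<phi>" unfolding t0_def by (rule LeastI)
    then have "\<exists>u. \<phi> u = \<gamma> ^ (p ^ t0 \<gamma>)" by (metis rangeE)
    then have r: "\<phi> (root \<gamma>) = \<gamma> ^ (p ^ t0 \<gamma>)" unfolding root_def by (rule someI_ex)
    have le: "t0 \<gamma> \<le> t" using mem unfolding t0_def by (rule Least_le)
    define k where "k = t - t0 \<gamma>"
    have "\<phi> (root \<gamma> ^ (p ^ k)) = \<gamma> ^ (p ^ t)"
      using le by (simp add: \<phi>_power r k_def flip: power_mult power_add)
    then have ax: "a * x ^ m = root \<gamma> ^ (p ^ k)" using \<phi>_inj t by simp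
    \<comment> \<open>Additivity of the Frobenius identifies the partner of
      \<open>root \<gamma>\<close> as 1 - \<open>root \<gamma>\<close>, with the same
      exponent.\<close>
    have "root \<gamma> ^ (p ^ k) + (1 - root \<gamma>) ^ (p ^ k) = (root \<gamma> + (1 - root \<gamma>)) ^ (p ^ k)"
      by (rule freshmans_dream'[symmetric, OF pa]) (simp add: char)
    then have "a * x ^ m + (1 - root \<gamma>) ^ (p ^ k) = a * x ^ m + b * y ^ n" by (simp add: ax eq[unfolded ax])
    then have "b * y ^ n = (1 - root \<gamma>) ^ (p ^ k)" by (simp only: add_left_cancel)
    then show ?thesis using ax \<gamma>(1) unfolding T_def by auto
  qed
  have fin: "finite T" using \<Gamma>(1) by (simp add: T_def)
  show ?thesis by (intro exI[of _ T] conjI allI impI fin main)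
qed

end
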